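(* For $z\in\mathcal A$ we have $$\log f(z+1)=-\frac12+\frac{\ln(2/\sqrt{\pi})}{z}+\frac{\ln(\sqrt{\pi})}{\operatorname{Log}(z+1)}+\frac12\int_1^\infty\frac{d_2((t-1)/2)}{z+t}\,dt.$$ In particular, $x\mapsto \frac12+\log f(x+1)$ is a Stieltjes function on $(0,\infty)$, and $x\mapsto f(x+1)$ is completely monotonic on $(0,\infty)$.
   Context: $\mathcal A=\mathbb C\setminus(-\infty,0]$. $\operatorname{Log}$ is the principal logarithm on $\mathcal A$, $\ln$ is the natural logarithm of positive numbers, and $\log\Gamma(z)$ is the holomorphic branch of the logarithm of $\Gamma$ on $\mathcal A$ that equals $\ln\Gamma(x)$ for $x>0$. The function $f$ is $$f(x)=\left(\frac{\pi^{x/2}}{\Gamma(1+x/2)}\right)^{1/(x\ln x)},\qquad x>0,\ x\neq 1,$$ and $\log f(z)$ denotes the holomorphic extension of $\ln f(x)$ to $\mathcal A\setminus\{1\}$, i.e. $$\log f(z)=\frac{(z/2)\ln\pi-\log\Gamma(1+z/2)}{z\operatorname{Log} z}.$$ The function $d_2$ on $[0,\infty)$ is defined by $$d_2(t)=\frac{\ln|\Gamma(1-t)|+(k-1)\ln(2t)}{t\left((\ln(2t))^2+\pi^2\right)}\quad\text{for } t\in(k-1,k),\ k=1,2,\ldots,$$ with $d_2(0)=0$ and $d_2(k)=\infty$ for $k=1,2,\ldots$. A Stieltjes function is a function $g:(0,\infty)\to\mathbb R$ of the form $g(x)=c+\int_0^\infty\frac{d\mu(t)}{x+t}$ with $c\ge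 0$ and $\mu$ a non-negative measure on $[0,\infty)$ with $\int_0^\infty\frac{d\mu(t)}{1+t}<\infty$. A function $\varphi:(0,\infty)\to\mathbb R$ is completely monotonic if it is $C^\infty$ and $(-1)^n\varphi^{(n)}(x)\ge 0$ for all $x>0$, $n\ge 0$. *)

theory Defs
  imports "HOL-Complex_Analysis.Complex_Analysis"
begin

definition ball_f :: "real \<Rightarrow> real" where
  "ball_f x = (pi powr (x / 2) / Gamma (1 + x / 2)) powr (1 / (x * ln x))"

text \<open>
  On the cut plane (the complement of \<^term>\<open>\<real>\<^sub>\<le>\<^sub>0 :: complex set\<close>), \<^term>\<open>ln :: complex \<Rightarrow> complex\<close>
  is the principal logarithm, and \<^term>\<open>ln_Gamma :: complex \<Rightarrow> complex\<close> is the holomorphic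
  branch of the logarithm of the Gamma function that is real on the positive half-line.
\<close>

definition log_ball_f :: "complex \<Rightarrow> complex" where
  "log_ball_f z = (z / 2 * of_real (ln pi) - ln_Gamma (1 + z / 2)) / (z * ln z)"

lemma log_ball_f_of_real:
  assumes "x > 0" "x \<noteq> 1"
  shows "log_ball_f (of_real x) = of_real (ln (ball_f x))"
proof -
  have "ln_Gamma (1 + complex_of_real x / 2) = of_real (ln (Gamma (1 + x / 2)))"
    using ln_Gamma_complex_of_real[of "1 + x / 2"] ln_Gamma_real_pos[of "1 + x / 2"] assms
    by simp
  moreover have "ln (complex_of_real x) = of_real (ln x)"
    using assms by (simp add: Ln_of_real)
  moreover have "ln (ball_f x) = (x / 2 * ln pi - ln (Gamma (1 + x / 2))) / (x * ln x)"
    using assms Gamma_real_pos[of "1 + x / 2"] by (simp add: ball_f_def ln_powr ln_div less_imp_neq[symmetric])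
  ultimately show ?thesis
    by (simp add: log_ball_f_def)
qed

lemma holomorphic_log_ball_f: "log_ball_f holomorphic_on (- \<real>\<^sub>\<le>\<^sub>0 - {1})"
proof -
  have *: "1 + z / 2 \<notin> \<real>\<^sub>\<le>\<^sub>0" if "z \<notin> \<real>\<^sub>\<le>\<^sub>0" for z :: complex
    using that by (auto simp: complex_nonpos_Reals_iff)
  have "ln z \<noteq> 0" if "z \<notin> \<real>\<^sub>\<le>\<^sub>0" "z \<noteq> 1" for z :: complex
    using that by (metis exp_Ln exp_zero nonpos_Reals_zero_I)
  moreover have "(\<lambda>z. ln_Gamma (1 + z / 2) :: complex) holomorphic_on (- \<real>\<^sub>\<le>\<^sub>0 - {1})"
    using * by (intro holomorphic_on_compose_gen[OF _ holomorphic_ln_Gamma[of "- \<real>\<^sub>\<le>\<^sub>0"],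
        unfolded o_def] holomorphic_intros) auto
  ultimately show ?thesis
    unfolding log_ball_f_def by (intro holomorphic_intros) auto
qed

text \<open>
  For \<^term>\<open>t\<close> strictly between \<^term>\<open>real k - 1\<close> and \<^term>\<open>real k\<close>, the index \<^term>\<open>k\<close> is the
  ceiling of \<^term>\<open>t\<close>.  Only the values on the closed half-line \<^term>\<open>{0::real..}\<close> are meaningful.
\<close>

definition d2 :: "real \<Rightarrow> ereal" where
  "d2 t =
    (if t = 0 then 0
     else if t \<in> \<nat> then \<infinity>
     else ereal ((ln \<bar>Gamma (1 - t)\<bar> + (of_int \<lceil>t\<rceil> - 1) * ln (2 * t)) /
                 (t * ((ln (2 * t))\<^sup>2 + pi\<^sup>2))))"

lemma d2_0: "d2 0 = 0"
  and d2_of_nat: "k \<ge> 1 \<Longrightarrow> d2 (of_nat k) = \<infinity>"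
  by (auto simp: d2_def)

lemma d2_between:
  assumes "k \<ge> (1::nat)" "real k - 1 < t" "t < real k"
  shows "d2 t = ereal ((ln \<bar>Gamma (1 - t)\<bar> + (real k - 1) * ln (2 * t)) /
                       (t * ((ln (2 * t))\<^sup>2 + pi\<^sup>2)))"
proof -
  have c: "\<lceil>t\<rceil> = int k"
    using assms by (intro ceiling_unique) auto
  have "t \<notin> \<nat>"
    using assms c by (auto elim!: Nats_cases)
  moreover have "t \<noteq> 0"
    using assms by auto
  ultimately show ?thesis
    using c by (simp add: d2_def)
qed

text \<open>Only the values of \<^term>\<open>g :: real \<Rightarrow> real\<close> on the open positive half-line matter below.\<close>

definition stieltjes_function :: "(real \<Rightarrow> real) \<Rightarrow> bool" where
  "stieltjes_function g \<longleftrightarrow>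
    (\<exists>c M. c \<ge> 0 \<and> sets M = sets (restrict_space borel {0::real..}) \<and>
       (\<integral>\<^sup>+ t. ennreal (1 / (1 + t)) \<partial>M) < \<infinity> \<and>
       (\<forall>x>0. g x = c + (\<integral> t. 1 / (x + t) \<partial>M)))"

definition completely_monotonic :: "(real \<Rightarrow> real) \<Rightarrow> bool" where
  "completely_monotonic g \<longleftrightarrow>
    (\<forall>n. \<forall>x>0. (deriv ^^ n) g differentiable (at x) \<and> (-1) ^ n * (deriv ^^ n) g x \<ge> 0)"

end

theory Submission
  imports Defs
begin

text \<open>
  Put \<open>u = z + 1\<close>.  By Euler's product, \<open>log \<Gamma>(1 + u/2) / (u Log u)\<close> is the sum over
  \<open>j \<ge> 1\<close> of the functions \<open>((u/2) ln(1 + 1/j) - Log(1 + u/(2j))) / (u Log u)\<close>, each of which is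
  holomorphic in the cut plane except for a simple pole at \<open>u = 1\<close> and has boundary values on the
  cut with at most a logarithmic singularity.  In the variable \<open>w = Log u\<close> the cut plane is the
  strip \<open>\<bar>Im w\<bar> < \<pi>\<close>, and the residue theorem on rectangles exhausting the strip expresses the
  difference of the values of such a function at two points by its jump across the cut.  Taking
  differences makes every integral absolutely convergent, so the formulas can be summed over \<open>j\<close>,
  and the jumps add up to \<open>d\<^sub>2\<close>.  Since \<open>d\<^sub>2 \<ge> 0\<close>, one of the two points can be sent to infinity by
  monotone convergence, where \<open>ln n! \<sim> n ln n\<close> gives the constant \<open>-1/2\<close>.  The same argument
  applied to \<open>1 / Log u\<close> provides its Stieltjes representation.  Finally, the exponential of a
  Stieltjes function lies in a class of non-negative functions that is closed under \<open>-d/dx\<close>.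
\<close>

text \<open>The obstacle is \<open>ln_Gamma\<close> near the cut:
  \<open>ln_Gamma (1 + u / 2)\<close> has a logarithmic branch point at every
  \<open>u = -2j\<close>, so a contour argument for the whole function would have to be estimated
  between infinitely many singularities. A single Euler factor has one logarithmic singularity on
  the cut, and near the cut its size is controlled by a function of \<open>|u|\<close> alone, which
  dominates at every height of the strip. The price is uniformity in \<open>j\<close>: the jumps
  need a majorant that is summable in \<open>j\<close> and integrable in \<open>t\<close>. The
  exponents 5/4, 3/4 and 1/4 below come from trading powers of \<open>t\<close> for powers of
  \<open>j\<close> so that both sides converge with room to spare. The order of the limits matters.
  The jump of a single factor changes sign, being positive for small \<open>t\<close> and negative
  for large \<open>t\<close>; only the sum over \<open>j\<close> is non-negative. So monotone
  convergence becomes available after the summation, and until then everything is kept in two-point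
  form.\<close>

section \<open>Distance to the cut, residues, and horizontal contour segments\<close>

lemma norm_exp_i_plus_1_le:
  fixes y :: real
  assumes "\<bar>y\<bar> \<le> pi"
  shows "norm (exp (\<i> * of_real y) + 1) \<le> pi - \<bar>y\<bar>"
proof -
  have eq: "norm (exp (\<i> * of_real z) + 1) = 2 * \<bar>cos (z / 2)\<bar>" for z
  proof -
    have "exp (\<i> * of_real z) + 1 = exp (\<i> * of_real (z / 2)) * (2 * cos (of_real (z / 2) :: complex))"
      unfolding cos_exp_eq by (simp add: ring_distribs mult.left_commute[of _ 2] flip: exp_add)
    then show ?thesis
      by (simp only: cos_of_real norm_mult norm_exp_i_times norm_of_real) simp
  qed
  have "cos (y / 2) \<ge> 0"
    using assms by (intro cos_ge_zero) auto
  then have "2 * \<bar>cos (y / 2)\<bar> = 2 * sin (pi / 2 - \<bar>y\<bar> / 2)"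
    by (simp add: sin_diff abs_if)
  also have "\<dots> \<le> pi - \<bar>y\<bar>"
    using sin_x_le_x[of "pi / 2 - \<bar>y\<bar> / 2"] assms by simp
  finally show ?thesis
    by (simp add: eq)
qed

text \<open>For large \<open>r\<close> the triangle inequality yields half of \<open>1 + r\<close>;
  on the remaining compact interval the distance has a positive minimum because \<open>u\<close> is
  off the cut. This linear bound controls the Cauchy kernels below.\<close>

lemma norm_add_cut_plane_ge:
  fixes u :: complex
  assumes "u \<notin> \<real>\<^sub>\<le>\<^sub>0"
  obtains d where "d > 0" "\<And>r. r \<ge> 0 \<Longrightarrow> norm (of_real r + u) \<ge> d * (1 + r)"
proof -
  define f where "f = (\<lambda>r. norm (of_real r + u))"
  have "continuous_on {0..2 * norm u + 1} f"
    unfolding f_def by (intro continuous_intros)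
  then obtain r0 where r0: "r0 \<in> {0..2 * norm u + 1}" "\<And>r. r \<in> {0..2 * norm u + 1} \<Longrightarrow> f r0 \<le> f r"
    using continuous_attains_inf[of "{0..2 * norm u + 1}" f] by force
  have "of_real r0 + u \<noteq> 0"
  proof
    assume "of_real r0 + u = 0"
    then have "u = of_real (- r0)"
      by (simp add: add_eq_0_iff)
    with assms r0(1) show False
      by (metis atLeastAtMost_iff neg_le_0_iff_le nonpos_Reals_of_real_iff)
  qed
  then have pos: "f r0 > 0"
    by (simp add: f_def)
  define d where "d = min (1/2) (f r0 / (2 * norm u + 2))"
  show thesis
  proof
    show "d > 0"
      using pos by (auto simp: d_def intro!: divide_pos_pos add_nonneg_pos)
    fix r :: real assume r: "r \<ge> 0"
    show "norm (of_real r + u) \<ge> d * (1 + r)"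
    proof (cases "r \<le> 2 * norm u + 1")
      case True
      have "d * (1 + r) \<le> f r0 / (2 * norm u + 2) * (2 * norm u + 2)"
        using True r pos by (intro mult_mono) (auto simp: d_def)
      also have "\<dots> = f r0"
        using norm_ge_zero[of u] by (simp del: norm_ge_zero)
      also have "\<dots> \<le> f r"
        using r0 True r by auto
      finally show ?thesis by (simp add: f_def)
    next
      case False
      have "d \<le> 1/2"
        unfolding d_def by (rule min.cobounded1)
      then have "d * (1 + r) \<le> 1/2 * (1 + r)"
        using r by (intro mult_right_mono) auto
      also have "\<dots> \<le> r - norm u"
        using False by simp
      also have "\<dots> \<le> norm (of_real r + u)"
        using norm_diff_triangle_ineq[of "of_real r + u" u 0 0] r norm_triangle_ineq4[of "of_real r + u" u] by simp
      finally show ?thesis .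
    qed
  qed
qed

text \<open>Near the edges \<open>exp w\<close> differs from \<open>- exp (Re w)\<close> by at most
  \<open>exp (Re w)\<close> times the distance to the edge. Staying within \<open>d / 2\<close> of
  \<open>pi\<close> costs at most half of the bound valid at \<open>- exp (Re w)\<close>, uniformly
  in \<open>Re w\<close>; dominated convergence relies on this uniformity.\<close>

lemma norm_exp_minus_cut_plane_ge:
  fixes u :: complex
  assumes "u \<notin> \<real>\<^sub>\<le>\<^sub>0"
  obtains c \<eta> where "c > 0" "\<eta> < pi"
    "\<And>w. \<lbrakk>\<eta> \<le> \<bar>Im w\<bar>; \<bar>Im w\<bar> \<le> pi\<rbrakk> \<Longrightarrow> norm (exp w - u) \<ge> c * (1 + exp (Re w))"
proof -
  obtain d where d: "d > 0" "\<And>r. r \<ge> 0 \<Longrightarrow> norm (of_real r + u) \<ge> d * (1 + r)"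
    using norm_add_cut_plane_ge[OF assms] by metis
  show thesis
  proof
    show "d / 2 > 0" "pi - d / 2 < pi"
      using d by simp_all
    fix w :: complex assume w: "pi - d / 2 \<le> \<bar>Im w\<bar>" "\<bar>Im w\<bar> \<le> pi"
    define r where "r = exp (Re w)"
    have "exp w = of_real r * exp (\<i> * of_real (Im w))"
      by (simp only: exp_eq_polar[of w] r_def cis_conv_exp)
    then have eq: "exp w - u = of_real r * (exp (\<i> * of_real (Im w)) + 1) - (of_real r + u)"
      by (simp add: algebra_simps)
    have r: "r > 0" by (simp add: r_def)
    have "norm (of_real r * (exp (\<i> * of_real (Im w)) + 1)) \<le> r * (pi - \<bar>Im w\<bar>)"
      using norm_exp_i_plus_1_le[OF w(2)] r by (simp add: norm_mult)
    also have "\<dots> \<le> (1 + r) * (d / 2)"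
      using r w by (intro mult_mono) auto
    finally have "norm (of_real r * (exp (\<i> * of_real (Im w)) + 1)) \<le> (1 + r) * (d / 2)" .
    moreover have "norm (of_real r + u) - norm (of_real r * (exp (\<i> * of_real (Im w)) + 1)) \<le> norm (exp w - u)"
      unfolding eq by (metis norm_minus_commute norm_triangle_ineq2)
    moreover have "d * (1 + r) \<le> norm (of_real r + u)"
      using d(2)[of r] r by simp
    moreover have "d * (1 + r) = (1 + r) * (d / 2) + d / 2 * (1 + r)"
      by simp
    ultimately show "d / 2 * (1 + exp (Re w)) \<le> norm (exp w - u)"
      unfolding r_def[symmetric] by linarith
  qed
qed

text \<open>If \<open>f z = 0\<close> the singularity is removable. Writing \<open>f\<close> as
  \<open>(f + 1) - 1\<close> then gives two genuine simple poles whose residues cancel. This case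
  matters because the symbol may vanish at any of the three poles below.\<close>

lemma residue_divide_simple_zero:
  assumes holo: "f holomorphic_on S" "g holomorphic_on S" and S: "open S" "connected S" "z \<in> S"
    and g': "(g has_field_derivative g') (at z)" and z: "g z = 0" "g' \<noteq> 0"
    and nz: "\<And>w. \<lbrakk>w \<in> S; w \<noteq> z\<rbrakk> \<Longrightarrow> g w \<noteq> 0"
  shows "residue (\<lambda>w. f w / g w) z = f z / g'"
proof (cases "f z = 0")
  case False
  then show ?thesis
    using residue_simple_pole_deriv[OF holo S g' _ z] by simp
next
  case True
  have "residue (\<lambda>w. (f w + 1) / g w - 1 / g w) z =
        residue (\<lambda>w. (f w + 1) / g w) z - residue (\<lambda>w. 1 / g w) z"
    using S nz by (intro residue_diff[of S]) (auto intro!: holomorphic_intros intro: holomorphic_on_subset[OF holo(1)] holomorphic_on_subset[OF holo(2)])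
  also have "residue (\<lambda>w. (f w + 1) / g w) z = (f z + 1) / g'"
    using True by (intro residue_simple_pole_deriv[OF _ holo(2) S g' _ z]) (auto intro!: holomorphic_intros holo)
  also have "residue (\<lambda>w. 1 / g w) z = 1 / g'"
    by (intro residue_simple_pole_deriv[OF _ holo(2) S g' _ z]) (auto intro!: holomorphic_intros holo)
  finally show ?thesis
    using True by (simp add: add_divide_distrib)
qed

lemma has_contour_integral_linepath_same_Im_iff:
  assumes "a < b"
  shows "(f has_contour_integral I) (linepath (Complex a c) (Complex b c)) \<longleftrightarrow>
         ((\<lambda>x. f (Complex x c)) has_integral I) {a..b}"
proof -
  have "(f has_contour_integral I) (linepath (Complex a c) (Complex b c)) \<longleftrightarrow>
          ((\<lambda>x. f (linepath (Complex a c) (Complex b c) x) * of_real (b - a)) has_integral I) {0..1}"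
    by (simp add: has_contour_integral_linepath Complex_eq)
  also have "\<dots> \<longleftrightarrow> ((\<lambda>x. f (Complex (a + (b - a) * x) c) * of_real (b - a)) has_integral I) {0..1}"
    by (intro has_integral_cong arg_cong2[of _ _ _ _ "(*)"] arg_cong[of _ _ f])
       (auto simp: linepath_def complex_eq_iff algebra_simps)
  also have "{0..1} = (\<lambda>x. x / (b - a)) ` {0..b-a}"
    using assms by simp
  also have "((\<lambda>x. f (Complex (a + (b - a) * x) c) * of_real (b - a)) has_integral I) \<dots> \<longleftrightarrow>
             ((\<lambda>x. f (Complex (a + x) c) * of_real (b-a)) has_integral ((b-a) *\<^sub>R I)) {0..b-a}"
    by (subst has_integral_stretch_real_iff) (use assms in simp_all)
  also have "\<dots> \<longleftrightarrow> ((\<lambda>x. of_real (b-a) * f (Complex x c)) has_integral (b-a) *\<^sub>R I) {a..b}"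
    by (subst has_integral_shift_real_ivl_iff[where c = "-a"])
       (simp_all add: scaleR_conv_of_real mult_ac)
  also have "\<dots> \<longleftrightarrow> ((\<lambda>x. f (Complex x c)) has_integral I) {a..b}"
    by (simp only: scaleR_conv_of_real, subst has_integral_mult_right_iff) (use assms in auto)
  finally show ?thesis .
qed

section \<open>A two-point formula from boundary values on the cut\<close>

abbreviation pi_strip :: "complex set" where
  "pi_strip \<equiv> {w. \<bar>Im w\<bar> < pi}"

lemma open_pi_strip: "open pi_strip"
  and connected_pi_strip: "connected pi_strip"
proof -
  have eq: "pi_strip = {w. Im w < pi} \<inter> {w. - pi < Im w}"
    by auto
  show "open pi_strip"
    unfolding eq using open_halfspace_Im_lt open_halfspace_Im_gt by blast
  show "connected pi_strip"
    unfolding eq by (intro convex_connected convex_Int convex_halfspace_Im_lt convex_halfspace_Im_gt)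
qed

lemma Ln_in_pi_strip: "u \<notin> \<real>\<^sub>\<le>\<^sub>0 \<Longrightarrow> \<bar>Im (Ln u)\<bar> < pi"
  using Im_Ln_less_pi[of u] mpi_less_Im_Ln[of u] by (cases "u = 0") (auto simp: complex_nonpos_Reals_iff)

text \<open>
  In the variable \<^term>\<open>w = Ln z\<close> the cut plane becomes a strip, and this is the Cauchy kernel
  for \<^term>\<open>u\<close> minus the one for \<^term>\<open>v\<close>; the difference decays at both ends of the strip.
\<close>

definition strip_kernel :: "complex \<Rightarrow> complex \<Rightarrow> complex \<Rightarrow> complex" where
  "strip_kernel u v w = exp w * (u - v) / ((exp w - u) * (exp w - v))"

text \<open>The factor \<open>exp w\<close> in the kernel makes the residue of
  \<open>exp w / (exp w - u)\<close> at \<open>Ln u\<close> equal to 1. Dividing by \<open>w\<close>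
  adds the pole at 0, the image of the point 1. The assumptions on \<open>u\<close> and
  \<open>v\<close> keep the three poles distinct and hence simple.\<close>

lemma contour_integral_strip_kernel:
  assumes A: "A holomorphic_on pi_strip"
    and u: "u \<notin> \<real>\<^sub>\<le>\<^sub>0" "u \<noteq> 1" and v: "v \<notin> \<real>\<^sub>\<le>\<^sub>0" "v \<noteq> 1" and uv: "u \<noteq> v"
    and T: "0 < M" "0 < \<theta>" "\<theta> < pi"
      "\<bar>Re (Ln u)\<bar> < M" "\<bar>Im (Ln u)\<bar> < \<theta>" "\<bar>Re (Ln v)\<bar> < M" "\<bar>Im (Ln v)\<bar> < \<theta>"
  shows "contour_integral (rectpath (Complex (-M) (-\<theta>)) (Complex M \<theta>))
           (\<lambda>w. A w / w * strip_kernel u v w) =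
         2 * pi * \<i> * (A 0 * (1 / (1 - u) - 1 / (1 - v)) + A (Ln u) / Ln u - A (Ln v) / Ln v)"
proof -
  define f where "f = (\<lambda>w. A w * (exp w * (u - v)))"
  define g where "g = (\<lambda>w. w * ((exp w - u) * (exp w - v)))"
  define pts where "pts = {0, Ln u, Ln v}"
  let ?\<gamma> = "rectpath (Complex (-M) (-\<theta>)) (Complex M \<theta>)"
  have u0: "u \<noteq> 0" and v0: "v \<noteq> 0" using u v by auto
  have ln: "exp w = p \<longleftrightarrow> w = Ln p" if "w \<in> pi_strip" "p \<noteq> 0" for w p
    using that by auto
  have [simp]: "Ln u \<noteq> 0" "Ln v \<noteq> 0" "Ln u \<noteq> Ln v"
    using u v uv u0 v0 by (metis exp_Ln exp_zero)+
  have S: "0 \<in> pi_strip" "Ln u \<in> pi_strip" "Ln v \<in> pi_strip"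
    using Ln_in_pi_strip u v by auto
  have fg: "A w / w * strip_kernel u v w = f w / g w" for w
    by (simp add: f_def g_def strip_kernel_def)
  have holo: "f holomorphic_on pi_strip" "g holomorphic_on pi_strip"
    unfolding f_def g_def by (intro holomorphic_intros A)+
  have nz: "g w \<noteq> 0" if "w \<in> pi_strip - pts" for w
    using that ln[of w] u0 v0 by (auto simp: g_def pts_def)
  have box: "pts \<subseteq> box (Complex (-M) (-\<theta>)) (Complex M \<theta>)"
    using T by (auto simp: pts_def in_box_complex_iff)
  have res: "residue (\<lambda>w. f w / g w) p = f p / g'"
    if p: "p \<in> pts" and g': "(g has_field_derivative g') (at p)" "g' \<noteq> 0" for p g'
  proof -
    have "finite (pts - {p})" by (simp add: pts_def)
    then have "open (pi_strip - (pts - {p}))"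
      by (intro open_Diff open_pi_strip finite_imp_closed)
    then obtain e where e: "e > 0" "ball p e \<subseteq> pi_strip - (pts - {p})"
      using p S unfolding open_contains_ball pts_def by blast
    show ?thesis
    proof (rule residue_divide_simple_zero)
      show "f holomorphic_on ball p e" "g holomorphic_on ball p e"
        using holo e(2) by (auto intro: holomorphic_on_subset)
      show "g p = 0" using p u0 v0 by (auto simp: pts_def g_def)
      show "g w \<noteq> 0" if "w \<in> ball p e" "w \<noteq> p" for w
        using that e(2) by (intro nz) auto
    qed (use e g' in auto)
  qed
  have d: "(g has_field_derivative (exp w - u) * (exp w - v) + w * (exp w * (exp w - v) + (exp w - u) * exp w)) (at w)" for w
    unfolding g_def by (auto intro!: derivative_eq_intros simp: algebra_simps)
  have r0: "residue (\<lambda>w. f w / g w) 0 = A 0 * (1 / (1 - u) - 1 / (1 - v))"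
    using res[of 0, OF _ d[of 0]] u v by (simp add: pts_def f_def divide_simps)
  have ru: "residue (\<lambda>w. f w / g w) (Ln u) = A (Ln u) / Ln u"
    using res[of "Ln u", OF _ d[of "Ln u"]] u0 uv by (simp add: pts_def f_def)
  have rv: "residue (\<lambda>w. f w / g w) (Ln v) = - (A (Ln v) / Ln v)"
  proof -
    have "residue (\<lambda>w. f w / g w) (Ln v) = A (Ln v) * (v * (u - v)) / (Ln v * ((v - u) * v))"
      using res[of "Ln v", OF _ d[of "Ln v"]] v0 uv by (simp add: pts_def f_def)
    also have "\<dots> = - (A (Ln v) / Ln v)"
      using v0 uv by (simp add: divide_simps) (simp add: algebra_simps)
    finally show ?thesis .
  qed
  have sub: "cbox (Complex (-M) (-\<theta>)) (Complex M \<theta>) \<subseteq> pi_strip"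
    using T by (auto simp: in_cbox_complex_iff)
  have le: "Re (Complex (-M) (-\<theta>)) \<le> Re (Complex M \<theta>)" "Im (Complex (-M) (-\<theta>)) \<le> Im (Complex M \<theta>)"
    using T by auto
  have "contour_integral ?\<gamma> (\<lambda>w. f w / g w) =
          2 * pi * \<i> * (\<Sum>p\<in>pts. winding_number ?\<gamma> p * residue (\<lambda>w. f w / g w) p)"
  proof (rule Residue_theorem[OF open_pi_strip connected_pi_strip])
    show "finite pts" by (simp add: pts_def)
    show "(\<lambda>w. f w / g w) holomorphic_on pi_strip - pts"
      using nz by (intro holomorphic_on_divide holomorphic_on_subset[OF holo(1)] holomorphic_on_subset[OF holo(2)]) auto
    show "path_image ?\<gamma> \<subseteq> pi_strip - pts"
      using path_image_rectpath_subset_cbox[OF le] path_image_rectpath_inter_box[OF le] sub box by blast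
    show "\<forall>z. z \<notin> pi_strip \<longrightarrow> winding_number ?\<gamma> z = 0"
      using sub by (auto intro!: winding_number_rectpath_outside[OF le])
  qed auto
  also have "(\<Sum>p\<in>pts. winding_number ?\<gamma> p * residue (\<lambda>w. f w / g w) p) = (\<Sum>p\<in>pts. residue (\<lambda>w. f w / g w) p)"
    using box by (intro sum.cong) (auto simp: winding_number_rectpath)
  also have "\<dots> = A 0 * (1 / (1 - u) - 1 / (1 - v)) + A (Ln u) / Ln u - A (Ln v) / Ln v"
    by (simp add: pts_def r0 ru rv algebra_simps)
  finally show ?thesis
    by (simp only: fg)
qed

text \<open>The horizontal sides become real integrals because their limits have to be identified;
  the vertical sides stay contour integrals because they are only estimated.\<close>

lemma contour_integral_rectpath_symmetric:
  assumes f: "continuous_on (path_image (rectpath (Complex (-M) (-\<theta>)) (Complex M \<theta>))) f"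
    and T: "0 < M" "0 < \<theta>"
  shows "contour_integral (rectpath (Complex (-M) (-\<theta>)) (Complex M \<theta>)) f =
    integral {-M..M} (\<lambda>x. f (Complex x (-\<theta>))) - integral {-M..M} (\<lambda>x. f (Complex x \<theta>)) +
    contour_integral (linepath (Complex M (-\<theta>)) (Complex M \<theta>)) f -
    contour_integral (linepath (Complex (-M) (-\<theta>)) (Complex (-M) \<theta>)) f"
proof -
  let ?a1 = "Complex (-M) (-\<theta>)" and ?a2 = "Complex M (-\<theta>)" and ?a3 = "Complex M \<theta>" and ?a4 = "Complex (-M) \<theta>"
  have pi: "path_image (rectpath ?a1 ?a3) =
      closed_segment ?a1 ?a2 \<union> closed_segment ?a2 ?a3 \<union> closed_segment ?a3 ?a4 \<union> closed_segment ?a4 ?a1"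
    by (simp add: rectpath_def Let_def path_image_join Un_assoc)
  have int: "f contour_integrable_on linepath a b" if "closed_segment a b \<subseteq> path_image (rectpath ?a1 ?a3)" for a b
    using that f by (intro contour_integrable_continuous_linepath) (auto intro: continuous_on_subset)
  have i: "f contour_integrable_on linepath ?a1 ?a2" "f contour_integrable_on linepath ?a2 ?a3"
    "f contour_integrable_on linepath ?a3 ?a4" "f contour_integrable_on linepath ?a4 ?a1"
    "f contour_integrable_on linepath ?a4 ?a3"
    by (intro int; force simp: pi closed_segment_commute)+
  have hor: "contour_integral (linepath (Complex (-M) y) (Complex M y)) f = integral {-M..M} (\<lambda>x. f (Complex x y))"
    if "f contour_integrable_on linepath (Complex (-M) y) (Complex M y)" for y
  proof -
    have "((\<lambda>x. f (Complex x y)) has_integral contour_integral (linepath (Complex (-M) y) (Complex M y)) f) {-M..M}"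
      using that T by (subst has_contour_integral_linepath_same_Im_iff[symmetric])
        (auto intro: has_contour_integral_integral)
    then show ?thesis by (simp add: integral_unique)
  qed
  have "contour_integral (rectpath ?a1 ?a3) f =
      contour_integral (linepath ?a1 ?a2) f + contour_integral (linepath ?a2 ?a3) f +
      contour_integral (linepath ?a3 ?a4) f + contour_integral (linepath ?a4 ?a1) f"
    using i by (simp add: rectpath_def Let_def)
  also have "contour_integral (linepath ?a3 ?a4) f = - contour_integral (linepath ?a4 ?a3) f"
    using contour_integral_reversepath[of "linepath ?a4 ?a3" f] by simp
  also have "contour_integral (linepath ?a4 ?a1) f = - contour_integral (linepath ?a1 ?a4) f"
    using contour_integral_reversepath[of "linepath ?a1 ?a4" f] by simp
  finally show ?thesis
    using hor i by simp
qed

text \<open>Carries an integral over the cut to one over an edge of the strip, with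
  \<open>t = exp x\<close>. The change of variables for absolute integrals gives the equivalence of
  integrability together with the value; Borel measurability lets both pass between Lebesgue measure
  and its completion.\<close>

lemma exp_substitution:
  fixes f :: "real \<Rightarrow> 'a :: euclidean_space"
  assumes [measurable]: "f \<in> borel_measurable borel"
  shows integrable_exp_substitution:
      "set_integrable lborel {0<..} f \<longleftrightarrow> integrable lborel (\<lambda>x. exp x *\<^sub>R f (exp x))"
    and integral_exp_substitution:
      "set_integrable lborel {0<..} f \<Longrightarrow> (LBINT t:{0<..}. f t) = (LBINT x. exp x *\<^sub>R f (exp x))"
proof -
  have ran: "exp ` UNIV = {0::real<..}"
    by (auto simp: image_iff) (metis exp_ln)
  note cv = has_absolute_integral_change_of_variables_real[of UNIV exp exp f, unfolded ran]
  have der: "\<And>x. (exp has_field_derivative exp x) (at x within UNIV)"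
    by (auto intro!: derivative_eq_intros)
  have inj: "inj_on exp (UNIV :: real set)"
    by (auto simp: inj_on_def)
  have iff1: "f absolutely_integrable_on {0<..} \<longleftrightarrow> set_integrable lborel {0<..} f"
    unfolding set_integrable_def by (intro integrable_completion) measurable
  have iff2: "(\<lambda>x. \<bar>exp x\<bar> *\<^sub>R f (exp x)) absolutely_integrable_on UNIV \<longleftrightarrow>
      integrable lborel (\<lambda>x. exp x *\<^sub>R f (exp x))"
    unfolding set_integrable_def by (subst integrable_completion) simp_all
  show *: "set_integrable lborel {0<..} f \<longleftrightarrow> integrable lborel (\<lambda>x. exp x *\<^sub>R f (exp x))"
    using cv[OF _ der inj] iff1 iff2 by auto
  assume f: "set_integrable lborel {0<..} f"
  have "(LBINT t:{0<..}. f t) = integral {0<..} f"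
    by (rule set_borel_integral_eq_integral(2)[OF f])
  also have "\<dots> = integral UNIV (\<lambda>x. \<bar>exp x\<bar> *\<^sub>R f (exp x))"
    using cv[OF _ der inj, of "integral UNIV (\<lambda>x. \<bar>exp x\<bar> *\<^sub>R f (exp x))"] iff1 iff2 f * by auto
  also have "\<dots> = (LBINT x. exp x *\<^sub>R f (exp x))"
    using integral_lborel[of "\<lambda>x. exp x *\<^sub>R f (exp x)"] f * by (simp add: integral_unique)
  finally show "(LBINT t:{0<..}. f t) = (LBINT x. exp x *\<^sub>R f (exp x))" .
qed

text \<open>Both factors \<open>exp w - p\<close> keep at least half of \<open>|exp w|\<close>,
  against a single \<open>exp w\<close> in the numerator.\<close>

lemma norm_strip_kernel_right:
  assumes "exp (Re w) \<ge> 2 * norm u" "exp (Re w) \<ge> 2 * norm v"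
  shows "norm (strip_kernel u v w) \<le> 4 * norm (u - v) * exp (- Re w)"
proof -
  have *: "norm (exp w - p) \<ge> exp (Re w) / 2" if "exp (Re w) \<ge> 2 * norm p" for p
    using that norm_triangle_ineq2[of "exp w" p] by simp
  have "norm (strip_kernel u v w) = exp (Re w) * norm (u - v) / (norm (exp w - u) * norm (exp w - v))"
    by (simp add: strip_kernel_def norm_mult norm_divide)
  also have "\<dots> \<le> exp (Re w) * norm (u - v) / (exp (Re w) / 2 * (exp (Re w) / 2))"
    using *[OF assms(1)] *[OF assms(2)] by (intro divide_left_mono mult_mono mult_pos_pos) (auto intro: less_le_trans[OF _ *[OF assms(1)]] less_le_trans[OF _ *[OF assms(2)]])
  also have "\<dots> = 4 * norm (u - v) * exp (- Re w)"
    by (simp add: exp_minus field_simps)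
  finally show ?thesis .
qed

text \<open>Both factors \<open>exp w - p\<close> keep at least half of \<open>|p|\<close>, and the
  numerator supplies the decay.\<close>

lemma norm_strip_kernel_left:
  assumes "2 * exp (Re w) \<le> norm u" "2 * exp (Re w) \<le> norm v"
  shows "norm (strip_kernel u v w) \<le> 4 * norm (u - v) / (norm u * norm v) * exp (Re w)"
proof -
  have *: "norm (exp w - p) \<ge> norm p / 2" if "2 * exp (Re w) \<le> norm p" for p
    using that norm_triangle_ineq2[of p "exp w"] by (simp add: norm_minus_commute)
  have pos: "norm u > 0" "norm v > 0"
    using assms exp_gt_zero[of "Re w"] by linarith+
  have "norm (strip_kernel u v w) = exp (Re w) * norm (u - v) / (norm (exp w - u) * norm (exp w - v))"
    by (simp add: strip_kernel_def norm_mult norm_divide)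
  also have "\<dots> \<le> exp (Re w) * norm (u - v) / (norm u / 2 * (norm v / 2))"
    using *[OF assms(1)] *[OF assms(2)] pos by (intro divide_left_mono mult_mono mult_pos_pos) auto
  also have "\<dots> = 4 * norm (u - v) / (norm u * norm v) * exp (Re w)"
    by (simp add: field_simps)
  finally show ?thesis .
qed

section \<open>Passing to the edges of the strip\<close>

text \<open>The function to be represented is \<open>A (Ln u) / Ln u\<close>. \<open>Ap t\<close> is
  the value of \<open>A\<close> on the upper side of the cut at \<open>- t\<close>, and
  \<open>a\<close> is the one radius where it may fail to exist. \<open>B\<close> depends on
  \<open>|exp w|\<close> alone and so dominates at all heights; \<open>B_int\<close> matches the
  decay of the kernel along the edges. \<open>B_right\<close> and \<open>B_left\<close> remove the
  vertical sides and run along integers because the rectangles have integer half-widths.\<close>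

locale strip_function =
  fixes A :: "complex \<Rightarrow> complex" and Ap :: "real \<Rightarrow> complex" and B :: "real \<Rightarrow> real" and a :: real
  assumes holo: "A holomorphic_on pi_strip"
    and cnj: "\<And>w. w \<in> pi_strip \<Longrightarrow> A (cnj w) = cnj (A w)"
    and bound: "\<And>w. \<lbrakk>w \<in> pi_strip; exp (Re w) \<noteq> a\<rbrakk> \<Longrightarrow> norm (A w) \<le> B (exp (Re w))"
    and B_meas [measurable]: "B \<in> borel_measurable borel"
    and B_int: "set_integrable lborel {0<..} (\<lambda>t. B t / (1 + t)\<^sup>2)"
    and B_right: "(\<lambda>n. B (exp (real n)) * exp (- real n)) \<longlonglongrightarrow> 0"
    and B_left: "(\<lambda>n. B (exp (- real n)) * exp (- real n)) \<longlonglongrightarrow> 0"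
    and Ap_meas [measurable]: "Ap \<in> borel_measurable borel"
    and lim: "\<And>t. \<lbrakk>t > 0; t \<noteq> a\<rbrakk> \<Longrightarrow> ((\<lambda>\<theta>. A (Complex (ln t) \<theta>)) \<longlongrightarrow> Ap t) (at_left pi)"
begin

text \<open>This is \<open>- Im (Ap t / (ln t + \<i> * pi)) / pi\<close>, that is, the jump of
  \<open>A w / w\<close> from the lower to the upper side, divided by
  \<open>- 2 * pi * \<i>\<close>.\<close>

definition density :: "real \<Rightarrow> real" where
  "density t = (Re (Ap t) - ln t / pi * Im (Ap t)) / ((ln t)\<^sup>2 + pi\<^sup>2)"

lemma density_measurable [measurable]: "density \<in> borel_measurable borel"
  unfolding density_def by measurable

lemma B_nonneg: "\<lbrakk>t > 0; t \<noteq> a\<rbrakk> \<Longrightarrow> B t \<ge> 0"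
  using bound[of "of_real (ln t)"] by (auto intro: order.trans[OF norm_ge_zero])

lemma two_point_aux:
  assumes u: "u \<notin> \<real>\<^sub>\<le>\<^sub>0" "u \<noteq> 1" and v: "v \<notin> \<real>\<^sub>\<le>\<^sub>0" "v \<noteq> 1" and uv: "u \<noteq> v"
  defines "f \<equiv> \<lambda>t. of_real (density t) * (1 / (u + of_real t) - 1 / (v + of_real t))"
  shows "set_integrable lborel {0<..} f \<and>
    A (Ln u) / Ln u - A (Ln v) / Ln v = A 0 * (1 / (u - 1) - 1 / (v - 1)) + (LBINT t:{0<..}. f t)"
proof -
  have u0: "u \<noteq> 0" and v0: "v \<noteq> 0" using u v by auto
  obtain cu \<eta>u where cu: "cu > 0" "\<eta>u < pi"
    "\<And>w. \<lbrakk>\<eta>u \<le> \<bar>Im w\<bar>; \<bar>Im w\<bar> \<le> pi\<rbrakk> \<Longrightarrow> norm (exp w - u) \<ge> cu * (1 + exp (Re w))"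
    using norm_exp_minus_cut_plane_ge[OF u(1)] by metis
  obtain cv \<eta>v where cv: "cv > 0" "\<eta>v < pi"
    "\<And>w. \<lbrakk>\<eta>v \<le> \<bar>Im w\<bar>; \<bar>Im w\<bar> \<le> pi\<rbrakk> \<Longrightarrow> norm (exp w - v) \<ge> cv * (1 + exp (Re w))"
    using norm_exp_minus_cut_plane_ge[OF v(1)] by metis
  define \<Psi> where "\<Psi> = (\<lambda>w. A w / w * strip_kernel u v w)"
  \<comment> \<open>For heights beyond \<open>\<eta>\<close> both denominators obey their uniform
    lower bounds, the poles lie below the edge, and \<open>|w| \<ge> 1\<close>. For half-widths
    beyond \<open>R\<close> the vertical sides miss the radius \<open>a\<close> and the poles, again
    \<open>|w| \<ge> 1\<close>, and the kernel decays, since \<open>exp (M n)\<close> exceeds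
    \<open>R\<close> too.\<close>
  define \<eta> where "\<eta> = Max {\<eta>u, \<eta>v, 1, \<bar>Im (Ln u)\<bar>, \<bar>Im (Ln v)\<bar>}"
  define R where "R = Max {1, \<bar>ln a\<bar>, \<bar>Re (Ln u)\<bar>, \<bar>Re (Ln v)\<bar>, 2 * norm u, 2 * norm v, 2 / norm u, 2 / norm v}"
  have "\<eta> < pi"
    using cu cv pi_gt3 Ln_in_pi_strip u v by (simp add: \<eta>_def)
  have \<eta>: "\<eta>u \<le> \<eta>" "\<eta>v \<le> \<eta>" "1 \<le> \<eta>" "\<bar>Im (Ln u)\<bar> \<le> \<eta>" "\<bar>Im (Ln v)\<bar> \<le> \<eta>"
    unfolding \<eta>_def by (rule Max_ge; simp)+
  have R: "1 \<le> R" "\<bar>ln a\<bar> \<le> R" "\<bar>Re (Ln u)\<bar> \<le> R" "\<bar>Re (Ln v)\<bar> \<le> R" "2 * norm u \<le> R" "2 * norm v \<le> R"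
    "2 / norm u \<le> R" "2 / norm v \<le> R"
    unfolding R_def by (rule Max_ge; simp)+
  have "(\<lambda>n. pi - 1 / real (Suc n)) \<longlonglongrightarrow> pi"
    by real_asymp
  then have "\<forall>\<^sub>F n in sequentially. pi - 1 / real (Suc n) > \<eta>"
    using \<open>\<eta> < pi\<close> by (rule order_tendstoD)
  moreover have "\<forall>\<^sub>F n in sequentially. real n > R"
    using filterlim_real_sequentially by (simp add: filterlim_at_top_dense)
  ultimately have "\<forall>\<^sub>F n in sequentially. pi - 1 / real (Suc n) > \<eta> \<and> real n > R"
    by eventually_elim simp
  then obtain N where N: "\<And>n. n \<ge> N \<Longrightarrow> pi - 1 / real (Suc n) > \<eta>" "\<And>n. n \<ge> N \<Longrightarrow> real n > R"
    unfolding eventually_sequentially by blast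
  define M where "M = (\<lambda>n. real (n + N))"
  define \<theta> where "\<theta> = (\<lambda>n. pi - 1 / real (Suc (n + N)))"
  have \<theta>: "\<eta> < \<theta> n" "\<theta> n < pi" for n
    using N(1)[of "n + N"] by (auto simp: \<theta>_def)
  have M: "R < M n" for n
    using N(2)[of "n + N"] by (auto simp: M_def)
  have \<theta>_lim: "filterlim \<theta> (at_left pi) sequentially"
    unfolding \<theta>_def by real_asymp
  define c where "c = 2 * pi * \<i> * (A 0 * (1 / (1 - u) - 1 / (1 - v)) + A (Ln u) / Ln u - A (Ln v) / Ln v)"
  define Vr where "Vr = (\<lambda>n. contour_integral (linepath (Complex (M n) (-\<theta> n)) (Complex (M n) (\<theta> n))) \<Psi>)"
  define Vl where "Vl = (\<lambda>n. contour_integral (linepath (Complex (-M n) (-\<theta> n)) (Complex (-M n) (\<theta> n))) \<Psi>)"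
  have cont: "continuous_on (pi_strip - {0, Ln u, Ln v}) \<Psi>"
    unfolding \<Psi>_def strip_kernel_def
    by (intro continuous_intros continuous_on_subset[OF holomorphic_on_imp_continuous_on[OF holo]]) auto
  have path: "path_image (rectpath (Complex (-M n) (-\<theta> n)) (Complex (M n) (\<theta> n))) \<subseteq> pi_strip - {0, Ln u, Ln v}" for n
  proof -
    have "\<theta> n > 0" "M n > 0" "\<bar>Re (Ln u)\<bar> < M n" "\<bar>Re (Ln v)\<bar> < M n" "\<bar>Im (Ln u)\<bar> < \<theta> n" "\<bar>Im (Ln v)\<bar> < \<theta> n"
      using \<theta>[of n] \<eta> M[of n] R by linarith+
    then show ?thesis
      using \<theta>(2)[of n] by (subst path_image_rectpath) auto
  qed
  have eq: "integral {-M n..M n} (\<lambda>x. \<Psi> (Complex x (-\<theta> n))) - integral {-M n..M n} (\<lambda>x. \<Psi> (Complex x (\<theta> n))) + Vr n - Vl n = c" for n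
  proof -
    have "\<theta> n > 0" "M n > 0" "\<bar>Re (Ln u)\<bar> < M n" "\<bar>Re (Ln v)\<bar> < M n" "\<bar>Im (Ln u)\<bar> < \<theta> n" "\<bar>Im (Ln v)\<bar> < \<theta> n"
      using \<theta>[of n] \<eta> M[of n] R by linarith+
    then have "contour_integral (rectpath (Complex (-M n) (-\<theta> n)) (Complex (M n) (\<theta> n))) \<Psi> = c"
      unfolding \<Psi>_def c_def using u v uv \<theta>(2)[of n]
      by (intro contour_integral_strip_kernel holo) auto
    with \<open>\<theta> n > 0\<close> \<open>M n > 0\<close> show ?thesis
      unfolding Vr_def Vl_def
      by (subst (asm) contour_integral_rectpath_symmetric[OF continuous_on_subset[OF cont path]]) auto
  qed
  have seg: "\<Psi> contour_integrable_on linepath (Complex x (-\<theta> n)) (Complex x (\<theta> n))" if "x = M n \<or> x = - M n" for x n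
  proof (rule contour_integrable_continuous_linepath)
    have "\<theta> n > 0" "M n > 0"
      using \<theta>[of n] \<eta> M[of n] R by linarith+
    then have "closed_segment (Complex x (-\<theta> n)) (Complex x (\<theta> n)) \<subseteq>
        path_image (rectpath (Complex (-M n) (-\<theta> n)) (Complex (M n) (\<theta> n)))"
      using that by (subst path_image_rectpath) (auto simp: closed_segment_same_Re closed_segment_eq_real_ivl)
    then show "continuous_on (closed_segment (Complex x (-\<theta> n)) (Complex x (\<theta> n))) \<Psi>"
      using continuous_on_subset[OF cont] path[of n] by blast
  qed
  \<comment> \<open>On a vertical side \<open>B\<close> is constant and the length is below
    \<open>2 * pi\<close>, so the only factor left to control is
    \<open>B (exp x) * exp (- M n)\<close>, which tends to 0 by \<open>B_right\<close> or
    \<open>B_left\<close>.\<close>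
  have vert: "norm (contour_integral (linepath (Complex x (-\<theta> n)) (Complex x (\<theta> n))) \<Psi>) \<le> B (exp x) * exp (- M n) * (K * (2 * pi))"
    if x: "x = M n \<or> x = - M n" and K: "\<And>w. Re w = x \<Longrightarrow> norm (strip_kernel u v w) \<le> K * exp (- M n)" for x n K
  proof -
    have pos: "\<theta> n > 0" "M n \<ge> 1"
      using \<theta>[of n] \<eta> M[of n] R by linarith+
    have xa: "exp x \<noteq> a"
      using x M[of n] R by auto
    have B0: "B (exp x) \<ge> 0" using xa by (intro B_nonneg) simp
    have K0: "K * exp (- M n) \<ge> 0"
      using K[of "Complex x 0"] by (auto intro: order.trans[OF norm_ge_zero])
    have "norm (contour_integral (linepath (Complex x (-\<theta> n)) (Complex x (\<theta> n))) \<Psi>) \<le>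
        (B (exp x) * (K * exp (- M n))) * norm (Complex x (\<theta> n) - Complex x (-\<theta> n))"
    proof (rule contour_integral_bound_linepath[OF seg[OF x]])
      show "0 \<le> B (exp x) * (K * exp (- M n))"
        using B0 K0 by simp
      fix w assume "w \<in> closed_segment (Complex x (-\<theta> n)) (Complex x (\<theta> n))"
      then have w: "Re w = x" "\<bar>Im w\<bar> \<le> \<theta> n"
        using pos by (auto simp: closed_segment_same_Re closed_segment_eq_real_ivl)
      have "norm (\<Psi> w) = norm (A w) / norm w * norm (strip_kernel u v w)"
        by (simp add: \<Psi>_def norm_mult norm_divide)
      also have "\<dots> \<le> B (exp x) / 1 * (K * exp (- M n))"
      proof (intro mult_mono frac_le)
        show "norm (A w) \<le> B (exp x)"
          using bound[of w] w xa \<theta>(2)[of n] by auto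
        show "1 \<le> norm w"
          using abs_Re_le_cmod[of w] w pos x by auto
      qed (use B0 K0 K[of w] w in auto)
      finally show "norm (\<Psi> w) \<le> B (exp x) * (K * exp (- M n))"
        by simp
    qed
    also have "norm (Complex x (\<theta> n) - Complex x (-\<theta> n)) = 2 * \<theta> n"
      using pos by (simp add: cmod_def real_sqrt_mult)
    also have "(B (exp x) * (K * exp (- M n))) * (2 * \<theta> n) \<le> (B (exp x) * (K * exp (- M n))) * (2 * pi)"
      using B0 K0 \<theta>(2)[of n] by (intro mult_left_mono) auto
    finally show ?thesis
      by (simp add: mult_ac)
  qed
  have eM: "exp (M n) \<ge> R" for n
    using M[of n] exp_ge_add_one_self[of "M n"] by linarith
  have "Vr \<longlonglongrightarrow> 0"
  proof (rule Lim_null_comparison)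
    show "\<forall>\<^sub>F n in sequentially. norm (Vr n) \<le> B (exp (M n)) * exp (- M n) * (4 * norm (u - v) * (2 * pi))"
      unfolding Vr_def
    proof (intro always_eventually allI vert)
      fix n w assume "Re w = M n"
      then show "norm (strip_kernel u v w) \<le> 4 * norm (u - v) * exp (- M n)"
        using norm_strip_kernel_right[of u w v] eM[of n] R by auto
    qed simp
    show "(\<lambda>n. B (exp (M n)) * exp (- M n) * (4 * norm (u - v) * (2 * pi))) \<longlonglongrightarrow> 0"
      unfolding M_def by (intro tendsto_mult_left_zero LIMSEQ_ignore_initial_segment[OF B_right])
  qed
  moreover have "Vl \<longlonglongrightarrow> 0"
  proof (rule Lim_null_comparison)
    show "\<forall>\<^sub>F n in sequentially. norm (Vl n) \<le> B (exp (- M n)) * exp (- M n) * (4 * norm (u - v) / (norm u * norm v) * (2 * pi))"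
      unfolding Vl_def
    proof (intro always_eventually allI vert)
      fix n w assume w: "Re w = - M n"
      have "2 / norm p \<le> exp (M n) \<Longrightarrow> p \<noteq> 0 \<Longrightarrow> 2 * exp (Re w) \<le> norm p" for p :: complex
        using w by (simp add: exp_minus field_simps)
      then have "2 * exp (Re w) \<le> norm u" "2 * exp (Re w) \<le> norm v"
        using u0 v0 eM[of n] R by auto
      then show "norm (strip_kernel u v w) \<le> 4 * norm (u - v) / (norm u * norm v) * exp (- M n)"
        using norm_strip_kernel_left[of w u v] w by auto
    qed simp
    show "(\<lambda>n. B (exp (- M n)) * exp (- M n) * (4 * norm (u - v) / (norm u * norm v) * (2 * pi))) \<longlonglongrightarrow> 0"
      unfolding M_def by (intro tendsto_mult_left_zero LIMSEQ_ignore_initial_segment[OF B_left])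
  qed
  ultimately have "(\<lambda>n. c - Vr n + Vl n) \<longlonglongrightarrow> c - 0 + 0"
    by (intro tendsto_intros)
  also have "(\<lambda>n. c - Vr n + Vl n) = (\<lambda>n. integral {-M n..M n} (\<lambda>x. \<Psi> (Complex x (-\<theta> n))) - integral {-M n..M n} (\<lambda>x. \<Psi> (Complex x (\<theta> n))))"
  proof (rule ext)
    have "I + r - l = c \<Longrightarrow> c - r + l = I" for I r l :: complex
      by auto
    then show "c - Vr n + Vl n = integral {-M n..M n} (\<lambda>x. \<Psi> (Complex x (-\<theta> n))) - integral {-M n..M n} (\<lambda>x. \<Psi> (Complex x (\<theta> n)))" for n
      using eq[of n] by this
  qed
  finally have lim1: "(\<lambda>n. integral {-M n..M n} (\<lambda>x. \<Psi> (Complex x (-\<theta> n))) - integral {-M n..M n} (\<lambda>x. \<Psi> (Complex x (\<theta> n)))) \<longlonglongrightarrow> c"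
    by simp

  \<comment> \<open>\<open>K x\<close> is the kernel at \<open>exp w = - exp x\<close>, common to
    both edges. \<open>dom\<close> is free of \<open>n\<close> because the lower bounds for the
    denominators hold at every height beyond \<open>\<eta>\<close>.\<close>
  define K where "K = (\<lambda>x. - of_real (exp x) * (u - v) / ((of_real (exp x) + u) * (of_real (exp x) + v)))"
  define dom where "dom = (\<lambda>x. norm (u - v) / (cu * cv) * (exp x * (B (exp x) / (1 + exp x)\<^sup>2)))"
  have "(\<lambda>t. B t / (1 + t)\<^sup>2) \<in> borel_measurable borel"
    by measurable
  from integrable_exp_substitution[OF this] B_int
  have "integrable lborel (\<lambda>x. exp x * (B (exp x) / (1 + exp x)\<^sup>2))"
    by (simp only: real_scaleR_def)
  then have dom_int: "integrable lborel dom"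
    unfolding dom_def by (intro integrable_mult_right)
  have nz: "of_real (exp x) + u \<noteq> 0" "of_real (exp x) + v \<noteq> 0" for x
  proof -
    have "of_real (exp x) + p \<noteq> 0" if "p \<notin> \<real>\<^sub>\<le>\<^sub>0" for p :: complex
    proof
      assume "of_real (exp x) + p = 0"
      then have "p = of_real (- exp x)" by (simp add: add_eq_0_iff)
      with that show False by (metis exp_ge_zero neg_le_0_iff_le nonpos_Reals_of_real_iff)
    qed
    then show "of_real (exp x) + u \<noteq> 0" "of_real (exp x) + v \<noteq> 0" using u v by auto
  qed
  \<comment> \<open>The sign \<open>s\<close> selects the edge. Convergence may fail only at
    \<open>x = ln a\<close>, a null set.\<close>
  have horizontal: "integrable lborel (\<lambda>x. G x / Complex x (s * pi) * K x) \<and>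
      (\<lambda>n. integral {-M n..M n} (\<lambda>x. \<Psi> (Complex x (s * \<theta> n)))) \<longlonglongrightarrow> (LBINT x. G x / Complex x (s * pi) * K x)"
    if s: "s = 1 \<or> s = -1" and [measurable]: "G \<in> borel_measurable borel"
      and G: "\<And>x. x \<noteq> ln a \<Longrightarrow> (\<lambda>n. A (Complex x (s * \<theta> n))) \<longlonglongrightarrow> G x" for s G
  proof -
    define q where "q = (\<lambda>n x. indicator {-M n..M n} x *\<^sub>R \<Psi> (Complex x (s * \<theta> n)))"
    define l where "l = (\<lambda>x. G x / Complex x (s * pi) * K x)"
    have s\<theta>: "\<bar>s * \<theta> n\<bar> = \<theta> n" for n
      using s \<theta>[of n] \<eta> by auto
    have cont': "continuous_on {-M n..M n} (\<lambda>x. \<Psi> (Complex x (s * \<theta> n)))" for n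
    proof (rule continuous_on_compose2[OF cont])
      show "continuous_on {-M n..M n} (\<lambda>x. Complex x (s * \<theta> n))"
        unfolding Complex_eq by (intro continuous_intros)
      have "(\<lambda>x. Complex x (s * \<theta> n)) ` {-M n..M n} \<subseteq> path_image (rectpath (Complex (-M n) (-\<theta> n)) (Complex (M n) (\<theta> n)))"
        using s \<theta>[of n] \<eta>(3) M[of n] R(1) by (subst path_image_rectpath) auto
      then show "(\<lambda>x. Complex x (s * \<theta> n)) ` {-M n..M n} \<subseteq> pi_strip - {0, Ln u, Ln v}"
        using path[of n] by blast
    qed
    have q_int: "integrable lborel (q n)" for n
      unfolding q_def using borel_integrable_compact[OF _ cont', of n] by simp
    have [measurable]: "q n \<in> borel_measurable lborel" for n
      using q_int by (rule borel_measurable_integrable)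
    have l_meas [measurable]: "l \<in> borel_measurable borel"
      unfolding l_def K_def Complex_eq by measurable
    have lim: "AE x in lborel. (\<lambda>n. q n x) \<longlonglongrightarrow> l x"
    proof (rule eventually_mono[OF AE_lborel_singleton[of "ln a"]])
      fix x assume x: "x \<noteq> ln a"
      have "\<theta> \<longlonglongrightarrow> pi"
        using \<theta>_lim by (rule filterlim_mono) (auto simp: at_within_le_nhds)
      then have w: "(\<lambda>n. Complex x (s * \<theta> n)) \<longlonglongrightarrow> Complex x (s * pi)"
        by (intro tendsto_Complex tendsto_intros)
      have e: "exp (Complex x (s * pi)) = - of_real (exp x)"
        using s by (auto simp: exp_eq_polar complex_eq_iff)
      have "strip_kernel u v (Complex x (s * pi)) = - of_real (exp x) * (u - v) / ((- (of_real (exp x) + u)) * (- (of_real (exp x) + v)))"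
        unfolding strip_kernel_def e by simp
      also have "\<dots> = K x"
        unfolding K_def by (simp only: minus_mult_minus)
      finally have Keq: "strip_kernel u v (Complex x (s * pi)) = K x" .
      have "(\<lambda>n. strip_kernel u v (Complex x (s * \<theta> n))) \<longlonglongrightarrow> strip_kernel u v (Complex x (s * pi))"
        unfolding strip_kernel_def using nz[of x] w
        by (intro tendsto_intros w) (auto simp: e add_eq_0_iff)
      then have "(\<lambda>n. \<Psi> (Complex x (s * \<theta> n))) \<longlonglongrightarrow> l x"
        unfolding \<Psi>_def l_def Keq using s by (intro tendsto_mult tendsto_divide G x w) (auto simp: complex_eq_iff)
      moreover have "\<forall>\<^sub>F n in sequentially. \<Psi> (Complex x (s * \<theta> n)) = q n x"
      proof -
        have "filterlim M at_top sequentially"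
          unfolding M_def by real_asymp
        then have "\<forall>\<^sub>F n in sequentially. M n \<ge> \<bar>x\<bar>"
          by (simp add: filterlim_at_top)
        then show ?thesis
          by eventually_elim (auto simp: q_def indicator_def)
      qed
      ultimately show "(\<lambda>n. q n x) \<longlonglongrightarrow> l x"
        by (rule Lim_transform_eventually)
    qed
    have dom: "AE x in lborel. norm (q n x) \<le> dom x" for n
    proof (rule eventually_mono[OF AE_lborel_singleton[of "ln a"]])
      fix x assume "x \<noteq> ln a"
      then have xa: "exp x \<noteq> a" by auto
      define w where "w = Complex x (s * \<theta> n)"
      have w: "Re w = x" "\<bar>Im w\<bar> = \<theta> n"
        using s\<theta> by (auto simp: w_def)
      have B0: "B (exp x) \<ge> 0" using xa by (intro B_nonneg) simp
      have den: "norm (exp w - u) * norm (exp w - v) \<ge> (cu * (1 + exp x)) * (cv * (1 + exp x))"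
        using cu(3)[of w] cv(3)[of w] \<theta>[of n] \<eta> w cu(1) cv(1) by (intro mult_mono) auto
      have den0: "(cu * (1 + exp x)) * (cv * (1 + exp x)) > 0"
        using cu(1) cv(1) by (intro mult_pos_pos) (auto intro: add_pos_pos)
      have "norm (\<Psi> w) = norm (A w) / norm w * (exp x * norm (u - v) / (norm (exp w - u) * norm (exp w - v)))"
        by (simp add: \<Psi>_def strip_kernel_def norm_mult norm_divide w)
      also have "\<dots> \<le> B (exp x) / 1 * (exp x * norm (u - v) / ((cu * (1 + exp x)) * (cv * (1 + exp x))))"
      proof (rule mult_mono)
        have "norm (A w) \<le> B (exp x)" "1 \<le> norm w"
          using bound[of w] xa abs_Im_le_cmod[of w] w \<theta>[of n] \<eta> by auto
        then show "norm (A w) / norm w \<le> B (exp x) / 1"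
          using B0 by (intro frac_le) auto
        show "exp x * norm (u - v) / (norm (exp w - u) * norm (exp w - v)) \<le>
            exp x * norm (u - v) / ((cu * (1 + exp x)) * (cv * (1 + exp x)))"
          using den mult_pos_pos[OF less_le_trans[OF den0 den] den0] by (intro divide_left_mono) auto
      qed (use B0 in auto)
      also have "\<dots> = dom x"
        by (simp add: dom_def power2_eq_square mult_ac)
      finally have "norm (\<Psi> w) \<le> dom x" .
      moreover have "dom x \<ge> 0"
        unfolding dom_def using cu(1) cv(1) B0 by auto
      ultimately show "norm (q n x) \<le> dom x"
        by (auto simp: q_def w_def indicator_def)
    qed
    have I: "(LBINT x. q n x) = integral {-M n..M n} (\<lambda>x. \<Psi> (Complex x (s * \<theta> n)))" for n
      using set_borel_integral_eq_integral(2)[of "{-M n..M n}" "\<lambda>x. \<Psi> (Complex x (s * \<theta> n))"] q_int[of n]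
      by (simp add: set_integrable_def set_lebesgue_integral_def q_def)
    have meas: "l \<in> borel_measurable lborel" "\<And>n. q n \<in> borel_measurable lborel"
      by measurable
    have "integrable lborel l" "(\<lambda>n. LBINT x. q n x) \<longlonglongrightarrow> (LBINT x. l x)"
      by (fact integrable_dominated_convergence[OF meas dom_int lim dom] integral_dominated_convergence[OF meas dom_int lim dom])+
    then show ?thesis
      by (simp add: I l_def)
  qed
  have up: "(\<lambda>n. A (Complex x (1 * \<theta> n))) \<longlonglongrightarrow> Ap (exp x)" if "x \<noteq> ln a" for x
  proof -
    have "exp x \<noteq> a" using that by auto
    then show ?thesis
      using filterlim_compose[OF lim \<theta>_lim, of "exp x"] by simp
  qed
  \<comment> \<open>The symmetry of \<open>A\<close> under conjugation makes the lower boundary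
    values conjugate to the upper ones; hence the two edges combine into a real density.\<close>
  have down: "(\<lambda>n. A (Complex x (-1 * \<theta> n))) \<longlonglongrightarrow> cnj (Ap (exp x))" if "x \<noteq> ln a" for x
  proof -
    have "A (Complex x (-1 * \<theta> n)) = cnj (A (Complex x (1 * \<theta> n)))" for n
      using cnj[of "Complex x (\<theta> n)"] \<theta>[of n] \<eta> by (simp add: complex_cnj)
    then show ?thesis
      using up[OF that] by (simp only: lim_cnj)
  qed
  have "cnj \<in> borel_measurable borel"
    by (intro borel_measurable_continuous_onI continuous_intros)
  then have cnj_meas: "(\<lambda>x. cnj (Ap (exp x))) \<in> borel_measurable borel"
    by measurable
  have Ap_exp_meas: "(\<lambda>x. Ap (exp x)) \<in> borel_measurable borel"
    by measurable
  note H1 = horizontal[OF disjI1[OF refl] Ap_exp_meas up]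
  note H2 = horizontal[OF disjI2[OF refl] cnj_meas down]
  have lim2: "(\<lambda>n. integral {-M n..M n} (\<lambda>x. \<Psi> (Complex x (-\<theta> n))) - integral {-M n..M n} (\<lambda>x. \<Psi> (Complex x (\<theta> n)))) \<longlonglongrightarrow>
      (LBINT x. cnj (Ap (exp x)) / Complex x (-1 * pi) * K x) - (LBINT x. Ap (exp x) / Complex x (1 * pi) * K x)"
    using tendsto_diff[OF conjunct2[OF H2] conjunct2[OF H1]] by simp
  have c_eq: "(LBINT x. cnj (Ap (exp x)) / Complex x (-1 * pi) * K x) - (LBINT x. Ap (exp x) / Complex x (1 * pi) * K x) = c"
    using LIMSEQ_unique[OF lim2 lim1] .
  have f_meas [measurable]: "f \<in> borel_measurable borel"
    unfolding f_def by measurable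
  have integrand: "cnj (Ap (exp x)) / Complex x (-1 * pi) * K x - Ap (exp x) / Complex x (1 * pi) * K x = 2 * pi * \<i> * (exp x *\<^sub>R f (exp x))" for x
  proof -
    have nz': "Complex x pi \<noteq> 0" "Complex x (-pi) \<noteq> 0" by (auto simp: complex_eq_iff)
    have ss: "x\<^sup>2 + pi\<^sup>2 > 0" by (simp add: add_nonneg_pos)
    have "Complex x pi * Complex x (-pi) = of_real (x\<^sup>2 + pi\<^sup>2)"
      by (simp add: complex_eq_iff power2_eq_square)
    then have "cnj (Ap (exp x)) / Complex x (-pi) - Ap (exp x) / Complex x pi =
        (cnj (Ap (exp x)) * Complex x pi - Ap (exp x) * Complex x (-pi)) / of_real (x\<^sup>2 + pi\<^sup>2)"
      using nz' by (simp add: diff_frac_eq mult.commute)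
    also have "cnj (Ap (exp x)) * Complex x pi - Ap (exp x) * Complex x (-pi) =
        2 * pi * \<i> * of_real (Re (Ap (exp x)) - x / pi * Im (Ap (exp x)))"
      by (simp add: complex_eq_iff field_simps)
    finally have d: "cnj (Ap (exp x)) / Complex x (-pi) - Ap (exp x) / Complex x pi = 2 * pi * \<i> * of_real (density (exp x))"
      by (simp add: density_def)
    have "K x = exp x *\<^sub>R (1 / (u + of_real (exp x)) - 1 / (v + of_real (exp x)))"
      using nz[of x] by (simp add: K_def scaleR_conv_of_real field_simps add_eq_0_iff)
    then have "2 * pi * \<i> * (exp x *\<^sub>R f (exp x)) = 2 * pi * \<i> * of_real (density (exp x)) * K x"
      by (simp add: f_def scaleR_conv_of_real)
    moreover have "cnj (Ap (exp x)) / Complex x (-1 * pi) * K x - Ap (exp x) / Complex x (1 * pi) * K x =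
        (cnj (Ap (exp x)) / Complex x (-pi) - Ap (exp x) / Complex x pi) * K x"
      by (simp add: left_diff_distrib)
    ultimately show ?thesis
      unfolding d by argo
  qed
  have int: "integrable lborel (\<lambda>x. 2 * pi * \<i> * (exp x *\<^sub>R f (exp x)))"
    unfolding integrand[symmetric] by (intro Bochner_Integration.integrable_diff conjunct1[OF H1] conjunct1[OF H2])
  have inv: "inverse (2 * pi * \<i>) * (2 * pi * \<i> * y) = y" for y :: complex
  proof -
    have "complex_of_real (2 * pi) * \<i> \<noteq> 0"
      by simp
    then have "inverse (2 * pi * \<i>) * (2 * pi * \<i>) = (1 :: complex)"
      by (rule left_inverse)
    then show ?thesis
      by (metis mult.assoc mult_1)
  qed
  have "integrable lborel (\<lambda>x. inverse (2 * pi * \<i>) * (2 * pi * \<i> * (exp x *\<^sub>R f (exp x))))"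
    by (intro integrable_mult_right int)
  also have "(\<lambda>x. inverse (2 * pi * \<i>) * (2 * pi * \<i> * (exp x *\<^sub>R f (exp x)))) = (\<lambda>x. exp x *\<^sub>R f (exp x))"
    by (simp only: inv)
  finally have "integrable lborel (\<lambda>x. exp x *\<^sub>R f (exp x))" .
  then have f_int: "set_integrable lborel {0<..} f"
    unfolding integrable_exp_substitution[OF f_meas] .
  have "c = (LBINT x. 2 * pi * \<i> * (exp x *\<^sub>R f (exp x)))"
    unfolding integrand[symmetric] c_eq[symmetric] by (intro Bochner_Integration.integral_diff[symmetric] conjunct1[OF H1] conjunct1[OF H2])
  also have "\<dots> = 2 * pi * \<i> * (LBINT t:{0<..}. f t)"
    unfolding integral_exp_substitution[OF f_meas f_int] by (rule integral_mult_right_zero)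
  finally have "A 0 * (1 / (1 - u) - 1 / (1 - v)) + A (Ln u) / Ln u - A (Ln v) / Ln v = (LBINT t:{0<..}. f t)"
    unfolding c_def by (subst (asm) mult_cancel_left) auto
  moreover have "1 / (1 - p) = - (1 / (p - 1))" for p :: complex
    by (metis minus_diff_eq minus_divide_right)
  ultimately show ?thesis
    using f_int by (simp add: algebra_simps)
qed

lemma two_point:
  assumes u: "u \<notin> \<real>\<^sub>\<le>\<^sub>0" "u \<noteq> 1" and v: "v \<notin> \<real>\<^sub>\<le>\<^sub>0" "v \<noteq> 1"
  shows two_point_integrable: "set_integrable lborel {0<..}
      (\<lambda>t. of_real (density t) * (1 / (u + of_real t) - 1 / (v + of_real t)))"
    and two_point_formula: "A (Ln u) / Ln u - A (Ln v) / Ln v = A 0 * (1 / (u - 1) - 1 / (v - 1)) +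
      (LBINT t:{0<..}. of_real (density t) * (1 / (u + of_real t) - 1 / (v + of_real t)))"
  using two_point_aux[OF assms] by (cases "u = v"; simp add: set_integrable_def set_lebesgue_integral_def)+

end

section \<open>Boundary values of the factors of Euler's product\<close>

text \<open>A compactly supported majorant for the singularity at \<open>t = 2 * j\<close>; the
  growth of the logarithm away from it is absorbed into powers of \<open>1 + t\<close>.\<close>

definition log_peak :: "real \<Rightarrow> real" where
  "log_peak y = (if \<bar>y\<bar> < 1 then \<bar>ln \<bar>y\<bar>\<bar> else 0)"

lemma log_peak_nonneg [simp]: "log_peak y \<ge> 0"
  by (simp add: log_peak_def)

lemma log_peak_measurable [measurable]: "log_peak \<in> borel_measurable borel"
  unfolding log_peak_def by measurable

lemma integrable_log_peak: "integrable lborel log_peak"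
proof -
  \<comment> \<open>An antiderivative of \<open>- ln y\<close> that extends continuously by 0 to the
    endpoint where the integrand is unbounded.\<close>
  define F :: "real \<Rightarrow> real" where "F = (\<lambda>y. y - y * ln y)"
  have "((\<lambda>y. - ln y) has_integral F 1 - F 0) {0..1::real}"
  proof (rule fundamental_theorem_of_calculus_interior)
    show "continuous_on {0..1} F"
      unfolding continuous_on_eq_continuous_within
    proof
      fix y :: real assume y: "y \<in> {0..1}"
      show "continuous (at y within {0..1}) F"
      proof (cases "y = 0")
        case True
        have "(F \<longlongrightarrow> 0) (at_right 0)"
          unfolding F_def by real_asymp
        then have "(F \<longlongrightarrow> F 0) (at 0 within {0..1})"
          unfolding at_within_Icc_at_right[OF zero_less_one] by (simp add: F_def)
        with True show ?thesis
          by (simp add: continuous_within)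
      next
        case False
        then show ?thesis
          unfolding F_def by (intro continuous_intros) auto
      qed
    qed
    show "(F has_vector_derivative - ln y) (at y)" if "y \<in> {0<..<1}" for y
      unfolding F_def has_real_derivative_iff_has_vector_derivative[symmetric]
      using that by (auto intro!: derivative_eq_intros)
  qed auto
  then have "(\<lambda>y. - ln y) absolutely_integrable_on {0..1::real}"
  proof (intro nonnegative_absolutely_integrable_1)
    show "0 \<le> - ln y" if "y \<in> {0..1}" for y :: real
      using that by (cases "y = 0") auto
  qed (rule has_integral_integrable)
  then have "set_integrable lborel {0..1} (\<lambda>y::real. - ln y)"
    unfolding set_integrable_def by (subst (asm) integrable_completion) auto
  then have i: "integrable lborel (\<lambda>y::real. indicator {0..1} y * - ln y)"
    by (simp add: set_integrable_def)
  have j: "integrable lborel (\<lambda>y::real. indicator {0..1} (- y) * - ln (- y))"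
    using lborel_integrable_real_affine[OF i, of "-1" 0] by simp
  show ?thesis
  proof (rule Bochner_Integration.integrable_bound[OF Bochner_Integration.integrable_add[OF i j]])
    show "AE y in lborel. norm (log_peak y) \<le> norm (indicator {0..1} y * - ln y + indicator {0..1} (- y) * - ln (- y))"
    proof (rule AE_I2)
      fix y :: real
      have "ln y < 0 \<longleftrightarrow> y < 1" if "y > 0" for y :: real using that by simp
      then show "norm (log_peak y) \<le> norm (indicator {0..1} y * - ln y + indicator {0..1} (- y) * - ln (- y))"
        by (cases "y = 0"; cases "y > 0") (auto simp: log_peak_def indicator_def)
    qed
  qed measurable
qed

text \<open>By translation invariance all peaks have the same mass, so that a sum over the centres
  \<open>2 * j\<close> is governed by the weights alone.\<close>

lemma integrable_log_peak_shift: "integrable lborel (\<lambda>t. log_peak (t - c))"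
  and integral_log_peak_shift: "(LBINT t. log_peak (t - c)) = (LBINT t. log_peak t)"
  using lborel_integrable_real_affine[OF integrable_log_peak, of 1 "- c"]
    lborel_integral_real_affine[of 1 log_peak "- c"] by simp_all

text \<open>The exponent is \<open>3/4 - 2\<close>: the growth allowed to the jumps, reduced by the
  decay of a difference of Cauchy kernels.\<close>

lemma integrable_powr_tail: "set_integrable lborel {0<..} (\<lambda>t::real. (1 + t) powr (-5/4))"
proof -
  have "(\<lambda>x::real. x powr (-5/4)) absolutely_integrable_on {1..}"
    using has_integral_powr_to_inf[of "-5/4" 1]
    by (intro nonnegative_absolutely_integrable_1) (auto simp: has_integral_integrable)
  then have "integrable lborel (\<lambda>x::real. indicator {1..} x * x powr (-5/4))"
    unfolding set_integrable_def by (subst (asm) integrable_completion) auto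
  from lborel_integrable_real_affine[OF this, of 1 1]
  have "set_integrable lborel {0..} (\<lambda>t::real. (1 + t) powr (-5/4))"
    by (simp add: set_integrable_def indicator_def)
  then show ?thesis
    by (rule set_integrable_subset) auto
qed

lemma ln_double_le: "t \<ge> 1 \<Longrightarrow> ln (2 * t) \<le> 8 * (1 + t) powr (1/4)" for t :: real
proof -
  assume t: "t \<ge> 1"
  have "ln (2 * t) \<le> (2 * t) powr (1/4) / (1/4)"
    using t by (intro ln_powr_bound) auto
  also have "\<dots> \<le> (2 * (1 + t)) powr (1/4) / (1/4)"
    using t by (intro divide_right_mono powr_mono2) auto
  also have "\<dots> = 4 * 2 powr (1/4) * (1 + t) powr (1/4)"
    using t by (subst powr_mult) auto
  also have "\<dots> \<le> 4 * 2 powr 1 * (1 + t) powr (1/4)"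
    by (intro mult_left_mono mult_right_mono powr_mono) auto
  finally show ?thesis by simp
qed

text \<open>This range contains the singularity \<open>t = 2 * j\<close>. For
  \<open>t \<ge> j\<close> the distance \<open>|t - 2 * j|\<close> is at most \<open>2 * t\<close>,
  so its logarithm is either in the peak or below \<open>ln (2 * t)\<close>. At the singularity
  itself the left side is 0 by the convention \<open>ln 0 = 0\<close>.\<close>

lemma abs_ln_abs_one_minus_far:
  fixes t :: real
  assumes "j \<ge> 1" "t \<ge> j"
  shows "\<bar>ln \<bar>1 - t / (2 * j)\<bar>\<bar> \<le> log_peak (t - 2 * j) + 2 * ln (2 * t)"
proof (cases "t = 2 * j")
  case False
  have "1 - t / (2 * j) = (2 * j - t) / (2 * j)"
    using assms by (simp add: field_simps)
  then have "\<bar>1 - t / (2 * j)\<bar> = \<bar>t - 2 * j\<bar> / (2 * j)"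
    using assms by (simp add: abs_minus_commute)
  then have "\<bar>ln \<bar>1 - t / (2 * j)\<bar>\<bar> = \<bar>ln \<bar>t - 2 * j\<bar> - ln (2 * j)\<bar>"
    using assms False by (simp add: ln_div)
  also have "\<dots> \<le> \<bar>ln \<bar>t - 2 * j\<bar>\<bar> + \<bar>ln (2 * j)\<bar>"
    by (rule abs_triangle_ineq4)
  also have "\<bar>ln (2 * j)\<bar> \<le> ln (2 * t)"
    using assms by simp
  also have "\<bar>ln \<bar>t - 2 * j\<bar>\<bar> \<le> log_peak (t - 2 * j) + ln (2 * t)"
  proof (cases "\<bar>t - 2 * j\<bar> < 1")
    case True
    then show ?thesis using assms by (simp add: log_peak_def)
  next
    case f: False
    then have "ln \<bar>t - 2 * j\<bar> \<ge> 0" by simp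
    moreover have "ln \<bar>t - 2 * j\<bar> \<le> ln (2 * t)"
      using assms f by (subst ln_le_cancel_iff) auto
    ultimately show ?thesis
      using log_peak_nonneg[of "t - 2 * j"] by linarith
  qed
  finally show ?thesis by simp
qed (use assms in auto)

text \<open>A quadratic Taylor remainder, available because \<open>t / (2 * j) < 1 / 2\<close>. The
  linear term is retained since it cancels in \<open>euler_jump\<close>.\<close>

lemma ln_abs_one_minus_near:
  fixes t :: real
  assumes "j \<ge> 1" "0 < t" "t < j"
  shows "\<bar>ln \<bar>1 - t / (2 * j)\<bar> + t / (2 * j)\<bar> \<le> t\<^sup>2 / (2 * j\<^sup>2)"
proof -
  have "\<bar>ln (1 + (- (t / (2 * j)))) - (- (t / (2 * j)))\<bar> \<le> 2 * (- (t / (2 * j)))\<^sup>2"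
    using assms by (intro abs_ln_one_plus_x_minus_x_bound) (auto simp: field_simps)
  moreover have "\<bar>1 - t / (2 * j)\<bar> = 1 + (- (t / (2 * j)))"
    using assms by (simp add: field_simps)
  ultimately show ?thesis
    by (simp add: power2_eq_square field_simps)
qed

lemma abs_ln_abs_one_minus_le:
  fixes t :: real
  assumes "j \<ge> 1" "t > 0"
  shows "\<bar>ln \<bar>1 - t / (2 * j)\<bar>\<bar> \<le> 1 + log_peak (t - 2 * j) + 16 * (1 + t) powr (1/4)"
proof (cases "t < j")
  case True
  have "t\<^sup>2 \<le> j\<^sup>2" using assms True by (intro power_mono) auto
  then have "t\<^sup>2 / (2 * j\<^sup>2) \<le> 1/2" using assms by (simp add: field_simps)
  moreover have "t / (2 * j) \<le> 1/2" "t / (2 * j) \<ge> 0" using assms True by (auto simp: field_simps)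
  ultimately have "\<bar>ln \<bar>1 - t / (2 * j)\<bar>\<bar> \<le> 1"
    using ln_abs_one_minus_near[OF assms True] by linarith
  moreover have "16 * (1 + t) powr (1/4) \<ge> 0" by simp
  ultimately show ?thesis
    using log_peak_nonneg[of "t - 2 * j"] by linarith
next
  case False
  then show ?thesis
    using abs_ln_abs_one_minus_far[of j t] ln_double_le[of t] assms by auto
qed

text \<open>
  On the upper side of the cut at \<^term>\<open>- t\<close>, the imaginary part of
  \<open>((u/2) ln(1 + 1/j) - Log(1 + u/(2j))) / Log u\<close> is \<open>- \<pi> / ((ln t)\<^sup>2 + \<pi>\<^sup>2)\<close> times the following function.
\<close>

definition euler_jump :: "nat \<Rightarrow> real \<Rightarrow> real" where
  "euler_jump j t = - (t / 2) * ln (1 + 1 / real j) - ln \<bar>1 - t / (2 * real j)\<bar> + (if t > 2 * real j then ln t else 0)"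

lemma euler_jump_measurable [measurable]: "euler_jump j \<in> borel_measurable borel"
  unfolding euler_jump_def by measurable

text \<open>For \<open>t < j\<close> the linear terms \<open>t / (2 * j)\<close> cancel and
  \<open>(1 + t) / j^2\<close> remains; there a factor \<open>(1 + t) powr (1/4)\<close> is
  exchanged for \<open>(2 * j) powr (1/4)\<close>. For \<open>t \<ge> j\<close> the terms
  \<open>1 / j\<close> and \<open>ln (2 * t) / t\<close> remain besides the peak, and powers of
  \<open>t\<close> are exchanged for negative powers of \<open>j\<close>. In the result
  \<open>-5/4 < -1\<close> allows summation over \<open>j\<close>, and \<open>3/4 < 1\<close> allows
  integration against \<open>(1 + t)^(-2)\<close>. The constant 60 merely covers both cases.\<close>

lemma abs_euler_jump_le:
  assumes j: "j \<ge> 1" and t: "t > 0"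
  shows "\<bar>euler_jump j t\<bar> / t \<le> 60 * (real j powr (-5/4) * (1 + t) powr (3/4) + log_peak (t - 2 * real j) / real j)"
proof -
  let ?L = "log_peak (t - 2 * real j)"
  have j1: "real j \<ge> 1" using j by simp
  have e: "0 \<le> 1 / real j - ln (1 + 1 / real j)" "1 / real j - ln (1 + 1 / real j) \<le> 1 / (real j)\<^sup>2"
    using ln_add_one_self_le_self[of "1 / real j"] ln_one_plus_pos_lower_bound[of "1 / real j"] j1
    by (auto simp: power_divide)
  show ?thesis
  proof (cases "t < real j")
    case True
    have "\<bar>euler_jump j t\<bar> = \<bar>t / 2 * (1 / real j - ln (1 + 1 / real j)) - (ln \<bar>1 - t / (2 * real j)\<bar> + t / (2 * real j))\<bar>"
      using True t by (simp add: euler_jump_def algebra_simps)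
    also have "\<dots> \<le> t / 2 * (1 / (real j)\<^sup>2) + t\<^sup>2 / (2 * (real j)\<^sup>2)"
    proof -
      have "\<bar>t / 2 * (1 / real j - ln (1 + 1 / real j))\<bar> \<le> t / 2 * (1 / (real j)\<^sup>2)"
        using mult_left_mono[OF e(2), of "t / 2"] mult_nonneg_nonneg[OF _ e(1), of "t / 2"] t by simp
      then show ?thesis
        using ln_abs_one_minus_near[OF j1 t True] by linarith
    qed
    also have "\<dots> \<le> t * ((1 + t) / (real j)\<^sup>2)"
      using j1 t by (simp add: field_simps power2_eq_square)
    finally have "\<bar>euler_jump j t\<bar> / t \<le> (1 + t) / (real j)\<^sup>2"
      using t by (simp add: field_simps)
    also have "\<dots> = (1 + t) powr (3/4) * (1 + t) powr (1/4) * real j powr (-2)"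
      using t j1 powr_add[of "1 + t" "3/4" "1/4"] powr_minus_divide[of "real j" 2] by simp
    also have "\<dots> \<le> (1 + t) powr (3/4) * (2 * real j) powr (1/4) * real j powr (-2)"
    proof -
      have "1 + t \<le> 2 * real j" using j1 True by linarith
      then show ?thesis
        using t by (intro mult_right_mono mult_left_mono powr_mono2) auto
    qed
    also have "\<dots> = 2 powr (1/4) * ((1 + t) powr (3/4) * real j powr (-7/4))"
      using j1 powr_add[of "real j" "1/4" "-2"] powr_mult[of 2 "real j" "1/4"] by simp
    also have "\<dots> \<le> 2 powr 1 * ((1 + t) powr (3/4) * real j powr (-5/4))"
      using j1 t by (intro mult_mono powr_mono mult_nonneg_nonneg) auto
    also have "\<dots> \<le> 60 * (real j powr (-5/4) * (1 + t) powr (3/4) + ?L / real j)"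
    proof -
      have "2 * (real j powr (-5/4) * (1 + t) powr (3/4)) \<le> 60 * (real j powr (-5/4) * (1 + t) powr (3/4))"
        by (intro mult_right_mono) auto
      moreover have "?L / real j \<ge> 0" by simp
      ultimately show ?thesis by (simp add: algebra_simps)
    qed
    finally show ?thesis .
  next
    case False
    define p where "p = (1 + t) powr (1/4)"
    define q where "q = real j powr (-5/4) * (1 + t) powr (3/4)"
    have L: "?L \<ge> 0" by simp
    have l2: "ln (2 * t) \<le> 8 * p" "ln t \<ge> 0" "ln t \<le> ln (2 * t)"
      using False j1 ln_double_le[of t] by (auto simp: p_def)
    have "t / 2 * ln (1 + 1 / real j) \<le> t / 2 * (1 / real j)"
      using e t by (intro mult_left_mono) auto
    moreover have "t / 2 * ln (1 + 1 / real j) \<ge> 0"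
      using t j1 by simp
    ultimately have X: "\<bar>- (t / 2) * ln (1 + 1 / real j)\<bar> \<le> t / 2 * (1 / real j)"
      by simp
    have Y: "\<bar>ln \<bar>1 - t / (2 * real j)\<bar>\<bar> \<le> ?L + 2 * ln (2 * t)"
      using False by (intro abs_ln_abs_one_minus_far[OF j1]) auto
    have Z: "\<bar>if t > 2 * real j then ln t else 0\<bar> \<le> ln (2 * t)"
      using l2 by auto
    have "\<bar>x - y + z\<bar> \<le> a + b + c" if "\<bar>x\<bar> \<le> a" "\<bar>y\<bar> \<le> b" "\<bar>z\<bar> \<le> c" for x y z a b c :: real
      using that by linarith
    from this[OF X Y Z] have "\<bar>euler_jump j t\<bar> \<le> t / 2 * (1 / real j) + (?L + 2 * ln (2 * t)) + ln (2 * t)"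
      unfolding euler_jump_def .
    also have "\<dots> \<le> t * (1 / real j) + (?L + 24 * p)"
    proof -
      have "t / 2 * (1 / real j) \<le> t * (1 / real j)"
        using t by (intro mult_right_mono) auto
      then show ?thesis
        using l2(1) by linarith
    qed
    finally have "\<bar>euler_jump j t\<bar> / t \<le> (t * (1 / real j) + (?L + 24 * p)) / t"
      using t by (intro divide_right_mono) auto
    also have "\<dots> = 1 / real j + ?L / t + 24 * (p / t)"
      using t by (simp add: field_simps)
    also have "?L / t \<le> ?L / real j"
      using False j1 L by (intro divide_left_mono) auto
    also have "1 / real j = real j powr (-5/4) * real j powr (1/4)"
      using j1 powr_add[of "real j" "-5/4" "1/4"] powr_minus_divide[of "real j" 1] by simp
    also have "\<dots> \<le> real j powr (-5/4) * (1 + t) powr (1/4)"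
      using False j1 by (intro mult_left_mono powr_mono2) auto
    also have "\<dots> \<le> q"
      unfolding q_def using t by (intro mult_left_mono powr_mono) auto
    also have "p / t \<le> 2 * q"
    proof -
      have "p / t \<le> p / ((1 + t) / 2)"
        using False j1 t unfolding p_def by (intro divide_left_mono) auto
      also have "\<dots> = 2 * ((1 + t) powr (1/4) * (1 + t) powr (-1))"
        using t powr_minus_divide[of "1 + t" 1] by (simp add: p_def)
      also have "\<dots> = 2 * ((1 + t) powr (-5/4) * (1 + t) powr (1/2))"
        using powr_add[of "1 + t" "1/4" "-1"] powr_add[of "1 + t" "-5/4" "1/2"] by simp
      also have "\<dots> \<le> 2 * q"
        unfolding q_def using False j1 t by (intro mult_left_mono mult_mono powr_mono powr_mono2') auto
      finally show ?thesis .
    qed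
    \<comment> \<open>Here 49 is 1 from the term \<open>1 / j\<close> plus \<open>24 * 2\<close>
      from the logarithms.\<close>
    finally have "\<bar>euler_jump j t\<bar> / t \<le> 49 * q + ?L / real j"
      by simp
    also have "\<dots> \<le> 60 * q + 60 * (?L / real j)"
    proof -
      have "q \<ge> 0" "?L / real j \<ge> 0" by (simp_all add: q_def)
      then show ?thesis by linarith
    qed
    finally show ?thesis
      by (simp add: q_def algebra_simps)
  qed
qed

lemma one_plus_exp_not_nonpos_Reals:
  assumes "w \<in> pi_strip" "r > 0"
  shows "1 + exp w / of_real r \<notin> \<real>\<^sub>\<le>\<^sub>0"
proof
  assume *: "1 + exp w / of_real r \<in> \<real>\<^sub>\<le>\<^sub>0"
  then have "sin (Im w) = 0"
    using assms by (simp add: complex_nonpos_Reals_iff Im_exp)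
  then have "Im w = 0"
    using assms(1) sin_eq_0_pi[of "Im w"] by auto
  then have "Re (exp w) > 0"
    by (simp add: Re_exp)
  then have "Re (1 + exp w / of_real r) > 0"
    using assms(2) by (simp add: add_pos_pos)
  with * show False
    by (auto simp: complex_nonpos_Reals_iff)
qed

lemma integrable_dominated_by_powr:
  fixes f :: "real \<Rightarrow> real"
  assumes [measurable]: "f \<in> borel_measurable borel"
    and le: "\<And>t. t > 0 \<Longrightarrow> \<bar>f t\<bar> \<le> C * (1 + t) powr (3/4) + D * log_peak (t - c)" and D: "D \<ge> 0"
  shows "set_integrable lborel {0<..} (\<lambda>t. f t / (1 + t)\<^sup>2)"
proof -
  have i: "integrable lborel (\<lambda>t. C * (indicator {0<..} t * (1 + t) powr (-5/4)) + D * log_peak (t - c))"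
    using integrable_powr_tail
    by (intro Bochner_Integration.integrable_add integrable_mult_right integrable_log_peak_shift)
       (simp add: set_integrable_def)
  show ?thesis
    unfolding set_integrable_def
  proof (rule Bochner_Integration.integrable_bound[OF i])
    show "AE t in lborel. norm (indicator {0<..} t *\<^sub>R (f t / (1 + t)\<^sup>2)) \<le>
        norm (C * (indicator {0<..} t * (1 + t) powr (-5/4)) + D * log_peak (t - c))"
    proof (rule AE_I2)
      fix t :: real
      show "norm (indicator {0<..} t *\<^sub>R (f t / (1 + t)\<^sup>2)) \<le>
        norm (C * (indicator {0<..} t * (1 + t) powr (-5/4)) + D * log_peak (t - c))"
      proof (cases "t > 0")
        case True
        have "\<bar>f t\<bar> / (1 + t)\<^sup>2 \<le> (C * (1 + t) powr (3/4) + D * log_peak (t - c)) / (1 + t)\<^sup>2"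
          using le[OF True] by (intro divide_right_mono) auto
        also have "\<dots> = C * ((1 + t) powr (3/4) / (1 + t)\<^sup>2) + D * log_peak (t - c) / (1 + t)\<^sup>2"
          by (simp add: add_divide_distrib)
        also have "(1 + t) powr (3/4) / (1 + t)\<^sup>2 = (1 + t) powr (-5/4)"
          using True powr_diff[of "1 + t" "3/4" 2] by simp
        also have "D * log_peak (t - c) / (1 + t)\<^sup>2 \<le> D * log_peak (t - c) / 1"
          using True D by (intro divide_left_mono) auto
        finally show ?thesis
          using True by (simp add: abs_divide)
      qed auto
    qed
  qed measurable
qed

section \<open>The symbols: the constant 1 and the Euler factors\<close>

text \<open>The constant symbol represents \<open>1 / Ln u\<close>. Its boundary value exists at
  every radius, and the excepted radius 1 is an arbitrary choice.\<close>

lemma strip_function_one: "strip_function (\<lambda>_. 1) (\<lambda>_. 1) (\<lambda>_. 1) 1"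
proof -
  have "set_integrable lborel {0<..} (\<lambda>t::real. 1 / (1 + t)\<^sup>2)"
    by (rule integrable_dominated_by_powr[where C = 1 and D = 0 and c = 0]) (auto simp: ge_one_powr_ge_zero)
  moreover have "(\<lambda>n. exp (- real n)) \<longlonglongrightarrow> 0"
    by real_asymp
  ultimately show ?thesis
    by unfold_locales simp_all
qed

text \<open>\<open>exp (- w)\<close> stands for \<open>1 / u\<close>: a further division by
  \<open>w = Ln u\<close> gives the Euler term for \<open>u / 2\<close> over
  \<open>u * Ln u\<close>.\<close>

definition euler_symbol :: "nat \<Rightarrow> complex \<Rightarrow> complex" where
  "euler_symbol j w = of_real (ln (1 + 1 / real j) / 2) - exp (- w) * Ln (1 + exp w / of_real (2 * real j))"

text \<open>On the cut \<open>1 / u = - 1 / t\<close>, which reverses the sign of the logarithm.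
  Beyond \<open>t = 2 * j\<close> its argument reaches the negative axis from above, whence
  \<open>pi\<close>.\<close>

definition euler_boundary :: "nat \<Rightarrow> real \<Rightarrow> complex" where
  "euler_boundary j t = Complex (ln (1 + 1 / real j) / 2 + ln \<bar>1 - t / (2 * real j)\<bar> / t) (if t > 2 * real j then pi / t else 0)"

text \<open>The factor \<open>exp (- w)\<close> has modulus \<open>1 / t\<close> and is dangerous
  for small \<open>t\<close>, where it is compensated by
  \<open>|Ln (1 + \<zeta>)| \<le> 2 * |\<zeta>|\<close>. If \<open>|\<zeta>| \<ge> 1 / 2\<close>,
  then \<open>t \<ge> j \<ge> 1\<close> and the division is harmless. The inequality
  \<open>|1 + \<zeta>| \<ge> |1 - |\<zeta>||\<close> removes the dependence on the angle, as the
  majorant \<open>B\<close> requires.\<close>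

lemma norm_euler_symbol_le:
  assumes j: "j \<ge> 1" and w: "w \<in> pi_strip" "exp (Re w) \<noteq> 2 * real j"
  shows "norm (euler_symbol j w) \<le> 6 + \<bar>ln \<bar>1 - exp (Re w) / (2 * real j)\<bar>\<bar>"
proof -
  define t where "t = exp (Re w)"
  define \<zeta> where "\<zeta> = exp w / of_real (2 * real j)"
  define r where "r = t / (2 * real j)"
  have t: "t > 0" "t \<noteq> 2 * real j" using w by (auto simp: t_def)
  have j1: "real j \<ge> 1" using j by simp
  have r: "r > 0" "norm \<zeta> = r" "r \<noteq> 1"
    using t j1 by (auto simp: r_def \<zeta>_def norm_divide t_def)
  have nz: "1 + \<zeta> \<noteq> 0"
    using one_plus_exp_not_nonpos_Reals[OF w(1), of "2 * real j"] j1 by (auto simp: \<zeta>_def)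
  have "0 \<le> ln (1 + 1 / real j)" "ln (1 + 1 / real j) \<le> 1 / real j"
    using j1 ln_add_one_self_le_self[of "1 / real j"] by auto
  moreover have "1 / real j \<le> 1" using j1 by simp
  ultimately have c: "norm (complex_of_real (ln (1 + 1 / real j) / 2)) \<le> 1/2"
    by (simp only: norm_of_real)
  have "norm (exp (- w) * Ln (1 + \<zeta>)) \<le> 5 + \<bar>ln \<bar>1 - r\<bar>\<bar>"
  proof (cases "r < 1/2")
    case True
    have "norm (exp (- w) * Ln (1 + \<zeta>)) = norm (Ln (1 + \<zeta>)) / t"
      by (simp add: norm_mult norm_inverse t_def exp_minus divide_inverse mult.commute)
    also have "\<dots> \<le> 2 * r / t"
      using norm_Ln_le[of \<zeta>] True r t by (intro divide_right_mono) auto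
    also have "\<dots> = 1 / real j"
      using t by (simp add: r_def)
    also have "\<dots> \<le> 5 + \<bar>ln \<bar>1 - r\<bar>\<bar>"
      using \<open>1 / real j \<le> 1\<close> by linarith
    finally show ?thesis .
  next
    case False
    then have "t \<ge> 1"
      using j1 by (auto simp: r_def field_simps)
    have "\<bar>1 - r\<bar> \<le> norm (1 + \<zeta>)"
      using norm_triangle_ineq3[of 1 "- \<zeta>"] r by simp
    moreover have le: "norm (1 + \<zeta>) \<le> 1 + r"
      using norm_triangle_ineq[of 1 \<zeta>] r by simp
    ultimately have "\<bar>ln (norm (1 + \<zeta>))\<bar> \<le> \<bar>ln \<bar>1 - r\<bar>\<bar> + ln (1 + r)"
    proof -
      have "ln \<bar>1 - r\<bar> \<le> ln (norm (1 + \<zeta>))" "ln (norm (1 + \<zeta>)) \<le> ln (1 + r)"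
        using \<open>\<bar>1 - r\<bar> \<le> norm (1 + \<zeta>)\<close> le r nz by (auto intro!: ln_mono)
      moreover have "ln (1 + r) \<ge> 0" using r by simp
      ultimately show ?thesis by linarith
    qed
    also have "ln (1 + r) \<le> r"
      using ln_add_one_self_le_self[of r] r by simp
    finally have "norm (Ln (1 + \<zeta>)) \<le> \<bar>ln \<bar>1 - r\<bar>\<bar> + r + pi"
      using cmod_le[of "Ln (1 + \<zeta>)"] Im_Ln_le_pi[OF nz] mpi_less_Im_Ln[OF nz] nz by simp
    moreover have "norm (exp (- w) * Ln (1 + \<zeta>)) = norm (Ln (1 + \<zeta>)) / t"
      by (simp add: norm_mult norm_inverse t_def exp_minus divide_inverse mult.commute)
    ultimately have "norm (exp (- w) * Ln (1 + \<zeta>)) \<le> (\<bar>ln \<bar>1 - r\<bar>\<bar> + r + pi) / t"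
      using t by (simp add: divide_right_mono)
    also have "\<dots> = (\<bar>ln \<bar>1 - r\<bar>\<bar> + pi) / t + r / t"
      by (simp add: add_divide_distrib)
    also have "\<dots> \<le> (\<bar>ln \<bar>1 - r\<bar>\<bar> + pi) / 1 + 1 / (2 * real j)"
      using \<open>t \<ge> 1\<close> by (intro add_mono divide_left_mono) (auto simp: r_def)
    also have "\<dots> \<le> 5 + \<bar>ln \<bar>1 - r\<bar>\<bar>"
      using \<open>1 / real j \<le> 1\<close> pi_less_4 by (simp add: field_simps)
    finally show ?thesis .
  qed
  then have "norm (euler_symbol j w) \<le> 1/2 + (5 + \<bar>ln \<bar>1 - r\<bar>\<bar>)"
    unfolding euler_symbol_def \<zeta>_def[symmetric] using c by (intro order.trans[OF norm_triangle_ineq4] add_mono)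
  then show ?thesis
    by (simp add: r_def t_def)
qed

lemma euler_symbol_boundary:
  assumes j: "j \<ge> 1" and t: "t > 0" "t \<noteq> 2 * real j"
  shows "((\<lambda>\<theta>. euler_symbol j (Complex (ln t) \<theta>)) \<longlongrightarrow> euler_boundary j t) (at_left pi)"
proof -
  define \<zeta> where "\<zeta> = (\<lambda>\<theta>. exp (Complex (ln t) \<theta>) / of_real (2 * real j))"
  have j1: "real j \<ge> 1" using j by simp
  have e: "exp (Complex (ln t) pi) = - of_real t" "exp (- Complex (ln t) pi) = - of_real (1 / t)"
    using t by (auto simp: exp_eq_polar complex_eq_iff exp_minus field_simps)
  have w: "((\<lambda>\<theta>. Complex (ln t) \<theta>) \<longlongrightarrow> Complex (ln t) pi) (at_left pi)"
    by (intro tendsto_Complex tendsto_intros)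
  have lim1: "((\<lambda>\<theta>. exp (- Complex (ln t) \<theta>)) \<longlongrightarrow> - of_real (1 / t)) (at_left pi)"
    unfolding e(2)[symmetric] by (intro tendsto_intros w)
  have "(\<zeta> \<longlongrightarrow> exp (Complex (ln t) pi) / of_real (2 * real j)) (at_left pi)"
    unfolding \<zeta>_def using j1 by (intro tendsto_intros w) auto
  then have lim\<zeta>: "((\<lambda>\<theta>. 1 + \<zeta> \<theta>) \<longlongrightarrow> of_real (1 - t / (2 * real j))) (at_left pi)"
    unfolding e by (auto intro!: tendsto_eq_intros)
  define l where "l = Complex (ln \<bar>1 - t / (2 * real j)\<bar>) (if t > 2 * real j then pi else 0)"
  have lim2: "((\<lambda>\<theta>. Ln (1 + \<zeta> \<theta>)) \<longlongrightarrow> l) (at_left pi)"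
  proof (cases "t < 2 * real j")
    case True
    then have pos: "1 - t / (2 * real j) > 0"
      using j1 by simp
    then have "((\<lambda>\<theta>. Ln (1 + \<zeta> \<theta>)) \<longlongrightarrow> Ln (of_real (1 - t / (2 * real j)))) (at_left pi)"
      by (intro tendsto_Ln lim\<zeta>) (simp del: of_real_diff)
    also have "Ln (of_real (1 - t / (2 * real j))) = l"
      using pos True by (subst Ln_of_real) (auto simp: l_def complex_eq_iff)
    finally show ?thesis .
  next
    case False
    then have pos: "t / (2 * real j) - 1 > 0"
      using j1 t by simp
    \<comment> \<open>Now the limit of \<open>1 + \<zeta> \<theta>\<close> lies on the branch cut of
      \<open>Ln\<close>. Its negative tends to a positive real, where \<open>Ln\<close> is
      continuous; \<open>Im (\<zeta> \<theta>) > 0\<close> below the edge fixes the correction as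
      \<open>+ \<i> * pi\<close>.\<close>
    have "((\<lambda>\<theta>. - (1 + \<zeta> \<theta>)) \<longlongrightarrow> of_real (t / (2 * real j) - 1)) (at_left pi)"
      using tendsto_minus[OF lim\<zeta>] by simp
    then have "((\<lambda>\<theta>. Ln (- (1 + \<zeta> \<theta>)) + \<i> * pi) \<longlongrightarrow> Ln (of_real (t / (2 * real j) - 1)) + \<i> * pi) (at_left pi)"
      using pos by (intro tendsto_intros) (simp_all del: of_real_diff)
    also have "Ln (of_real (t / (2 * real j) - 1)) + \<i> * pi = l"
      using pos False t by (subst Ln_of_real) (auto simp: l_def complex_eq_iff)
    finally show ?thesis
    proof (rule Lim_transform_eventually)
      have "\<forall>\<^sub>F \<theta> in at_left pi. \<theta> \<in> {0<..<pi}"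
        by (intro eventually_at_left_real) auto
      then show "\<forall>\<^sub>F \<theta> in at_left pi. Ln (- (1 + \<zeta> \<theta>)) + \<i> * pi = Ln (1 + \<zeta> \<theta>)"
      proof eventually_elim
        case (elim \<theta>)
        then have "Im (\<zeta> \<theta>) > 0"
          using j1 t by (auto simp: \<zeta>_def Im_exp sin_gt_zero)
        then have "- (1 + \<zeta> \<theta>) \<noteq> 0" "Im (- (1 + \<zeta> \<theta>)) < 0"
          by (auto simp: complex_eq_iff)
        then show ?case
          using Ln_minus[of "- (1 + \<zeta> \<theta>)"] by (metis less_irrefl less_imp_le minus_minus)
      qed
    qed
  qed
  have "((\<lambda>\<theta>. of_real (ln (1 + 1 / real j) / 2) - exp (- Complex (ln t) \<theta>) * Ln (1 + \<zeta> \<theta>)) \<longlongrightarrow>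
      of_real (ln (1 + 1 / real j) / 2) - (- of_real (1 / t)) * l) (at_left pi)"
    by (intro tendsto_intros lim1 lim2)
  also have "of_real (ln (1 + 1 / real j) / 2) - (- of_real (1 / t)) * l = euler_boundary j t"
    by (simp add: l_def euler_boundary_def complex_eq_iff)
  finally show ?thesis
    by (simp add: euler_symbol_def \<zeta>_def)
qed

lemma strip_function_euler_symbol:
  assumes j: "j \<ge> 1"
  shows "strip_function (euler_symbol j) (euler_boundary j) (\<lambda>t. 6 + \<bar>ln \<bar>1 - t / (2 * real j)\<bar>\<bar>) (2 * real j)"
proof
  have j1: "real j \<ge> 1" using j by simp
  note nonpos = one_plus_exp_not_nonpos_Reals[where r = "2 * real j"]
  show "euler_symbol j holomorphic_on pi_strip"
    unfolding euler_symbol_def using nonpos j1 by (intro holomorphic_intros) auto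
  show "euler_symbol j (cnj w) = cnj (euler_symbol j w)" if "w \<in> pi_strip" for w
    using nonpos[OF that] j1 by (simp add: euler_symbol_def exp_cnj cnj_Ln)
  show "norm (euler_symbol j w) \<le> 6 + \<bar>ln \<bar>1 - exp (Re w) / (2 * real j)\<bar>\<bar>"
    if "w \<in> pi_strip" "exp (Re w) \<noteq> 2 * real j" for w
    using norm_euler_symbol_le[OF j that] .
  show "set_integrable lborel {0<..} (\<lambda>t. (6 + \<bar>ln \<bar>1 - t / (2 * real j)\<bar>\<bar>) / (1 + t)\<^sup>2)"
  \<comment> \<open>Here \<open>23 = 6 + 1 + 16\<close>, the last two from
    \<open>abs_ln_abs_one_minus_le\<close>; the constants and the power 1/4 are raised to the power
    3/4.\<close>
  proof (rule integrable_dominated_by_powr[where C = 23 and D = 1 and c = "2 * real j"])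
    fix t :: real assume t: "t > 0"
    have "(1 + t) powr (1/4) \<le> (1 + t) powr (3/4)" "1 \<le> (1 + t) powr (3/4)"
      using t by (auto intro: powr_mono ge_one_powr_ge_zero)
    then show "\<bar>6 + \<bar>ln \<bar>1 - t / (2 * real j)\<bar>\<bar>\<bar> \<le> 23 * (1 + t) powr (3/4) + 1 * log_peak (t - 2 * real j)"
      using abs_ln_abs_one_minus_le[OF j1 t] by linarith
  qed auto
  show "(\<lambda>n. (6 + \<bar>ln \<bar>1 - exp (real n) / (2 * real j)\<bar>\<bar>) * exp (- real n)) \<longlonglongrightarrow> 0"
    using j1 by real_asymp
  show "(\<lambda>n. (6 + \<bar>ln \<bar>1 - exp (- real n) / (2 * real j)\<bar>\<bar>) * exp (- real n)) \<longlonglongrightarrow> 0"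
    using j1 by real_asymp
  show "euler_boundary j \<in> borel_measurable borel"
    unfolding euler_boundary_def Complex_eq by measurable
  show "((\<lambda>\<theta>. euler_symbol j (Complex (ln t) \<theta>)) \<longlongrightarrow> euler_boundary j t) (at_left pi)"
    if "t > 0" "t \<noteq> 2 * real j" for t
    using euler_symbol_boundary[OF j that] .
qed (use j in auto)

lemma density_euler_symbol:
  assumes "t > 0" "j \<ge> 1"
  shows "strip_function.density (euler_boundary j) t = - (euler_jump j t / (t * ((ln t)\<^sup>2 + pi\<^sup>2)))"
proof -
  have "Re (euler_boundary j t) - ln t / pi * Im (euler_boundary j t) = - (euler_jump j t / t)"
    using assms by (simp add: euler_boundary_def euler_jump_def field_simps)
  then show ?thesis
    by (simp add: strip_function.density_def[OF strip_function_euler_symbol[OF assms(2)]])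
qed

section \<open>Summation over the factors\<close>

text \<open>By the recurrence of \<open>Digamma\<close> the difference of the two sides has
  derivative 0 on the connected cut plane, and it vanishes at 1. This secures the right branch when
  \<open>ln_Gamma z + Ln z\<close>, the limit of Euler's sums, is rewritten.\<close>

lemma ln_Gamma_complex_plus1:
  fixes z :: complex
  assumes "z \<notin> \<real>\<^sub>\<le>\<^sub>0"
  shows "ln_Gamma (z + 1) = ln_Gamma z + Ln z"
proof -
  let ?S = "- \<real>\<^sub>\<le>\<^sub>0 :: complex set"
  define h where "h = (\<lambda>z::complex. ln_Gamma (z + 1) - ln_Gamma z - Ln z)"
  have plus1: "z + 1 \<notin> \<real>\<^sub>\<le>\<^sub>0" if "z \<notin> \<real>\<^sub>\<le>\<^sub>0" for z :: complex
    using that by (auto simp: complex_nonpos_Reals_iff)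
  have "h constant_on ?S"
  proof (rule has_field_derivative_0_imp_constant_on)
    have "?S = - (complex_of_real ` {..0})"
      by (auto simp: nonpos_Reals_def)
    then show "connected ?S"
      using starlike_imp_connected[OF starlike_slotted_complex_plane_left[of 0]] by simp
    show "open ?S" by (simp add: open_Compl)
    fix z :: complex assume z: "z \<in> ?S"
    then have "z \<noteq> 0" by auto
    have "(h has_field_derivative (Digamma (z + 1) - Digamma z - 1 / z)) (at z)"
      unfolding h_def using z plus1[of z] by (auto intro!: derivative_eq_intros simp: divide_inverse)
    also have "Digamma (z + 1) - Digamma z - 1 / z = 0"
      using Digamma_plus1[OF \<open>z \<noteq> 0\<close>] by simp
    finally show "(h has_field_derivative 0) (at z)" .
  qed
  then obtain c where c: "\<And>z. z \<in> ?S \<Longrightarrow> h z = c"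
    unfolding constant_on_def by blast
  have "ln_Gamma (of_real x :: complex) = of_real (ln (Gamma x))" if "x > 0" for x :: real
    using that by (simp add: ln_Gamma_complex_of_real ln_Gamma_real_pos)
  from this[of 1] this[of 2] have "h 1 = 0"
    using Gamma_fact[of 1, where 'a = real] by (simp add: h_def)
  then have "h z = 0"
    using c[of 1] c[of z] assms by simp
  then show ?thesis
    by (simp add: h_def algebra_simps)
qed

lemma sum_ln_one_plus_inverse: "(\<Sum>k<n. ln (1 + 1 / real (Suc k))) = ln (real (Suc n))"
proof (induction n)
  case (Suc n)
  have "1 + 1 / real (Suc n) = real (Suc (Suc n)) / real (Suc n)"
    by (simp add: field_simps)
  then show ?case
    using Suc by (simp add: ln_div)
qed simp

lemma ln_Gamma_euler_sums:
  fixes z :: complex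
  assumes "z \<notin> \<real>\<^sub>\<le>\<^sub>0"
  shows "(\<lambda>k. z * of_real (ln (1 + 1 / real (Suc k))) - Ln (1 + z / of_real (real (Suc k)))) sums ln_Gamma (1 + z)"
proof -
  have z: "z \<notin> \<int>\<^sub>\<le>\<^sub>0"
    using assms nonpos_Ints_subset_nonpos_Reals by blast
  \<comment> \<open>The logarithms in Euler's partial sums telescope to \<open>ln (Suc n)\<close>,
    while \<open>ln_Gamma_series\<close> contains \<open>ln n\<close>; the correction term vanishes
    in the limit.\<close>
  have "(\<lambda>n. ln_Gamma_series z n + Ln z + z * of_real (ln (real (Suc n)) - ln (real n))) \<longlonglongrightarrow> ln_Gamma z + Ln z + z * of_real 0"
  proof (intro tendsto_intros ln_Gamma_complex_LIMSEQ z)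
    show "(\<lambda>n. ln (real (Suc n)) - ln (real n)) \<longlonglongrightarrow> 0"
      by real_asymp
  qed
  moreover have "ln_Gamma_series z n + Ln z + z * of_real (ln (real (Suc n)) - ln (real n)) =
      (\<Sum>k<n. z * of_real (ln (1 + 1 / real (Suc k))) - Ln (1 + z / of_real (real (Suc k))))" if "n > 0" for n
  proof -
    have "Ln (of_nat n :: complex) = of_real (ln (real n))"
      using that by (metis Ln_of_real of_nat_0_less_iff of_real_of_nat_eq)
    moreover have "(\<Sum>k=1..n. Ln (z / of_nat k + 1)) = (\<Sum>k<n. Ln (1 + z / of_real (real (Suc k))))"
      by (rule sum.reindex_bij_witness[of _ Suc "\<lambda>k. k - 1"]) (auto simp: add.commute)
    ultimately show ?thesis
      by (simp add: ln_Gamma_series_def sum_subtractf sum_ln_one_plus_inverse algebra_simps del: of_nat_Suc flip: sum_distrib_left of_real_sum)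
  qed
  ultimately have "(\<lambda>n. \<Sum>k<n. z * of_real (ln (1 + 1 / real (Suc k))) - Ln (1 + z / of_real (real (Suc k)))) \<longlonglongrightarrow> ln_Gamma z + Ln z"
    by (auto elim!: Lim_transform_eventually intro!: eventually_mono[OF eventually_gt_at_top[of 0]])
  then show ?thesis
    using ln_Gamma_complex_plus1[OF assms] by (simp add: sums_def add.commute)
qed

text \<open>The counterpart on the cut itself, where factors of the product may be negative;
  absolute values take care of the signs. Adding \<open>ln s\<close> turns
  \<open>Gamma (- s)\<close> into \<open>Gamma (1 - s)\<close>.\<close>

lemma ln_abs_Gamma_euler_sums:
  fixes s :: real
  assumes s: "s > 0" "s \<notin> \<nat>"
  shows "(\<lambda>k. - s * ln (1 + 1 / real (Suc k)) - ln \<bar>1 - s / real (Suc k)\<bar>) sums ln \<bar>Gamma (1 - s)\<bar>"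
proof -
  have z: "- s \<notin> \<int>\<^sub>\<le>\<^sub>0"
    using s by (metis minus_minus nonpos_Ints_cases' Nats_1 of_nat_in_Nats minus_equation_iff)
  have nz: "1 - s / real (Suc k) \<noteq> 0" for k
  proof
    assume "1 - s / real (Suc k) = 0"
    then have "s = real (Suc k)" by (simp add: field_simps)
    with s(2) show False by (metis of_nat_in_Nats)
  qed
  have G: "Gamma (- s) \<noteq> 0"
    using z by (rule Gamma_nonzero)
  have "(\<lambda>n. ln \<bar>Gamma_series_euler' (- s) n\<bar> + ln s) \<longlonglongrightarrow> ln \<bar>Gamma (- s)\<bar> + ln s"
    using G by (intro tendsto_intros Gamma_series_euler' z) auto
  also have "ln \<bar>Gamma (- s)\<bar> + ln s = ln \<bar>Gamma (1 - s)\<bar>"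
    using Gamma_plus1[OF z] s G by (simp add: abs_mult ln_mult)
  also have "(\<lambda>n. ln \<bar>Gamma_series_euler' (- s) n\<bar> + ln s) =
      (\<lambda>n. \<Sum>k<n. - s * ln (1 + 1 / real (Suc k)) - ln \<bar>1 - s / real (Suc k)\<bar>)"
  proof
    fix n
    have "Gamma_series_euler' (- s) n = inverse (- s) * (\<Prod>k<n. exp (- s * ln (1 + 1 / real (Suc k))) / (1 - s / real (Suc k)))"
      unfolding Gamma_series_euler'_def
      by (intro arg_cong2[of _ _ _ _ "(*)"] refl prod.reindex_bij_witness[of _ Suc "\<lambda>k. k - 1"])
         (auto simp: inverse_eq_divide)
    then have "\<bar>Gamma_series_euler' (- s) n\<bar> = inverse s * (\<Prod>k<n. exp (- s * ln (1 + 1 / real (Suc k))) / \<bar>1 - s / real (Suc k)\<bar>)"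
      using s by (simp add: abs_mult abs_prod)
    also have "ln \<dots> = - ln s + (\<Sum>k<n. ln (exp (- s * ln (1 + 1 / real (Suc k))) / \<bar>1 - s / real (Suc k)\<bar>))"
      using s nz by (subst ln_mult) (auto intro!: prod_pos ln_prod simp: ln_inverse)
    also have "(\<Sum>k<n. ln (exp (- s * ln (1 + 1 / real (Suc k))) / \<bar>1 - s / real (Suc k)\<bar>)) =
        (\<Sum>k<n. - s * ln (1 + 1 / real (Suc k)) - ln \<bar>1 - s / real (Suc k)\<bar>)"
      using nz by (intro sum.cong) (simp_all add: ln_div del: of_nat_Suc)
    finally show "ln \<bar>Gamma_series_euler' (- s) n\<bar> + ln s = (\<Sum>k<n. - s * ln (1 + 1 / real (Suc k)) - ln \<bar>1 - s / real (Suc k)\<bar>)"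
      by simp
  qed
  finally show ?thesis
    by (simp add: sums_def)
qed

section \<open>Non-negativity of the density and summation of the jumps\<close>

text \<open>Log-convexity between \<open>x\<close> and 2: the point 1 is the convex combination with
  weight \<open>l = 1 / (2 - x)\<close> on \<open>x\<close>, and
  \<open>Gamma 1 = Gamma 2 = 1\<close>, so \<open>ln (Gamma x)\<close> cannot be negative.\<close>

lemma Gamma_real_ge_1:
  fixes x :: real
  assumes "0 < x" "x \<le> 1"
  shows "Gamma x \<ge> 1"
proof -
  define l where "l = 1 / (2 - x)"
  have l: "0 < l" "l \<le> 1"
    using assms by (auto simp: l_def)
  have "(1 - l) *\<^sub>R 2 + l *\<^sub>R x = 2 - l * (2 - x)"
    by (simp add: algebra_simps)
  also have "\<dots> = 1"
    using assms by (simp add: l_def)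
  finally have e: "(1 - l) *\<^sub>R 2 + l *\<^sub>R x = 1" .
  have "(ln \<circ> Gamma) ((1 - l) *\<^sub>R 2 + l *\<^sub>R x) \<le> (1 - l) * (ln \<circ> Gamma) 2 + l * (ln \<circ> Gamma) x"
    using l assms by (intro convex_onD[OF log_convex_Gamma_real]) auto
  then have "0 \<le> l * ln (Gamma x)"
    unfolding e using Gamma_fact[of 1, where 'a = real] by simp
  then have "0 \<le> ln (Gamma x)"
    using l by (simp add: zero_le_mult_iff)
  then show ?thesis
    using Gamma_real_pos[OF assms(1)] by simp
qed

text \<open>With \<open>m = k - 1\<close>, raising the argument \<open>1 - t\<close> by
  \<open>m\<close> steps lands in the unit interval, where \<open>Gamma\<close> is at least 1. The
  recurrence contributes \<open>m\<close> factors of modulus at most \<open>2 * t\<close>, and the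
  logarithm of the resulting inequality is the sign of the numerator. At positive integers
  \<open>real_of_ereal\<close> turns \<open>\<infinity>\<close> into 0.\<close>

lemma d2_nonneg:
  assumes "t > 0"
  shows "real_of_ereal (d2 t) \<ge> 0"
proof (cases "t \<in> \<nat>")
  case False
  define m where "m = nat (\<lceil>t\<rceil> - 1)"
  have m: "of_int \<lceil>t\<rceil> - 1 = real m" "real m < t" "t \<le> real m + 1"
    using assms by (simp_all add: m_def) linarith+
  have "real m + 1 \<noteq> t"
    using False by (metis of_nat_in_Nats of_nat_Suc add.commute)
  then have t1: "real m + 1 - t > 0"
    using m by linarith
  have z: "1 - t \<notin> \<int>\<^sub>\<le>\<^sub>0"
  proof
    assume "1 - t \<in> \<int>\<^sub>\<le>\<^sub>0"
    then obtain n where "1 - t = - real n" by (auto elim!: nonpos_Ints_cases')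
    then have "t = real (Suc n)" by simp
    with False show False by (metis of_nat_in_Nats)
  qed
  have "\<bar>pochhammer (1 - t) m\<bar> = (\<Prod>i<m. \<bar>1 - t + real i\<bar>)"
    by (simp add: pochhammer_prod atLeast0LessThan abs_prod)
  also have "\<dots> \<le> (\<Prod>i<m. 2 * t)"
    using m by (intro prod_mono) auto
  also have "\<dots> = (2 * t) ^ m" by simp
  finally have le: "\<bar>pochhammer (1 - t) m\<bar> \<le> (2 * t) ^ m" .
  have "1 \<le> Gamma (1 - t + real m)"
    using m t1 by (intro Gamma_real_ge_1) auto
  also have "\<dots> = \<bar>pochhammer (1 - t) m\<bar> * \<bar>Gamma (1 - t)\<bar>"
    using pochhammer_Gamma[OF z, of m] Gamma_nonzero[OF z] \<open>1 \<le> Gamma (1 - t + real m)\<close>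
    by (simp add: field_simps flip: abs_mult)
  also have "\<dots> \<le> (2 * t) ^ m * \<bar>Gamma (1 - t)\<bar>"
    by (intro mult_right_mono le) auto
  finally have "0 \<le> ln ((2 * t) ^ m * \<bar>Gamma (1 - t)\<bar>)"
    by simp
  also have "\<dots> = real m * ln (2 * t) + ln \<bar>Gamma (1 - t)\<bar>"
    using assms Gamma_nonzero[OF z] by (simp add: ln_mult ln_realpow algebra_simps)
  finally show ?thesis
    using False assms by (auto simp: d2_def m intro!: divide_nonneg_nonneg mult_nonneg_nonneg)
qed (use assms in \<open>auto simp: d2_def\<close>)

text \<open>The point \<open>- t\<close> of the cut corresponds to the argument \<open>t / 2\<close>
  of \<open>d2\<close>; halving restores the denominator \<open>t\<close> of the jumps. The infinite
  values become 0, which affects only a null set.\<close>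

definition ball_density :: "real \<Rightarrow> real" where
  "ball_density t = real_of_ereal (d2 (t / 2)) / 2"

lemma ball_density_nonneg: "t > 0 \<Longrightarrow> ball_density t \<ge> 0"
  using d2_nonneg[of "t / 2"] by (simp add: ball_density_def)

lemma d2_measurable [measurable]: "d2 \<in> borel_measurable borel"
proof -
  have "rGamma \<in> borel_measurable (borel :: real measure)"
    by (intro borel_measurable_continuous_onI continuous_intros)
  then have "Gamma \<in> borel_measurable (borel :: real measure)"
    unfolding Gamma_def[abs_def] by measurable
  note [measurable] = this
  have "(\<nat> :: real set) \<in> sets borel"
    by (rule sets.countable) (auto simp: Nats_def)
  note [measurable] = this
  show ?thesis
    unfolding d2_def[abs_def] by measurable
qed

lemma ball_density_measurable [measurable]: "ball_density \<in> borel_measurable borel"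
  unfolding ball_density_def by measurable

text \<open>The term \<open>ln t\<close> occurs once for each \<open>j\<close> with
  \<open>2 * j < t\<close>. If \<open>t / 2\<close> lies between \<open>k - 1\<close> and
  \<open>k\<close> there are \<open>k - 1\<close> of these, which explains the summand
  \<open>(k - 1) * ln (2 * s)\<close> of \<open>d2 s\<close> at \<open>s = t / 2\<close>.\<close>

lemma euler_jump_sums:
  assumes t: "t > 0" "t / 2 \<notin> \<nat>"
  shows "(\<lambda>k. euler_jump (Suc k) t / (t * ((ln t)\<^sup>2 + pi\<^sup>2))) sums ball_density t"
proof -
  define s where "s = t / 2"
  define m where "m = nat (\<lceil>s\<rceil> - 1)"
  have s: "s > 0" "s \<notin> \<nat>" "t = 2 * s" using t by (auto simp: s_def)
  have m: "of_int \<lceil>s\<rceil> - 1 = real m" "real m < s" "s \<le> real m + 1"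
    using s by (simp_all add: m_def) linarith+
  have "(\<lambda>k. if k \<in> {..<m} then ln t else 0) sums (\<Sum>k<m. ln t)"
    by (intro sums_If_finite_set) auto
  moreover have "k \<in> {..<m} \<longleftrightarrow> t > 2 * real (Suc k)" for k
  proof -
    have "s \<noteq> real m + 1"
      using s by (metis of_nat_in_Nats of_nat_Suc add.commute)
    then show ?thesis
      using m s by auto
  qed
  ultimately have "(\<lambda>k. if t > 2 * real (Suc k) then ln t else 0) sums (real m * ln t)"
    by simp
  from sums_add[OF ln_abs_Gamma_euler_sums[OF s(1,2)] this]
  have "(\<lambda>k. euler_jump (Suc k) t) sums (ln \<bar>Gamma (1 - s)\<bar> + real m * ln t)"
    by (simp add: euler_jump_def s_def cong: if_cong)
  from sums_divide[OF this, of "t * ((ln t)\<^sup>2 + pi\<^sup>2)"] show ?thesis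
    using s m by (simp add: ball_density_def d2_def mult_ac)
qed

section \<open>Termwise integration of the two-point formulas\<close>

lemma norm_cauchy_kernel_le:
  fixes u :: complex
  assumes "u \<notin> \<real>\<^sub>\<le>\<^sub>0"
  obtains C where "C > 0" "\<And>t. t \<ge> 0 \<Longrightarrow> norm (1 / (u + of_real t)) \<le> C / (1 + t)"
    "\<And>t. t \<ge> 0 \<Longrightarrow> u + of_real t \<noteq> 0"
proof -
  obtain d where d: "d > 0" "\<And>r. r \<ge> 0 \<Longrightarrow> norm (of_real r + u) \<ge> d * (1 + r)"
    using norm_add_cut_plane_ge[OF assms] by metis
  show thesis
  proof
    show "1 / d > 0" using d by simp
    fix t :: real assume t: "t \<ge> 0"
    have pos: "d * (1 + t) > 0" using d t by simp
    have le: "d * (1 + t) \<le> norm (u + of_real t)"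
      using d(2)[OF t] by (simp add: add.commute)
    show "u + of_real t \<noteq> 0"
      using le pos by auto
    have "norm (1 / (u + of_real t)) = 1 / norm (u + of_real t)"
      by (simp add: norm_divide)
    also have "\<dots> \<le> 1 / (d * (1 + t))"
      using le mult_pos_pos[OF less_le_trans[OF pos le] pos] by (intro divide_left_mono) auto
    finally show "norm (1 / (u + of_real t)) \<le> 1 / d / (1 + t)"
      by simp
  qed
qed

lemma norm_cauchy_kernel_diff_le:
  fixes u v :: complex
  assumes "u \<notin> \<real>\<^sub>\<le>\<^sub>0" "v \<notin> \<real>\<^sub>\<le>\<^sub>0"
  obtains C where "C > 0" "\<And>t. t \<ge> 0 \<Longrightarrow> norm (1 / (u + of_real t) - 1 / (v + of_real t)) \<le> C / (1 + t)\<^sup>2"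
proof -
  obtain C where C: "C > 0" "\<And>t. t \<ge> 0 \<Longrightarrow> norm (1 / (u + of_real t)) \<le> C / (1 + t)"
    "\<And>t. t \<ge> 0 \<Longrightarrow> u + of_real t \<noteq> 0"
    using norm_cauchy_kernel_le[OF assms(1)] by metis
  obtain D where D: "D > 0" "\<And>t. t \<ge> 0 \<Longrightarrow> norm (1 / (v + of_real t)) \<le> D / (1 + t)"
    "\<And>t. t \<ge> 0 \<Longrightarrow> v + of_real t \<noteq> 0"
    using norm_cauchy_kernel_le[OF assms(2)] by metis
  show thesis
  proof
    show "C * D * (norm (v - u) + 1) > 0"
      using C D by (intro mult_pos_pos) (auto intro: add_nonneg_pos)
    fix t :: real assume t: "t \<ge> 0"
    have "1 / (u + of_real t) - 1 / (v + of_real t) = (1 / (u + of_real t)) * (1 / (v + of_real t)) * (v - u)"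
      using C(3)[OF t] D(3)[OF t] by (simp add: field_simps)
    also have "norm \<dots> \<le> (C / (1 + t)) * (D / (1 + t)) * (norm (v - u) + 1)"
      unfolding norm_mult using C D t by (intro mult_mono) auto
    finally show "norm (1 / (u + of_real t) - 1 / (v + of_real t)) \<le> C * D * (norm (v - u) + 1) / (1 + t)\<^sup>2"
      by (simp add: power2_eq_square)
  qed
qed

lemma euler_symbol_Ln:
  assumes "u \<noteq> 0"
  shows "euler_symbol j (Ln u) =
    (u / 2 * of_real (ln (1 + 1 / real j)) - Ln (1 + u / 2 / of_real (real j))) / u"
  using assms by (simp add: euler_symbol_def exp_minus field_simps)

lemma euler_symbol_Ln_sums:
  assumes "u \<notin> \<real>\<^sub>\<le>\<^sub>0"
  shows "(\<lambda>k. euler_symbol (Suc k) (Ln u)) sums (ln_Gamma (1 + u / 2) / u)"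
proof -
  have "u \<noteq> 0" using assms by auto
  moreover have "u / 2 \<notin> \<real>\<^sub>\<le>\<^sub>0"
    using assms by (auto simp: complex_nonpos_Reals_iff)
  ultimately show ?thesis
    using sums_divide[OF ln_Gamma_euler_sums[of "u / 2"], of u] by (simp add: euler_symbol_Ln del: of_nat_Suc)
qed

lemma ball_two_point:
  assumes u: "u \<notin> \<real>\<^sub>\<le>\<^sub>0" "u \<noteq> 1" and v: "v \<notin> \<real>\<^sub>\<le>\<^sub>0" "v \<noteq> 1"
  defines "K \<equiv> \<lambda>t. 1 / (u + of_real t) - 1 / (v + of_real t)"
  shows ball_two_point_integrable: "set_integrable lborel {0<..} (\<lambda>t. of_real (ball_density t) * K t)"
    and ball_two_point_formula: "ln_Gamma (1 + u / 2) / (u * Ln u) - ln_Gamma (1 + v / 2) / (v * Ln v) =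
      ln_Gamma (3 / 2) * (1 / (u - 1) - 1 / (v - 1)) -
      (LBINT t:{0<..}. of_real (ball_density t) * K t)"
proof -
  obtain C where C: "C > 0" "\<And>t. t \<ge> 0 \<Longrightarrow> norm (K t) \<le> C / (1 + t)\<^sup>2"
    unfolding K_def using norm_cauchy_kernel_diff_le[OF u(1) v(1)] by metis
  have [measurable]: "K \<in> borel_measurable borel"
    unfolding K_def by measurable
  define X where "X = (\<lambda>t. (ln t)\<^sup>2 + pi\<^sup>2)"
  have X: "X t \<ge> 1" for t
  proof -
    have "1 \<le> pi\<^sup>2"
      using pi_gt3 by (intro one_le_power) simp
    moreover have "0 \<le> (ln t)\<^sup>2"
      by simp
    ultimately show ?thesis
      unfolding X_def by linarith
  qed
  define f where "f = (\<lambda>k t. indicator {0<..} t *\<^sub>R (of_real (euler_jump (Suc k) t / (t * X t)) * K t))"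
  have f_meas [measurable]: "f k \<in> borel_measurable lborel" for k
    unfolding f_def X_def by measurable
  define w where "w = (\<lambda>k. real (Suc k) powr (-5/4))"
  \<comment> \<open>A fixed integrable profile plus a moving peak, both with the summable weight
    \<open>w k\<close>. Since all peaks have equal mass, the integral of \<open>h k\<close> is a
    constant times \<open>w k\<close>.\<close>
  define h where "h = (\<lambda>k t. 60 * C * w k * (indicator {0<..} t * (1 + t) powr (-5/4) + log_peak (t - 2 * real (Suc k))))"
  have "summable (\<lambda>k. real k powr (-5/4))"
    by (simp add: summable_real_powr_iff)
  then have w_summable: "summable w"
    unfolding w_def by (subst summable_Suc_iff)
  have le: "norm (f k t) \<le> h k t" for k t
  proof (cases "t > 0")
    case True
    define J where "J = real (Suc k)"
    have J: "J \<ge> 1" by (simp add: J_def)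
    let ?L = "log_peak (t - 2 * J)"
    have K1: "norm (K t) \<le> C / (1 + t)\<^sup>2" using C True by auto
    have "\<bar>euler_jump (Suc k) t / (t * X t)\<bar> = \<bar>euler_jump (Suc k) t\<bar> / t / X t"
      using True X[of t] by (simp add: abs_divide abs_mult)
    also have "\<dots> \<le> \<bar>euler_jump (Suc k) t\<bar> / t / 1"
      using True X[of t] by (intro divide_left_mono) auto
    also have "\<dots> \<le> 60 * (J powr (-5/4) * (1 + t) powr (3/4) + ?L / J)"
      unfolding J_def using abs_euler_jump_le[of "Suc k" t] True by simp
    finally have ej: "\<bar>euler_jump (Suc k) t / (t * X t)\<bar> \<le> 60 * (J powr (-5/4) * (1 + t) powr (3/4) + ?L / J)" .
    have "norm (f k t) = \<bar>euler_jump (Suc k) t / (t * X t)\<bar> * norm (K t)"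
      using True by (simp only: f_def norm_mult norm_of_real norm_scaleR indicator_simps greaterThan_iff abs_one mult_1)
    also have "\<dots> \<le> 60 * (J powr (-5/4) * (1 + t) powr (3/4) + ?L / J) * (C / (1 + t)\<^sup>2)"
      using ej K1 by (intro mult_mono order.trans[OF abs_ge_zero ej]) auto
    also have "\<dots> = 60 * C * (J powr (-5/4) * ((1 + t) powr (3/4) / (1 + t)\<^sup>2) + ?L * (1 / (J * (1 + t)\<^sup>2)))"
      by (simp add: ring_distribs add_divide_distrib mult_ac)
    also have "(1 + t) powr (3/4) / (1 + t)\<^sup>2 = (1 + t) powr (-5/4)"
      using True powr_diff[of "1 + t" "3/4" 2] by simp
    \<comment> \<open>The weight \<open>1 / J\<close> of the peak alone would not be summable. On
      the support of the peak \<open>1 + t \<ge> J\<close>, so the decay of the kernel improves it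
      to \<open>J powr (-2)\<close>.\<close>
    also have "?L * (1 / (J * (1 + t)\<^sup>2)) \<le> J powr (-5/4) * ?L"
    proof (cases "\<bar>t - 2 * J\<bar> < 1")
      case near: True
      then have "J \<le> 1 + t" using J by linarith
      then have "J * J powr 1 \<le> J * (1 + t)\<^sup>2"
        using J self_le_power[of "1 + t" 2] by (intro mult_left_mono) auto
      then have "1 / (J * (1 + t)\<^sup>2) \<le> 1 / (J * J powr 1)"
        using J True by (intro divide_left_mono) auto
      also have "\<dots> = J powr (-2)"
        using J powr_minus_divide[of J 2] by (simp add: power2_eq_square)
      also have "\<dots> \<le> J powr (-5/4)"
        using J by (intro powr_mono) auto
      finally have "?L * (1 / (J * (1 + t)\<^sup>2)) \<le> ?L * J powr (-5/4)"
        by (intro mult_left_mono) auto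
      then show ?thesis by (simp add: mult.commute)
    qed (simp add: log_peak_def)
    finally show ?thesis
      using True C(1) by (simp add: h_def w_def J_def algebra_simps)
  next
    case False
    have "h k t \<ge> 0"
      unfolding h_def w_def using C(1) by (intro mult_nonneg_nonneg add_nonneg_nonneg) auto
    with False show ?thesis by (simp add: f_def)
  qed
  have tail: "integrable lborel (\<lambda>t. indicator {0<..} t * (1 + t) powr (-5/4) :: real)"
    using integrable_powr_tail by (simp add: set_integrable_def)
  have h_int: "integrable lborel (h k)" for k
    unfolding h_def by (intro integrable_mult_right Bochner_Integration.integrable_add tail integrable_log_peak_shift)
  have h_integral: "(LBINT t. h k t) = 60 * C * w k * ((LBINT t. indicator {0<..} t * (1 + t) powr (-5/4)) + (LBINT t. log_peak t))" for k
    by (simp only: h_def integral_mult_right_zero Bochner_Integration.integral_add[OF tail integrable_log_peak_shift] integral_log_peak_shift)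
  have f_int: "integrable lborel (f k)" for k
    by (rule Bochner_Integration.integrable_bound[OF h_int[of k] f_meas])
       (auto intro!: AE_I2 order.trans[OF le])
  have norm_summable: "summable (\<lambda>k. norm (f k t))" for t
  proof (rule summable_comparison_test_ev)
    \<comment> \<open>For fixed \<open>t\<close> only finitely many peaks reach \<open>t\<close>;
      from this index on the profile alone dominates.\<close>
    define N where "N = nat \<lceil>\<bar>t\<bar> + 1\<rceil>"
    show "summable (\<lambda>k. 60 * C * w k * (indicator {0<..} t * (1 + t) powr (-5/4)))"
      by (intro summable_mult summable_mult2 w_summable)
    show "\<forall>\<^sub>F k in sequentially. norm (norm (f k t)) \<le> 60 * C * w k * (indicator {0<..} t * (1 + t) powr (-5/4))"
      using eventually_ge_at_top[of N]
    proof eventually_elim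
      case (elim k)
      then have "real k \<ge> \<bar>t\<bar> + 1"
        unfolding N_def by linarith
      then have "log_peak (t - 2 * real (Suc k)) = 0"
        by (simp add: log_peak_def)
      then show ?case
        using le[of k t] by (simp add: h_def)
    qed
  qed
  have int_summable: "summable (\<lambda>k. LBINT t. norm (f k t))"
  proof (rule summable_comparison_test[OF exI[of _ 0]])
    show "summable (\<lambda>k. LBINT t. h k t)"
      unfolding h_integral by (intro summable_mult summable_mult2 w_summable)
    show "\<forall>k\<ge>0. norm (LBINT t. norm (f k t)) \<le> (LBINT t. h k t)"
    proof (intro allI impI)
      fix k
      have "norm (LBINT t. norm (f k t)) = (LBINT t. norm (f k t))"
        by (simp add: integral_nonneg_AE)
      also have "\<dots> \<le> (LBINT t. h k t)"
        using f_int h_int le by (intro integral_mono) auto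
      finally show "norm (LBINT t. norm (f k t)) \<le> (LBINT t. h k t)" .
    qed
  qed
  have AE_eq: "AE t in lborel. (\<Sum>k. f k t) = indicator {0<..} t *\<^sub>R (of_real (ball_density t) * K t)"
  proof (rule AE_I')
    have "countable ((\<lambda>n. 2 * real n) ` UNIV)"
      by auto
    then show "range (\<lambda>n. 2 * real n) \<in> null_sets lborel"
      by (rule countable_imp_null_set_lborel)
    have "(\<Sum>k. f k t) = indicator {0<..} t *\<^sub>R (of_real (ball_density t) * K t)"
      if "t \<notin> range (\<lambda>n. 2 * real n)" for t
    proof (cases "t > 0")
      case True
      have "t / 2 \<notin> \<nat>"
      proof
        assume "t / 2 \<in> \<nat>"
        then obtain n where "t / 2 = real n" by (auto elim: Nats_cases)
        then have "t = 2 * real n" by simp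
        with that show False by auto
      qed
      from euler_jump_sums[OF True this]
      have "(\<lambda>k. of_real (euler_jump (Suc k) t / (t * X t)) * K t) sums (of_real (ball_density t) * K t)"
        unfolding X_def by (intro sums_mult2 sums_of_real)
      then show ?thesis
        using True by (simp add: f_def sums_iff)
    qed (simp add: f_def)
    then show "{t \<in> space lborel. (\<Sum>k. f k t) \<noteq> indicator {0<..} t *\<^sub>R (of_real (ball_density t) * K t)} \<subseteq> range (\<lambda>n. 2 * real n)"
      by auto
  qed
  have S_meas: "(\<lambda>t. indicator {0<..} t *\<^sub>R (of_real (ball_density t) * K t)) \<in> borel_measurable lborel"
    by measurable
  have "integrable lborel (\<lambda>t. \<Sum>k. f k t)"
    by (rule integrable_suminf[OF f_int AE_I2[OF norm_summable] int_summable])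
  then show int: "set_integrable lborel {0<..} (\<lambda>t. of_real (ball_density t) * K t)"
    unfolding set_integrable_def by (rule integrable_cong_AE_imp[OF _ S_meas]) (use AE_eq in auto)
  have "(\<lambda>k. LBINT t. f k t) sums (LBINT t. \<Sum>k. f k t)"
    by (rule sums_integral[OF f_int AE_I2[OF norm_summable] int_summable])
  also have "(LBINT t. \<Sum>k. f k t) = (LBINT t:{0<..}. of_real (ball_density t) * K t)"
    unfolding set_lebesgue_integral_def using S_meas AE_eq by (intro integral_cong_AE) auto
  finally have sum1: "(\<lambda>k. LBINT t. f k t) sums (LBINT t:{0<..}. of_real (ball_density t) * K t)" .
  have eq: "euler_symbol (Suc k) (Ln u) / Ln u - euler_symbol (Suc k) (Ln v) / Ln v =
      euler_symbol (Suc k) 0 * (1 / (u - 1) - 1 / (v - 1)) - (LBINT t. f k t)" for k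
  proof -
    interpret strip_function "euler_symbol (Suc k)" "euler_boundary (Suc k)"
        "\<lambda>t. 6 + \<bar>ln \<bar>1 - t / (2 * real (Suc k))\<bar>\<bar>" "2 * real (Suc k)"
      by (rule strip_function_euler_symbol) simp
    have "(LBINT t:{0<..}. of_real (density t) * K t) = (LBINT t. - f k t)"
      unfolding set_lebesgue_integral_def
    proof (intro Bochner_Integration.integral_cong refl)
      show "indicator {0<..} t *\<^sub>R (of_real (density t) * K t) = - f k t" for t
        using density_euler_symbol[of t "Suc k"] by (cases "t > 0") (simp_all add: f_def X_def)
    qed
    then show ?thesis
      using two_point_formula[OF u v] by (simp add: K_def)
  qed
  have "(\<lambda>k. euler_symbol (Suc k) (Ln u) / Ln u - euler_symbol (Suc k) (Ln v) / Ln v) sums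
      (ln_Gamma (1 + u / 2) / u / Ln u - ln_Gamma (1 + v / 2) / v / Ln v)"
    by (intro sums_diff sums_divide euler_symbol_Ln_sums u v)
  moreover have "(\<lambda>k. euler_symbol (Suc k) 0 * (1 / (u - 1) - 1 / (v - 1)) - (LBINT t. f k t)) sums
      (ln_Gamma (3 / 2) * (1 / (u - 1) - 1 / (v - 1)) - (LBINT t:{0<..}. of_real (ball_density t) * K t))"
    \<comment> \<open>At \<open>u = 1\<close> one has \<open>Ln u = 0\<close>, so the coefficients
      at the pole sum to \<open>ln_Gamma (3 / 2)\<close>.\<close>
    using euler_symbol_Ln_sums[of 1] by (intro sums_diff sums_mult2 sum1) auto
  ultimately have "ln_Gamma (1 + u / 2) / u / Ln u - ln_Gamma (1 + v / 2) / v / Ln v =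
      ln_Gamma (3 / 2) * (1 / (u - 1) - 1 / (v - 1)) - (LBINT t:{0<..}. of_real (ball_density t) * K t)"
    unfolding eq by (rule sums_unique2)
  then show "ln_Gamma (1 + u / 2) / (u * Ln u) - ln_Gamma (1 + v / 2) / (v * Ln v) =
      ln_Gamma (3 / 2) * (1 / (u - 1) - 1 / (v - 1)) -
      (LBINT t:{0<..}. of_real (ball_density t) * K t)"
    by (simp only: divide_divide_eq_left)
qed

text \<open>
  Letting \<^term>\<open>v\<close> tend to infinity in a two-point formula: the integrands increase with \<^term>\<open>v\<close>,
  so monotone convergence yields the integrability of the density and the value at infinity at once.
\<close>

lemma two_point_imp_one_point:
  fixes G :: "complex \<Rightarrow> complex" and \<rho> :: "real \<Rightarrow> real"
  assumes [measurable]: "\<rho> \<in> borel_measurable borel"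
    and \<rho>: "\<And>t. t > 0 \<Longrightarrow> \<rho> t \<ge> 0"
    and int: "\<And>u v :: complex. \<lbrakk>u \<notin> \<real>\<^sub>\<le>\<^sub>0; u \<noteq> 1; v \<notin> \<real>\<^sub>\<le>\<^sub>0; v \<noteq> 1\<rbrakk> \<Longrightarrow>
      set_integrable lborel {0<..} (\<lambda>t. of_real (\<rho> t) * (1 / (u + of_real t) - 1 / (v + of_real t)))"
    and eq: "\<And>u v :: complex. \<lbrakk>u \<notin> \<real>\<^sub>\<le>\<^sub>0; u \<noteq> 1; v \<notin> \<real>\<^sub>\<le>\<^sub>0; v \<noteq> 1\<rbrakk> \<Longrightarrow>
      G u - G v = (LBINT t:{0<..}. of_real (\<rho> t) * (1 / (u + of_real t) - 1 / (v + of_real t)))"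
    and lim: "(\<lambda>n. G (of_real (2 * real n + 4))) \<longlonglongrightarrow> L"
    and u: "u \<notin> \<real>\<^sub>\<le>\<^sub>0" "u \<noteq> 1"
  shows one_point_integrable: "set_integrable lborel {0<..} (\<lambda>t. of_real (\<rho> t) / (u + of_real t))"
    and one_point_formula: "G u = L + (LBINT t:{0<..}. of_real (\<rho> t) / (u + of_real t))"
proof -
  \<comment> \<open>Even integers make \<open>1 + v n / 2\<close> an integer, so that in the
    application \<open>ln_Gamma\<close> there is the logarithm of a factorial.\<close>
  define v where "v = (\<lambda>n. 2 * real n + 4)"
  have v: "complex_of_real (v n) \<notin> \<real>\<^sub>\<le>\<^sub>0" "complex_of_real (v n) \<noteq> 1" "v n > 0" for n
    by (auto simp: v_def complex_nonpos_Reals_iff complex_eq_iff)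
  \<comment> \<open>Monotone convergence needs real integrands, so it is run from the real base
    point 2; a general \<open>u\<close> is reached by adding the two-point formula for
    \<open>u\<close> and 2.\<close>
  have two: "(2 :: complex) \<notin> \<real>\<^sub>\<le>\<^sub>0" "(2 :: complex) \<noteq> 1"
    by (auto simp: complex_nonpos_Reals_iff)
  define g where "g = (\<lambda>n t. indicator {0<..} t * (\<rho> t * (1 / (2 + t) - 1 / (v n + t))))"
  define g' where "g' = (\<lambda>t. indicator {0<..} t * (\<rho> t / (2 + t)))"
  have cg: "indicator {0<..} t *\<^sub>R (of_real (\<rho> t) * (1 / (2 + of_real t) - 1 / (of_real (v n) + of_real t))) = complex_of_real (g n t)" for n t
    by (simp add: g_def scaleR_conv_of_real)
  have "integrable lborel (\<lambda>t. complex_of_real (g n t))" for n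
    using int[OF two v(1,2)[of n]] by (simp only: set_integrable_def cg)
  then have g_int: "integrable lborel (g n)" for n
    by (simp only: complex_of_real_integrable_eq)
  have g_eq: "G 2 - G (of_real (v n)) = of_real (LBINT t. g n t)" for n
    using eq[OF two v(1,2)[of n]] by (simp only: set_lebesgue_integral_def cg integral_complex_of_real)
  have g_lim: "(\<lambda>n. complex_of_real (LBINT t. g n t)) \<longlonglongrightarrow> G 2 - L"
    unfolding g_eq[symmetric] v_def by (intro tendsto_intros lim)
  have g'_int: "integrable lborel g'" and g'_eq: "(LBINT t. g' t) = Re (G 2 - L)"
  proof -
    have mono: "AE t in lborel. mono (\<lambda>n. g n t)"
    proof (intro AE_I2 monoI)
      fix t :: real and m n :: nat assume "m \<le> n"
      then have "1 / (v n + t) \<le> 1 / (v m + t)" if "t > 0"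
        using that v(3)[of m] v(3)[of n] by (intro divide_left_mono) (auto simp: v_def)
      then show "g m t \<le> g n t"
        using \<rho>[of t] by (cases "t > 0") (auto simp: g_def intro!: mult_left_mono)
    qed
    have pointwise: "AE t in lborel. (\<lambda>n. g n t) \<longlonglongrightarrow> g' t"
    proof (rule AE_I2)
      fix t :: real
      have "(\<lambda>n. 1 / (2 * real n + 4 + t)) \<longlonglongrightarrow> 0"
        by real_asymp
      then have "(\<lambda>n. g n t) \<longlonglongrightarrow> indicator {0<..} t * (\<rho> t * (1 / (2 + t) - 0))"
        unfolding g_def v_def by (intro tendsto_intros)
      then show "(\<lambda>n. g n t) \<longlonglongrightarrow> g' t"
        by (simp add: g'_def)
    qed
    have lim': "(\<lambda>n. LBINT t. g n t) \<longlonglongrightarrow> Re (G 2 - L)"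
      using tendsto_Re[OF g_lim] by simp
    have "g' \<in> borel_measurable lborel"
      unfolding g'_def by measurable
    note m = g_int mono pointwise lim' this
    show "integrable lborel g'" "(LBINT t. g' t) = Re (G 2 - L)"
      by (rule integrable_monotone_convergence[OF m] integral_monotone_convergence[OF m])+
  qed
  have "Im (G 2 - L) = 0"
    using LIMSEQ_unique[OF tendsto_Im[OF g_lim], of 0] by simp
  then have G2: "G 2 - L = of_real (LBINT t. g' t)"
    by (simp add: complex_eq_iff g'_eq)
  have g'_eq2: "indicator {0<..} t *\<^sub>R (of_real (\<rho> t) / (2 + of_real t)) = complex_of_real (g' t)" for t
    by (simp add: g'_def scaleR_conv_of_real)
  have int2: "set_integrable lborel {0<..} (\<lambda>t. of_real (\<rho> t) / (2 + of_real t) :: complex)"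
    unfolding set_integrable_def g'_eq2 using g'_int by simp
  have G2': "G 2 = L + (LBINT t:{0<..}. of_real (\<rho> t) / (2 + of_real t))"
    unfolding set_lebesgue_integral_def g'_eq2 using G2 by (simp add: algebra_simps)
  have sum_eq: "of_real (\<rho> t) / (u + of_real t) =
      of_real (\<rho> t) * (1 / (u + of_real t) - 1 / (2 + of_real t)) + of_real (\<rho> t) / (2 + of_real t)" for t
    by (simp add: right_diff_distrib)
  show "set_integrable lborel {0<..} (\<lambda>t. of_real (\<rho> t) / (u + of_real t))"
    unfolding sum_eq by (intro set_integral_add int u two int2)
  have "(LBINT t:{0<..}. of_real (\<rho> t) / (u + of_real t)) = G u - G 2 + (LBINT t:{0<..}. of_real (\<rho> t) / (2 + of_real t))"
    unfolding sum_eq eq[OF u two] by (intro set_integral_add int u two int2)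
  then show "G u = L + (LBINT t:{0<..}. of_real (\<rho> t) / (u + of_real t))"
    using G2' by (simp add: algebra_simps)
qed

section \<open>Exponentials of Stieltjes functions\<close>

text \<open>The induction represents the \<open>n\<close>-th derivative as \<open>(-1) ^ n\<close>
  times a member of \<open>K\<close>, on the open half-line only; agreement on an open set suffices
  to differentiate once more.\<close>

lemma completely_monotonic_closed_under_deriv:
  assumes f: "f \<in> K"
    and nonneg: "\<And>g x. \<lbrakk>g \<in> K; x > 0\<rbrakk> \<Longrightarrow> g x \<ge> 0"
    and deriv: "\<And>g. g \<in> K \<Longrightarrow> \<exists>h\<in>K. \<forall>x>0. (g has_real_derivative - h x) (at x)"
  shows "completely_monotonic f"
proof -
  have transform: "((deriv ^^ n) f has_real_derivative (-1) ^ n * - h x) (at x)"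
    if "\<forall>x>0. (deriv ^^ n) f x = (-1) ^ n * g x" "(g has_real_derivative - h x) (at x)" "x > 0" for n g h x
    by (rule has_field_derivative_transform_within_open[OF DERIV_cmult[OF that(2)], of "{0<..}"]) (use that in auto)
  have ex: "\<exists>g\<in>K. \<forall>x>0. (deriv ^^ n) f x = (-1) ^ n * g x" for n
  proof (induction n)
    case 0
    then show ?case using f by auto
  next
    case (Suc n)
    then obtain g where g: "g \<in> K" "\<forall>x>0. (deriv ^^ n) f x = (-1) ^ n * g x" by blast
    obtain h where h: "h \<in> K" "\<forall>x>0. (g has_real_derivative - h x) (at x)"
      using deriv[OF g(1)] by blast
    have "(deriv ^^ Suc n) f x = (-1) ^ Suc n * h x" if "x > 0" for x
      using DERIV_imp_deriv[OF transform[OF g(2)]] h(2) that by simp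
    with h(1) show ?case by blast
  qed
  show ?thesis
    unfolding completely_monotonic_def
  proof (intro allI impI conjI)
    fix n and x :: real assume x: "x > 0"
    obtain g where g: "g \<in> K" "\<forall>x>0. (deriv ^^ n) f x = (-1) ^ n * g x"
      using ex by blast
    obtain h where h: "h \<in> K" "\<forall>x>0. (g has_real_derivative - h x) (at x)"
      using deriv[OF g(1)] by blast
    show "(deriv ^^ n) f differentiable (at x)"
      using transform[OF g(2), of h x] h(2) x real_differentiable_def by blast
    have "(-1) ^ n * (deriv ^^ n) f x = ((-1) ^ n * (-1) ^ n) * g x"
      using g(2) x by simp
    also have "\<dots> = g x"
      by (simp flip: power_mult_distrib)
    finally show "(-1) ^ n * (deriv ^^ n) f x \<ge> 0"
      using nonneg[OF g(1) x] by simp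
  qed
qed

lemma completely_monotonic_cong:
  assumes f: "completely_monotonic f" and fg: "\<And>x. x > 0 \<Longrightarrow> f x = g x"
  shows "completely_monotonic g"
proof -
  have eq: "(deriv ^^ n) f x = (deriv ^^ n) g x" if "x > 0" for n x
    using that
  proof (induction n arbitrary: x)
    case (Suc n)
    have "\<forall>\<^sub>F y in nhds x. y \<in> {0<..}"
      using Suc.prems by (intro eventually_nhds_in_open) auto
    then have "\<forall>\<^sub>F y in nhds x. (deriv ^^ n) f y = (deriv ^^ n) g y"
      by eventually_elim (simp add: Suc.IH)
    then show ?case
      by (simp add: deriv_cong_ev)
  qed (simp add: fg)
  have "(deriv ^^ n) g differentiable (at x)" if "x > 0" for n x
  proof -
    have "(deriv ^^ n) f differentiable (at x)"
      using f that by (simp add: completely_monotonic_def)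
    then obtain D where "((deriv ^^ n) f has_real_derivative D) (at x)"
      unfolding real_differentiable_def by blast
    then have "((deriv ^^ n) g has_real_derivative D) (at x)"
      by (rule has_field_derivative_transform_within_open[of _ _ _ "{0<..}"]) (use that eq in auto)
    then show ?thesis
      unfolding real_differentiable_def by blast
  qed
  then show ?thesis
    using f unfolding completely_monotonic_def by (simp add: eq)
qed

section \<open>Moments of a Stieltjes measure\<close>

locale stieltjes_measure =
  fixes M :: "real measure"
  assumes sets_M: "sets M = sets (restrict_space borel {0::real..})"
    and finite_M: "(\<integral>\<^sup>+ t. ennreal (1 / (1 + t)) \<partial>M) < \<infinity>"
begin

lemma space_M: "space M = {0..}"
  using sets_eq_imp_space_eq[OF sets_M] by (simp add: space_restrict_space)

lemma measurable_M: "f \<in> borel_measurable borel \<Longrightarrow> f \<in> borel_measurable M"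
  using measurable_cong_sets[OF sets_M refl] measurable_restrict_space1 by blast

lemma integrable_power:
  assumes "c > 0"
  shows "integrable M (\<lambda>t. 1 / (c + t) ^ Suc m)"
proof (rule Bochner_Integration.integrable_bound)
  have "(\<integral>\<^sup>+ t. ennreal (norm (1 / (1 + t))) \<partial>M) = (\<integral>\<^sup>+ t. ennreal (1 / (1 + t)) \<partial>M)"
    by (intro nn_integral_cong) (simp add: space_M)
  then have "integrable M (\<lambda>t. 1 / (1 + t))"
    using finite_M by (intro integrableI_bounded measurable_M) (auto simp: less_top)
  then show "integrable M (\<lambda>t. max 1 (1 / c) * (1 / c) ^ m * (1 / (1 + t)))"
    by (intro integrable_mult_right)
  show "(\<lambda>t. 1 / (c + t) ^ Suc m) \<in> borel_measurable M"
    by (intro measurable_M) measurable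
  show "AE t in M. norm (1 / (c + t) ^ Suc m) \<le> norm (max 1 (1 / c) * (1 / c) ^ m * (1 / (1 + t)))"
  proof (rule AE_I2)
    fix t assume "t \<in> space M"
    then have t: "t \<ge> 0" by (simp add: space_M)
    \<comment> \<open>The factor \<open>max 1 (1 / c)\<close> serves both \<open>c < 1\<close> and
      \<open>c \<ge> 1\<close>; the other \<open>m\<close> powers are bounded by their value at
      \<open>t = 0\<close>.\<close>
    have "1 + t \<le> max 1 (1 / c) * c + max 1 (1 / c) * t"
      using assms t mult_right_mono[of 1 "max 1 (1 / c)" t] mult_right_mono[of "1 / c" "max 1 (1 / c)" c]
      by (intro add_mono) auto
    then have "1 + t \<le> max 1 (1 / c) * (c + t)"
      by (simp add: distrib_left)
    then have "1 / (c + t) \<le> max 1 (1 / c) * (1 / (1 + t))"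
      using assms t by (simp add: divide_le_eq pos_le_divide_eq)
    moreover have "(1 / (c + t)) ^ m \<le> (1 / c) ^ m"
      using assms t by (intro power_mono divide_left_mono) auto
    ultimately have "(1 / (c + t)) * (1 / (c + t)) ^ m \<le> (max 1 (1 / c) * (1 / (1 + t))) * (1 / c) ^ m"
      using assms t by (intro mult_mono) auto
    then show "norm (1 / (c + t) ^ Suc m) \<le> norm (max 1 (1 / c) * (1 / c) ^ m * (1 / (1 + t)))"
      using assms t by (simp add: power_divide mult_ac)
  qed
qed

text \<open>Up to the factor \<open>(-1) ^ m * fact m\<close> this is the \<open>m\<close>-th
  derivative of \<open>moment 0\<close>, the integral part of a Stieltjes function.\<close>

definition moment :: "nat \<Rightarrow> real \<Rightarrow> real" where
  "moment m x = (\<integral>t. 1 / (x + t) ^ Suc m \<partial>M)"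

lemma moment_nonneg: "x > 0 \<Longrightarrow> moment m x \<ge> 0"
  unfolding moment_def by (intro integral_nonneg_AE AE_I2) (simp add: space_M)

text \<open>Differentiation under the integral by dominated convergence along sequences. Once a
  sequence stays above \<open>x / 2\<close>, the mean value inequality bounds every difference
  quotient by the differentiated kernel at \<open>x / 2\<close>, which is integrable.\<close>

lemma has_derivative_moment:
  assumes x: "x > 0"
  shows "(moment m has_real_derivative - (real (Suc m) * moment (Suc m) x)) (at x)"
proof -
  define k where "k = (\<lambda>y t::real. 1 / (y + t) ^ Suc m)"
  define k' where "k' = (\<lambda>y t::real. - (real (Suc m) * (1 / (y + t) ^ Suc (Suc m))))"
  have der: "((\<lambda>y. k y t) has_real_derivative k' y t) (at y)" if "y > 0" "t \<ge> 0" for y t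
  proof -
    define p where "p = y + t"
    have p: "p > 0" using that by (simp add: p_def)
    have "((\<lambda>y. (y + t) ^ Suc m) has_real_derivative real (Suc m) * p ^ m) (at y)"
      unfolding p_def by (rule derivative_eq_intros refl)+ simp
    then have "((\<lambda>y. 1 / (y + t) ^ Suc m) has_real_derivative
        (0 * p ^ Suc m - 1 * (real (Suc m) * p ^ m)) / (p ^ Suc m * p ^ Suc m)) (at y)"
      unfolding p_def using that by (intro DERIV_divide DERIV_const) auto
    also have "(0 * p ^ Suc m - 1 * (real (Suc m) * p ^ m)) / (p ^ Suc m * p ^ Suc m) = k' y t"
      using p by (simp add: k'_def p_def[symmetric] divide_simps del: of_nat_Suc)
    finally show ?thesis
      by (simp only: k_def)
  qed
  have "((\<lambda>y. (moment m y - moment m x) / (y - x)) \<longlongrightarrow> - (real (Suc m) * moment (Suc m) x)) (at x)"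
    unfolding tendsto_at_iff_sequentially comp_def
  proof (intro allI impI)
    fix X :: "nat \<Rightarrow> real" assume X: "\<forall>i. X i \<in> UNIV - {x}" "X \<longlonglongrightarrow> x"
    have "\<forall>\<^sub>F n in sequentially. X n > x / 2"
      using X(2) x by (intro order_tendstoD) auto
    then obtain N where N: "\<And>n. n \<ge> N \<Longrightarrow> X n > x / 2"
      unfolding eventually_sequentially by blast
    define Y where "Y = (\<lambda>n. X (n + N))"
    have Y: "Y n > x / 2" "Y n \<noteq> x" "Y \<longlonglongrightarrow> x" for n
      using N X LIMSEQ_ignore_initial_segment[OF X(2)] by (auto simp: Y_def)
    define q where "q = (\<lambda>n t. (k (Y n) t - k x t) / (Y n - x))"
    have "(\<lambda>n. \<integral>t. q n t \<partial>M) \<longlonglongrightarrow> (\<integral>t. k' x t \<partial>M)"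
    proof (rule integral_dominated_convergence[where w = "\<lambda>t. real (Suc m) * (1 / (x / 2 + t) ^ Suc (Suc m))"])
      show "k' x \<in> borel_measurable M" "q n \<in> borel_measurable M" for n
        unfolding k'_def q_def k_def by (intro measurable_M; measurable)+
      show "integrable M (\<lambda>t. real (Suc m) * (1 / (x / 2 + t) ^ Suc (Suc m)))"
        using x by (intro integrable_mult_right integrable_power) auto
      show "AE t in M. (\<lambda>n. q n t) \<longlonglongrightarrow> k' x t"
      proof (rule AE_I2)
        fix t assume "t \<in> space M"
        then have "((\<lambda>y. (k y t - k x t) / (y - x)) \<longlongrightarrow> k' x t) (at x)"
          using der[OF x, of t] by (simp add: has_field_derivative_iff space_M)
        then show "(\<lambda>n. q n t) \<longlonglongrightarrow> k' x t"
          unfolding q_def tendsto_at_iff_sequentially comp_def using Y by auto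
      qed
      show "AE t in M. norm (q n t) \<le> real (Suc m) * (1 / (x / 2 + t) ^ Suc (Suc m))" for n
      proof (rule AE_I2)
        fix t assume "t \<in> space M"
        then have t: "t \<ge> 0" by (simp add: space_M)
        let ?B = "real (Suc m) * (1 / (x / 2 + t) ^ Suc (Suc m))"
        have "norm (k (Y n) t - k x t) \<le> ?B * norm (Y n - x)"
        proof (rule field_differentiable_bound[of "{x / 2<..}"])
          fix y assume y: "y \<in> {x / 2<..}"
          then show "((\<lambda>y. k y t) has_field_derivative k' y t) (at y within {x / 2<..})"
            using der[of y t] x t by (auto intro: has_field_derivative_at_within)
          have "1 / (y + t) ^ Suc (Suc m) \<le> 1 / (x / 2 + t) ^ Suc (Suc m)"
            using y x t by (intro divide_left_mono power_mono mult_pos_pos zero_less_power) auto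
          moreover have "norm (k' y t) = real (Suc m) * (1 / (y + t) ^ Suc (Suc m))"
            using y x t by (simp add: k'_def abs_mult del: of_nat_Suc)
          ultimately show "norm (k' y t) \<le> ?B"
            by (simp only: mult_left_mono of_nat_0_le_iff)
        qed (use Y x in auto)
        then show "norm (q n t) \<le> ?B"
          using Y(2)[of n] by (simp add: q_def divide_le_eq del: of_nat_Suc power_Suc)
      qed
    qed
    moreover have "(\<integral>t. k' x t \<partial>M) = - (real (Suc m) * moment (Suc m) x)"
      by (simp only: k'_def moment_def Bochner_Integration.integral_minus integral_mult_right_zero)
    moreover have "(\<integral>t. q n t \<partial>M) = (moment m (Y n) - moment m x) / (Y n - x)" for n
      using integrable_power[of x m] integrable_power[of "Y n" m] x Y(1)[of n]
      by (simp add: q_def k_def moment_def del: power_Suc)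
    ultimately have "(\<lambda>n. (moment m (Y n) - moment m x) / (Y n - x)) \<longlonglongrightarrow> - (real (Suc m) * moment (Suc m) x)"
      by simp
    then show "(\<lambda>n. (moment m (X n) - moment m x) / (X n - x)) \<longlonglongrightarrow> - (real (Suc m) * moment (Suc m) x)"
      unfolding Y_def by (rule LIMSEQ_offset)
  qed
  then show ?thesis
    by (simp add: has_field_derivative_iff)
qed

text \<open>Generated by what repeated differentiation produces: the exponential brings down
  \<open>moment 1\<close>, a moment yields the next one with a positive factor, and Leibniz' rule
  needs sums and products. The constant \<open>c\<close> may have any sign, as it occurs only inside
  the exponential.\<close>

inductive_set exp_cone :: "real \<Rightarrow> (real \<Rightarrow> real) set" for c where
  exp: "(\<lambda>x. exp (c + moment 0 x)) \<in> exp_cone c"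
| moment: "moment m \<in> exp_cone c"
| add: "\<lbrakk>f \<in> exp_cone c; g \<in> exp_cone c\<rbrakk> \<Longrightarrow> (\<lambda>x. f x + g x) \<in> exp_cone c"
| mult: "\<lbrakk>f \<in> exp_cone c; g \<in> exp_cone c\<rbrakk> \<Longrightarrow> (\<lambda>x. f x * g x) \<in> exp_cone c"
| scale: "\<lbrakk>f \<in> exp_cone c; r \<ge> 0\<rbrakk> \<Longrightarrow> (\<lambda>x. r * f x) \<in> exp_cone c"

lemma exp_cone_nonneg: "f \<in> exp_cone c \<Longrightarrow> x > 0 \<Longrightarrow> f x \<ge> 0"
  by (induction rule: exp_cone.induct) (auto intro: moment_nonneg)

lemma exp_cone_deriv: "f \<in> exp_cone c \<Longrightarrow> \<exists>h\<in>exp_cone c. \<forall>x>0. (f has_real_derivative - h x) (at x)"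
proof (induction rule: exp_cone.induct)
  case exp
  have "(\<lambda>x. moment 1 x * exp (c + moment 0 x)) \<in> exp_cone c"
    by (rule exp_cone.mult[OF exp_cone.moment exp_cone.exp])
  moreover have "((\<lambda>x. exp (c + moment 0 x)) has_real_derivative - (moment 1 x * exp (c + moment 0 x))) (at x)"
    if "x > 0" for x
    using DERIV_fun_exp[OF DERIV_add[OF DERIV_const has_derivative_moment[OF that, of 0]], of c]
    by (simp add: mult.commute)
  ultimately show ?case
    by (intro bexI[of _ "\<lambda>x. moment 1 x * exp (c + moment 0 x)"] allI impI)
next
  case (moment m)
  have "(\<lambda>x. real (Suc m) * moment (Suc m) x) \<in> exp_cone c"
    by (rule exp_cone.scale[OF exp_cone.moment]) simp
  then show ?case
    by (intro bexI[of _ "\<lambda>x. real (Suc m) * moment (Suc m) x"] allI impI has_derivative_moment)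
next
  case (add f g)
  then obtain f' g' where *: "f' \<in> exp_cone c" "g' \<in> exp_cone c"
    "\<forall>x>0. (f has_real_derivative - f' x) (at x)" "\<forall>x>0. (g has_real_derivative - g' x) (at x)"
    by blast
  then have "((\<lambda>x. f x + g x) has_real_derivative - (f' x + g' x)) (at x)" if "x > 0" for x
    using DERIV_add[of f "- f' x" x UNIV g "- g' x"] that by simp
  then show ?case
    by (intro bexI[of _ "\<lambda>x. f' x + g' x"] allI impI exp_cone.add[OF *(1,2)])
next
  case (mult f g)
  then obtain f' g' where *: "f' \<in> exp_cone c" "g' \<in> exp_cone c"
    "\<forall>x>0. (f has_real_derivative - f' x) (at x)" "\<forall>x>0. (g has_real_derivative - g' x) (at x)"
    by blast
  then have "((\<lambda>x. f x * g x) has_real_derivative - (f' x * g x + f x * g' x)) (at x)" if "x > 0" for x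
    using DERIV_mult[of f "- f' x" x UNIV g "- g' x"] that by (simp add: algebra_simps)
  moreover have "(\<lambda>x. f' x * g x + f x * g' x) \<in> exp_cone c"
    by (rule exp_cone.add[OF exp_cone.mult[OF *(1) mult.hyps(2)] exp_cone.mult[OF mult.hyps(1) *(2)]])
  ultimately show ?case
    by (intro bexI[of _ "\<lambda>x. f' x * g x + f x * g' x"] allI impI)
next
  case (scale f r)
  then obtain f' where *: "f' \<in> exp_cone c" "\<forall>x>0. (f has_real_derivative - f' x) (at x)"
    by blast
  then have "((\<lambda>x. r * f x) has_real_derivative - (r * f' x)) (at x)" if "x > 0" for x
    using DERIV_cmult[of f "- f' x" x UNIV r] that by simp
  then show ?case
    by (intro bexI[of _ "\<lambda>x. r * f' x"] allI impI exp_cone.scale[OF *(1) \<open>r \<ge> 0\<close>])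
qed

lemma completely_monotonic_exp_moment: "completely_monotonic (\<lambda>x. exp (c + moment 0 x))"
  using exp_cone_nonneg exp_cone_deriv
  by (intro completely_monotonic_closed_under_deriv[where K = "exp_cone c"] exp_cone.exp)

end

lemma completely_monotonic_exp_stieltjes:
  assumes "stieltjes_function g"
  shows "completely_monotonic (\<lambda>x. exp (g x + c))"
proof -
  obtain a M where M: "sets M = sets (restrict_space borel {0::real..})"
      "(\<integral>\<^sup>+ t. ennreal (1 / (1 + t)) \<partial>M) < \<infinity>" "\<forall>x>0. g x = a + (\<integral> t. 1 / (x + t) \<partial>M)"
    using assms unfolding stieltjes_function_def by blast
  interpret stieltjes_measure M
    using M by unfold_locales auto
  have "exp (g x + c) = exp ((a + c) + moment 0 x)" if "x > 0" for x
    using M(3) that by (simp add: moment_def algebra_simps)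
  then show ?thesis
    by (intro completely_monotonic_cong[OF completely_monotonic_exp_moment[of "a + c"]]) simp
qed

section \<open>The integral representation\<close>

text \<open>The measure is a mass \<open>a\<close> at 0 plus the density \<open>w\<close> translated
  by \<open>s\<close>. Realizing it as one image of a weighted Lebesgue measure reduces
  integrability and value to the transport formulas for densities and images.\<close>

lemma stieltjes_functionI_density:
  fixes w :: "real \<Rightarrow> real"
  assumes [measurable]: "w \<in> borel_measurable borel"
    and w: "\<And>t. t > 0 \<Longrightarrow> w t \<ge> 0" and a: "a \<ge> 0" and s: "s \<ge> 0"
    and int: "\<And>x. x > 0 \<Longrightarrow> set_integrable lborel {0<..} (\<lambda>t. w t / (x + s + t))"
    and g: "\<And>x. x > 0 \<Longrightarrow> g x = a / x + (LBINT t:{0<..}. w t / (x + s + t))"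
  shows "stieltjes_function g"
proof -
  \<comment> \<open>The point mass at \<^term>\<open>0::real\<close> is the image of Lebesgue measure on \<^term>\<open>{-1<..<0::real}\<close>.\<close>
  define q where "q = (\<lambda>t. a * indicator {-1<..<0} t + indicator {0<..} t * w t)"
  define T where "T = (\<lambda>t::real. if t > 0 then s + t else 0)"
  define R where "R = restrict_space borel {0::real..}"
  define M where "M = distr (density lborel (\<lambda>t. ennreal (q t))) R T"
  have q_nonneg: "q t \<ge> 0" for t
    unfolding q_def using a w[of t] by (auto simp: indicator_def)
  have q_meas [measurable]: "q \<in> borel_measurable borel"
    unfolding q_def by measurable
  have "T \<in> borel \<rightarrow>\<^sub>M R"
    unfolding R_def T_def using s by (intro measurable_restrict_space2) auto
  then have T_meas: "T \<in> density lborel (\<lambda>t. ennreal (q t)) \<rightarrow>\<^sub>M R"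
    by simp
  have f_meas: "f \<in> borel_measurable borel \<Longrightarrow> f \<in> borel_measurable R" for f :: "real \<Rightarrow> real"
    unfolding R_def by (rule measurable_restrict_space1)
  have T_borel [measurable]: "T \<in> borel_measurable borel"
    unfolding T_def by measurable
  have one: "integrable M (\<lambda>t. 1 / (x + t)) \<and> (\<integral>t. 1 / (x + t) \<partial>M) = a / x + (LBINT t:{0<..}. w t / (x + s + t))"
    if x: "x > 0" for x
  proof -
    have R_meas: "(\<lambda>t. 1 / (x + t)) \<in> borel_measurable R"
      by (intro f_meas) measurable
    have eq: "q t *\<^sub>R (1 / (x + T t)) = a / x * indicator {-1<..<0} t + indicator {0<..} t *\<^sub>R (w t / (x + s + t))" for t
      by (auto simp: q_def T_def indicator_def add.assoc)
    have i1: "integrable lborel (\<lambda>t. a / x * indicator {-1<..<0::real} t)"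
      by (intro integrable_mult_right integrable_real_indicator) auto
    have i2: "integrable lborel (\<lambda>t. indicator {0<..} t *\<^sub>R (w t / (x + s + t)))"
      using int[OF x] by (simp add: set_integrable_def)
    have m: "(\<lambda>t. 1 / (x + T t)) \<in> borel_measurable lborel"
      by measurable
    have "integrable M (\<lambda>t. 1 / (x + t)) \<longleftrightarrow> integrable (density lborel (\<lambda>t. ennreal (q t))) (\<lambda>t. 1 / (x + T t))"
      unfolding M_def by (rule integrable_distr_eq[OF T_meas R_meas])
    also have "\<dots> \<longleftrightarrow> integrable lborel (\<lambda>t. q t *\<^sub>R (1 / (x + T t)))"
      using q_nonneg m by (intro integrable_density) auto
    also have "\<dots>"
      unfolding eq by (rule Bochner_Integration.integrable_add[OF i1 i2])
    finally have int_M: "integrable M (\<lambda>t. 1 / (x + t))" .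
    have "(\<integral>t. 1 / (x + t) \<partial>M) = (\<integral>t. 1 / (x + T t) \<partial>density lborel (\<lambda>t. ennreal (q t)))"
      unfolding M_def by (rule integral_distr[OF T_meas R_meas])
    also have "\<dots> = (LBINT t. q t *\<^sub>R (1 / (x + T t)))"
      using q_nonneg m by (intro integral_density) auto
    also have "\<dots> = (LBINT t. a / x * indicator {-1<..<0::real} t) + (LBINT t. indicator {0<..} t *\<^sub>R (w t / (x + s + t)))"
      unfolding eq by (rule Bochner_Integration.integral_add[OF i1 i2])
    also have "(LBINT t. a / x * indicator {-1<..<0::real} t) = a / x"
      by simp
    finally show ?thesis
      using int_M by (simp add: set_lebesgue_integral_def)
  qed
  show ?thesis
    unfolding stieltjes_function_def
  proof (intro exI[of _ 0] exI[of _ M] conjI allI impI)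
    show "sets M = sets (restrict_space borel {0::real..})"
      by (simp add: M_def R_def)
    have "space M = {0..}"
      by (simp add: M_def R_def space_restrict_space)
    then have "(\<integral>\<^sup>+ t. ennreal (1 / (1 + t)) \<partial>M) = (\<integral>\<^sup>+ t. ennreal (norm (1 / (1 + t))) \<partial>M)"
      by (intro nn_integral_cong) simp
    also have "\<dots> < \<infinity>"
      using one[of 1] by (simp add: integrable_iff_bounded)
    finally show "(\<integral>\<^sup>+ t. ennreal (1 / (1 + t)) \<partial>M) < \<infinity>" .
  qed (use one g in auto)
qed

section \<open>The value at infinity and the one-point formulas\<close>

text \<open>Stirling's formula to leading order. The induction step of the lower bound rests on
  \<open>n * ln (1 + 1 / n) \<le> 1\<close>.\<close>

lemma ln_fact_bounds:
  assumes "n > 0"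
  shows "real n * ln (real n) - real n \<le> ln (fact n)" "ln (fact n) \<le> real n * ln (real n)"
  using assms
proof (induction n rule: nat_induct_non_zero)
  case (Suc n)
  have "ln (real (Suc n)) - ln (real n) = ln (1 + 1 / real n)"
  proof -
    have "1 + 1 / real n = real (Suc n) / real n"
      using Suc.hyps by (simp add: field_simps)
    then show ?thesis
      using Suc.hyps by (simp add: ln_div)
  qed
  also have "\<dots> \<le> 1 / real n"
    by (rule ln_add_one_self_le_self) simp
  finally have "real n * (ln (real (Suc n)) - ln (real n)) \<le> real n * (1 / real n)"
    by (rule mult_left_mono) simp
  then have "real n * ln (real (Suc n)) - real n * ln (real n) \<le> 1"
    using Suc.hyps by (simp add: right_diff_distrib)
  moreover have "real n * ln (real n) \<le> real n * ln (real (Suc n))"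
    using Suc.hyps by (intro mult_left_mono) auto
  moreover have "ln (fact (Suc n)) = ln (real (Suc n)) + ln (fact n :: real)"
    using Suc.hyps by (simp add: ln_mult del: of_nat_Suc)
  moreover have "real (Suc n) * ln (real (Suc n)) = real n * ln (real (Suc n)) + ln (real (Suc n))"
    by (simp add: distrib_right)
  ultimately show "real (Suc n) * ln (real (Suc n)) - real (Suc n) \<le> ln (fact (Suc n))"
    "ln (fact (Suc n)) \<le> real (Suc n) * ln (real (Suc n))"
    using Suc.IH by linarith+
qed auto

lemma ln_fact_over_n_ln_n_tendsto:
  "(\<lambda>n. ln (fact (n + 2)) / ((2 * real n + 4) * ln (2 * real n + 4))) \<longlonglongrightarrow> 1 / 2"
proof (rule real_tendsto_sandwich)
  show "(\<lambda>n. (real (n + 2) * ln (real (n + 2)) - real (n + 2)) / ((2 * real n + 4) * ln (2 * real n + 4))) \<longlonglongrightarrow> 1 / 2"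
    by real_asymp
  show "(\<lambda>n. (real (n + 2) * ln (real (n + 2))) / ((2 * real n + 4) * ln (2 * real n + 4))) \<longlonglongrightarrow> 1 / 2"
    by real_asymp
  have pos: "(2 * real n + 4) * ln (2 * real n + 4) \<ge> 0" for n
    by (intro mult_nonneg_nonneg ln_ge_zero) auto
  show "\<forall>\<^sub>F n in sequentially. (real (n + 2) * ln (real (n + 2)) - real (n + 2)) / ((2 * real n + 4) * ln (2 * real n + 4)) \<le>
      ln (fact (n + 2)) / ((2 * real n + 4) * ln (2 * real n + 4))"
    by (intro always_eventually allI divide_right_mono pos ln_fact_bounds) simp
  show "\<forall>\<^sub>F n in sequentially. ln (fact (n + 2)) / ((2 * real n + 4) * ln (2 * real n + 4)) \<le>
      (real (n + 2) * ln (real (n + 2))) / ((2 * real n + 4) * ln (2 * real n + 4))"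
    by (intro always_eventually allI divide_right_mono pos ln_fact_bounds) simp
qed

text \<open>The source of \<open>ln (2 / sqrt pi)\<close>: the coefficient of the simple pole at
  \<open>u = 1\<close>, that is, at \<open>z = 0\<close>.\<close>

lemma ln_Gamma_three_halves: "ln_Gamma (3 / 2 :: complex) = of_real (- ln (2 / sqrt pi))"
proof -
  have "Gamma (1 / 2 + 1 :: real) = 1 / 2 * Gamma (1 / 2)"
    by (rule Gamma_plus1) (auto elim!: nonpos_Ints_cases)
  then have G: "Gamma (3 / 2 :: real) = sqrt pi / 2"
    by (simp add: Gamma_one_half_real)
  have "ln_Gamma (of_real (3 / 2) :: complex) = of_real (ln (Gamma (3 / 2)))"
    by (subst ln_Gamma_complex_of_real) (simp_all add: ln_Gamma_real_pos)
  then show ?thesis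
    unfolding G by (simp add: ln_div)
qed

context
  fixes u :: complex
  assumes u: "u \<notin> \<real>\<^sub>\<le>\<^sub>0" "u \<noteq> 1"
begin

lemma ball_one_point:
  shows ball_one_point_integrable: "set_integrable lborel {0<..} (\<lambda>t. of_real (ball_density t) / (u + of_real t))"
    and ball_one_point_formula: "ln_Gamma (1 + u / 2) / (u * Ln u) =
      1 / 2 + ln_Gamma (3 / 2) / (u - 1) - (LBINT t:{0<..}. of_real (ball_density t) / (u + of_real t))"
proof -
  \<comment> \<open>The pole at 1 is removed and the sign reversed, so that the density is
    \<open>ball_density\<close> itself and hence non-negative.\<close>
  define G where "G = (\<lambda>u::complex. ln_Gamma (3 / 2) / (u - 1) - ln_Gamma (1 + u / 2) / (u * Ln u))"
  have eq: "G u - G v = (LBINT t:{0<..}. of_real (ball_density t) * (1 / (u + of_real t) - 1 / (v + of_real t)))"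
    if "u \<notin> \<real>\<^sub>\<le>\<^sub>0" "u \<noteq> 1" "v \<notin> \<real>\<^sub>\<le>\<^sub>0" "v \<noteq> 1" for u v
    using ball_two_point_formula[OF that] by (simp add: G_def algebra_simps)
  have G_of_real: "G (of_real (2 * real n + 4)) =
      ln_Gamma (3 / 2) * of_real (1 / (2 * real n + 3)) - of_real (ln (fact (n + 2)) / ((2 * real n + 4) * ln (2 * real n + 4)))" for n
  proof -
    have "1 + complex_of_real (2 * real n + 4) / 2 = of_real (1 + real (n + 2))"
      by simp
    moreover have "ln_Gamma (complex_of_real (1 + real (n + 2))) = of_real (ln (fact (n + 2)))"
    proof -
      have "ln_Gamma (complex_of_real (1 + real (n + 2))) = of_real (ln (Gamma (1 + real (n + 2))))"
        by (subst ln_Gamma_complex_of_real) (simp_all add: ln_Gamma_real_pos)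
      then show ?thesis
        by (simp only: Gamma_fact)
    qed
    moreover have "Ln (complex_of_real (2 * real n + 4)) = of_real (ln (2 * real n + 4))"
      by (rule Ln_of_real) simp
    moreover have "complex_of_real (2 * real n + 4) - 1 = of_real (2 * real n + 3)"
      by simp
    ultimately show ?thesis
      unfolding G_def by (simp only: of_real_divide of_real_mult of_real_1 times_divide_eq_right mult_1_right)
  qed
  have "(\<lambda>n. 1 / (2 * real n + 3)) \<longlonglongrightarrow> 0"
    by real_asymp
  then have "(\<lambda>n. G (of_real (2 * real n + 4))) \<longlonglongrightarrow> ln_Gamma (3 / 2) * of_real 0 - of_real (1 / 2)"
    unfolding G_of_real by (intro tendsto_intros ln_fact_over_n_ln_n_tendsto)
  then have lim: "(\<lambda>n. G (of_real (2 * real n + 4))) \<longlonglongrightarrow> - (1 / 2)"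
    by simp
  show "set_integrable lborel {0<..} (\<lambda>t. of_real (ball_density t) / (u + of_real t))"
    by (rule one_point_integrable[OF ball_density_measurable ball_density_nonneg ball_two_point_integrable eq lim u])
  have "G u = - (1 / 2) + (LBINT t:{0<..}. of_real (ball_density t) / (u + of_real t))"
    by (rule one_point_formula[OF ball_density_measurable ball_density_nonneg ball_two_point_integrable eq lim u])
  then show "ln_Gamma (1 + u / 2) / (u * Ln u) =
      1 / 2 + ln_Gamma (3 / 2) / (u - 1) - (LBINT t:{0<..}. of_real (ball_density t) / (u + of_real t))"
    by (simp add: G_def algebra_simps)
qed

lemma inverse_Ln_one_point:
  shows inverse_Ln_one_point_integrable:
      "set_integrable lborel {0<..} (\<lambda>t. of_real (1 / ((ln t)\<^sup>2 + pi\<^sup>2)) / (u + of_real t))"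
    and inverse_Ln_one_point_formula:
      "1 / Ln u = 1 / (u - 1) + (LBINT t:{0<..}. of_real (1 / ((ln t)\<^sup>2 + pi\<^sup>2)) / (u + of_real t))"
proof -
  interpret strip_function "\<lambda>_. 1" "\<lambda>_. 1" "\<lambda>_. 1" 1
    by (rule strip_function_one)
  have density: "density t = 1 / ((ln t)\<^sup>2 + pi\<^sup>2)" for t
    by (simp add: density_def)
  define G where "G = (\<lambda>u::complex. 1 / Ln u - 1 / (u - 1))"
  have eq: "G u - G v = (LBINT t:{0<..}. of_real (density t) * (1 / (u + of_real t) - 1 / (v + of_real t)))"
    if "u \<notin> \<real>\<^sub>\<le>\<^sub>0" "u \<noteq> 1" "v \<notin> \<real>\<^sub>\<le>\<^sub>0" "v \<noteq> 1" for u v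
    using two_point_formula[OF that] by (simp add: G_def algebra_simps)
  have G_of_real: "G (of_real (2 * real n + 4)) = of_real (1 / ln (2 * real n + 4) - 1 / (2 * real n + 3))" for n
  proof -
    have "Ln (complex_of_real (2 * real n + 4)) = of_real (ln (2 * real n + 4))"
      by (rule Ln_of_real) simp
    moreover have "complex_of_real (2 * real n + 4) - 1 = of_real (2 * real n + 3)"
      by simp
    ultimately show ?thesis
      unfolding G_def by (simp only: of_real_diff of_real_divide of_real_1)
  qed
  have "(\<lambda>n. 1 / ln (2 * real n + 4) - 1 / (2 * real n + 3)) \<longlonglongrightarrow> 0"
    by real_asymp
  then have "(\<lambda>n. G (of_real (2 * real n + 4))) \<longlonglongrightarrow> of_real 0"
    unfolding G_of_real by (intro tendsto_intros)
  then have lim: "(\<lambda>n. G (of_real (2 * real n + 4))) \<longlonglongrightarrow> 0"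
    by simp
  have nonneg: "density t \<ge> 0" if "t > 0" for t
    by (simp add: density)
  have "set_integrable lborel {0<..} (\<lambda>t. of_real (density t) / (u + of_real t))"
    by (rule one_point_integrable[OF density_measurable nonneg two_point_integrable eq lim u])
  then show "set_integrable lborel {0<..} (\<lambda>t. of_real (1 / ((ln t)\<^sup>2 + pi\<^sup>2)) / (u + of_real t))"
    by (simp only: density)
  have "G u = 0 + (LBINT t:{0<..}. of_real (density t) / (u + of_real t))"
    by (rule one_point_formula[OF density_measurable nonneg two_point_integrable eq lim u])
  then have "G u = (LBINT t:{0<..}. of_real (1 / ((ln t)\<^sup>2 + pi\<^sup>2)) / (u + of_real t))"
    by (simp only: density add_0)
  then show "1 / Ln u = 1 / (u - 1) + (LBINT t:{0<..}. of_real (1 / ((ln t)\<^sup>2 + pi\<^sup>2)) / (u + of_real t))"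
    by (simp add: G_def algebra_simps)
qed

lemma log_ball_f_one_point:
  "log_ball_f u = - (1 / 2) + of_real (ln (2 / sqrt pi)) / (u - 1) + of_real (ln (sqrt pi)) / Ln u +
    (LBINT t:{0<..}. of_real (ball_density t) / (u + of_real t))"
proof -
  have "u \<noteq> 0" using u by auto
  have "log_ball_f u = of_real (ln pi / 2) / Ln u - ln_Gamma (1 + u / 2) / (u * Ln u)"
    using \<open>u \<noteq> 0\<close> by (simp add: log_ball_f_def diff_divide_distrib)
  also have "ln pi / 2 = ln (sqrt pi)"
    by (simp add: ln_sqrt)
  finally show ?thesis
    unfolding ball_one_point_formula ln_Gamma_three_halves by (simp add: algebra_simps)
qed

end

section \<open>Assembly for the argument shifted by 1\<close>

lemma real_set_integral_of_complex:
  fixes f :: "real \<Rightarrow> real"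
  assumes "set_integrable lborel S (\<lambda>t. complex_of_real (f t))"
  shows "set_integrable lborel S f"
proof -
  have "integrable lborel (\<lambda>t. complex_of_real (indicator S t *\<^sub>R f t))"
    using assms by (simp add: set_integrable_def scaleR_conv_of_real)
  then show ?thesis
    by (simp only: set_integrable_def complex_of_real_integrable_eq)
qed

text \<open>The representation of \<open>1 / ln (x + 1)\<close> itself contains
  \<open>1 / x\<close>. Weighted with \<open>ln (sqrt pi)\<close> and added to
  \<open>ln (2 / sqrt pi) / x\<close> it gives a point mass \<open>ln 2\<close> at 0; the two
  remaining densities are non-negative and are translated by 1.\<close>

lemma stieltjes_log_ball_f: "stieltjes_function (\<lambda>x. 1 / 2 + ln (ball_f (x + 1)))"
proof -
  define l where "l = (\<lambda>t::real. 1 / ((ln t)\<^sup>2 + pi\<^sup>2))"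
  define w where "w = (\<lambda>t. ball_density t + ln (sqrt pi) * l t)"
  have pi: "ln (sqrt pi) \<ge> 0"
    using pi_gt3 by (intro ln_ge_zero) simp
  have l0: "l t \<ge> 0" for t
    by (simp add: l_def)
  have [measurable]: "l \<in> borel_measurable borel"
    unfolding l_def by measurable
  have cut: "complex_of_real (x + 1) \<notin> \<real>\<^sub>\<le>\<^sub>0" "complex_of_real (x + 1) \<noteq> 1" if "x > 0" for x
    using that by (auto simp: complex_nonpos_Reals_iff)
  have c1: "of_real (ball_density t) / (of_real (x + 1) + of_real t) = complex_of_real (ball_density t / (x + 1 + t))" for x t
    by simp
  have c2: "of_real (1 / ((ln t)\<^sup>2 + pi\<^sup>2)) / (of_real (x + 1) + of_real t) = complex_of_real (l t / (x + 1 + t))" for x t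
    by (simp add: l_def)
  have i1: "set_integrable lborel {0<..} (\<lambda>t. ball_density t / (x + 1 + t))" if "x > 0" for x
    using ball_one_point_integrable[OF cut[OF that]] unfolding c1 by (rule real_set_integral_of_complex)
  have i2: "set_integrable lborel {0<..} (\<lambda>t. l t / (x + 1 + t))" if "x > 0" for x
    using inverse_Ln_one_point_integrable[OF cut[OF that]] unfolding c2 by (rule real_set_integral_of_complex)
  have w_eq: "w t / (x + 1 + t) = ball_density t / (x + 1 + t) + ln (sqrt pi) * (l t / (x + 1 + t))" for x t
    by (simp add: w_def add_divide_distrib)
  show ?thesis
  proof (rule stieltjes_functionI_density)
    show "w \<in> borel_measurable borel"
      unfolding w_def by measurable
    show "w t \<ge> 0" if "t > 0" for t
      unfolding w_def using ball_density_nonneg[OF that] pi l0 by (intro add_nonneg_nonneg mult_nonneg_nonneg)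
    show "ln 2 \<ge> (0::real)" "(1::real) \<ge> 0" by auto
    fix x :: real assume x: "x > 0"
    show "set_integrable lborel {0<..} (\<lambda>t. w t / (x + 1 + t))"
      unfolding w_eq by (intro set_integral_add set_integrable_mult_right i1 i2 x)
    have W: "(LBINT t:{0<..}. w t / (x + 1 + t)) =
        (LBINT t:{0<..}. ball_density t / (x + 1 + t)) + ln (sqrt pi) * (LBINT t:{0<..}. l t / (x + 1 + t))"
    proof -
      have i3: "set_integrable lborel {0<..} (\<lambda>t. ln (sqrt pi) * (l t / (x + 1 + t)))"
        by (intro set_integrable_mult_right i2 x)
      show ?thesis
        unfolding w_eq set_integral_add(2)[OF i1[OF x] i3] by (simp only: set_integral_mult_right)
    qed
    have Ln: "Ln (complex_of_real (x + 1)) = of_real (ln (x + 1))"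
      using x by (intro Ln_of_real) simp
    have "complex_of_real (1 / ln (x + 1)) = of_real (1 / x + (LBINT t:{0<..}. l t / (x + 1 + t)))"
      using inverse_Ln_one_point_formula[OF cut[OF x]] unfolding Ln c2 set_integral_complex_of_real by simp
    then have inv: "1 / ln (x + 1) = 1 / x + (LBINT t:{0<..}. l t / (x + 1 + t))"
      by (simp only: of_real_eq_iff)
    have "complex_of_real (ln (ball_f (x + 1))) =
        of_real (- (1 / 2) + ln (2 / sqrt pi) / x + ln (sqrt pi) * (1 / ln (x + 1)) + (LBINT t:{0<..}. ball_density t / (x + 1 + t)))"
      using log_ball_f_one_point[OF cut[OF x]] log_ball_f_of_real[of "x + 1"] x
      unfolding Ln c1 set_integral_complex_of_real by simp
    then have "ln (ball_f (x + 1)) = - (1 / 2) + ln (2 / sqrt pi) / x + ln (sqrt pi) * (1 / ln (x + 1)) +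
        (LBINT t:{0<..}. ball_density t / (x + 1 + t))"
      by (simp only: of_real_eq_iff)
    moreover have "ln (2 / sqrt pi) = ln 2 - ln (sqrt pi)"
      by (simp add: ln_div)
    ultimately show "1 / 2 + ln (ball_f (x + 1)) = ln 2 / x + (LBINT t:{0<..}. w t / (x + 1 + t))"
      unfolding W inv by (simp add: algebra_simps diff_divide_distrib)
  qed
qed

text \<open>Replacing \<open>t\<close> by \<open>t - 1\<close> turns \<open>z + 1 + t\<close> into
  \<open>z + t\<close>; the factor 1/2 is the one in \<open>ball_density\<close>.\<close>

lemma d2_shift:
  fixes z :: complex
  assumes int: "set_integrable lborel {0<..} (\<lambda>t. of_real (ball_density t) / (z + 1 + of_real t))"
  shows "set_integrable lborel {1<..} (\<lambda>t. of_real (real_of_ereal (d2 ((t - 1) / 2))) / (z + of_real t))"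
    and "(LBINT t:{0<..}. of_real (ball_density t) / (z + 1 + of_real t)) =
      1 / 2 * (LBINT t:{1<..}. of_real (real_of_ereal (d2 ((t - 1) / 2))) / (z + of_real t))"
proof -
  define h where "h = (\<lambda>t. indicator {0<..} t *\<^sub>R (of_real (ball_density t) / (z + 1 + of_real t)))"
  have eq: "h (-1 + 1 * t) = 1 / 2 * (indicator {1<..} t *\<^sub>R (of_real (real_of_ereal (d2 ((t - 1) / 2))) / (z + of_real t)))" for t
    by (simp add: h_def ball_density_def indicator_def)
  have h: "integrable lborel h"
    using int by (simp add: h_def set_integrable_def)
  have "integrable lborel (\<lambda>t. 2 * h (-1 + 1 * t))"
    by (intro integrable_mult_right lborel_integrable_real_affine h) simp
  then show "set_integrable lborel {1<..} (\<lambda>t. of_real (real_of_ereal (d2 ((t - 1) / 2))) / (z + of_real t))"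
  proof -
    have "2 * (1 / 2 * y) = y" for y :: complex
      by simp
    then show ?thesis
      using \<open>integrable lborel (\<lambda>t. 2 * h (-1 + 1 * t))\<close> by (simp only: set_integrable_def eq)
  qed
  have "(LBINT t. h t) = (LBINT t. h (-1 + 1 * t))"
    using lborel_integral_real_affine[of 1 h "-1"] by simp
  also have "\<dots> = 1 / 2 * (LBINT t:{1<..}. of_real (real_of_ereal (d2 ((t - 1) / 2))) / (z + of_real t))"
    unfolding eq set_lebesgue_integral_def by (rule integral_mult_right_zero)
  finally show "(LBINT t:{0<..}. of_real (ball_density t) / (z + 1 + of_real t)) =
      1 / 2 * (LBINT t:{1<..}. of_real (real_of_ereal (d2 ((t - 1) / 2))) / (z + of_real t))"
    by (simp add: h_def set_lebesgue_integral_def)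
qed

theorem theorem1p3:
  shows "(\<forall>z::complex. z \<notin> \<real>\<^sub>\<le>\<^sub>0 \<longrightarrow>
            set_integrable lborel {1<..}
              (\<lambda>t. of_real (real_of_ereal (d2 ((t - 1) / 2))) / (z + of_real t)) \<and>
            log_ball_f (z + 1) =
              - (1 / 2) + of_real (ln (2 / sqrt pi)) / z + of_real (ln (sqrt pi)) / ln (z + 1) +
              1 / 2 * (LBINT t:{1<..}.
                of_real (real_of_ereal (d2 ((t - 1) / 2))) / (z + of_real t))) \<and>
         stieltjes_function (\<lambda>x. 1 / 2 + ln (ball_f (x + 1))) \<and>
         completely_monotonic (\<lambda>x. ball_f (x + 1))"
proof (intro conjI allI impI)
  fix z :: complex assume z: "z \<notin> \<real>\<^sub>\<le>\<^sub>0"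
  have u: "z + 1 \<notin> \<real>\<^sub>\<le>\<^sub>0" "z + 1 \<noteq> 1"
    using z by (auto simp: complex_nonpos_Reals_iff)
  note int = ball_one_point_integrable[OF u]
  show "set_integrable lborel {1<..} (\<lambda>t. of_real (real_of_ereal (d2 ((t - 1) / 2))) / (z + of_real t))"
    by (rule d2_shift(1)[OF int])
  show "log_ball_f (z + 1) =
      - (1 / 2) + of_real (ln (2 / sqrt pi)) / z + of_real (ln (sqrt pi)) / ln (z + 1) +
      1 / 2 * (LBINT t:{1<..}. of_real (real_of_ereal (d2 ((t - 1) / 2))) / (z + of_real t))"
    unfolding log_ball_f_one_point[OF u] d2_shift(2)[OF int] by simp
next
  show "stieltjes_function (\<lambda>x. 1 / 2 + ln (ball_f (x + 1)))"
    by (rule stieltjes_log_ball_f)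
  have "completely_monotonic (\<lambda>x. exp (1 / 2 + ln (ball_f (x + 1)) + - (1 / 2)))"
    by (rule completely_monotonic_exp_stieltjes[OF stieltjes_log_ball_f])
  then show "completely_monotonic (\<lambda>x. ball_f (x + 1))"
  proof (rule completely_monotonic_cong)
    \<comment> \<open>Positivity of \<open>ball_f (x + 1)\<close> is what lets \<open>exp\<close>
      undo \<open>ln\<close>, whose values on non-positive reals would be mere defaults.\<close>
    fix x :: real assume "x > 0"
    then have "Gamma (1 + (x + 1) / 2) > 0"
      by (intro Gamma_real_pos add_pos_pos) auto
    then have "ball_f (x + 1) > 0"
      by (simp add: ball_f_def)
    then show "exp (1 / 2 + ln (ball_f (x + 1)) + - (1 / 2)) = ball_f (x + 1)"
      by simp
  qed
qed

end
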